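(* Let $R$ be a standard graded polynomial ring in $n\ge 2$ variables over a field $k$, with maximal graded ideal $\mathfrak m$. Let $M$ be a non-zero finitely generated graded $R$-module of dimension $d$ with $\operatorname{reg}(M)=\operatorname{indeg}(M)=:r$ and $H^0_{\mathfrak m}(M)=0$. Let $P_M$ be the Hilbert polynomial of $M$. Then, for every $i\ge 0$, $$\dim_k\operatorname{Tor}_i^R(M,k)=\sum_{\ell=0}^{\min\{i,d-1\}}(-1)^\ell\binom{n-\ell-1}{i-\ell}\Delta^\ell P_M(r+\ell).$$
   Context: $\operatorname{indeg}(M)=\min\{t: M_t\neq 0\}$; $\operatorname{reg}(M)=\max\{i+t : H^i_{\mathfrak m}(M)_t\neq 0\}$ is the Castelnuovo-Mumford regularity. For a polynomial $P$, $\Delta^0P=P$, $\Delta P(t):=P(t)-P(t-1)$ and $\Delta^iP:=\Delta(\Delta^{i-1}P)$. Binomial coefficients $\binom{a}{b}$ are $0$ if $a<b$. *)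

theory Defs
  imports
    "HOL-Library.Poly_Mapping"
    "HOL-Library.FuncSet"
    "HOL-Library.Cardinality"
    "HOL-Library.Extended_Real"
    "HOL-Computational_Algebra.Polynomial"
begin

section \<open>The polynomial ring\<close>

text \<open>The ring \<open>R = k[x\<^sub>i | i \<in> 'n]\<close> in \<open>CARD('n)\<close> variables. The linear order
  on the variables only serves to fix the signs in the Cech complex.\<close>

type_synonym ('n, 'k) mpoly = "('n \<Rightarrow>\<^sub>0 nat) \<Rightarrow>\<^sub>0 'k"

definition const :: "'k \<Rightarrow> ('n::finite, 'k::field) mpoly" where
  "const c = Poly_Mapping.single 0 c"

definition var :: "'n \<Rightarrow> ('n::finite, 'k::field) mpoly" where
  "var i = Poly_Mapping.single (Poly_Mapping.single i 1) 1"

definition homogeneous :: "nat \<Rightarrow> ('n::finite, 'k::field) mpoly \<Rightarrow> bool" where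
  "homogeneous e f \<longleftrightarrow>
    (\<forall>\<alpha>\<in>Poly_Mapping.keys f. (\<Sum>i\<in>UNIV. Poly_Mapping.lookup \<alpha> i) = e)"

section \<open>Finitely generated graded modules\<close>

text \<open>A module has carrier type \<open>'m\<close> and scalar multiplication \<open>sm\<close>; \<open>G t\<close> is its
  homogeneous component of degree \<open>t\<close>. The last clause states that the module is the
  (internal) direct sum of the \<open>G t\<close>.\<close>

definition graded_module ::
  "(('n::finite, 'k::field) mpoly \<Rightarrow> 'm::ab_group_add \<Rightarrow> 'm) \<Rightarrow> (int \<Rightarrow> 'm set) \<Rightarrow> bool" where
  "graded_module sm G \<longleftrightarrow> module sm
    \<and> (\<forall>t. 0 \<in> G t \<and> (\<forall>x\<in>G t. \<forall>y\<in>G t. x - y \<in> G t))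
    \<and> (\<forall>e t f. homogeneous e f \<longrightarrow> (\<forall>x\<in>G t. sm f x \<in> G (t + int e)))
    \<and> (\<forall>x. \<exists>!c :: int \<Rightarrow>\<^sub>0 'm. (\<forall>t. Poly_Mapping.lookup c t \<in> G t)
          \<and> x = (\<Sum>t\<in>Poly_Mapping.keys c. Poly_Mapping.lookup c t))"

definition finitely_generated :: "('r::comm_ring_1 \<Rightarrow> 'm::ab_group_add \<Rightarrow> 'm) \<Rightarrow> bool" where
  "finitely_generated sm \<longleftrightarrow> (\<exists>B. finite B \<and> module.span sm B = UNIV)"

text \<open>The value is \<open>\<infinity>\<close> for the zero module and an integer for every other
  finitely generated graded module.\<close>

definition indeg :: "(int \<Rightarrow> 'm::ab_group_add set) \<Rightarrow> ereal" where
  "indeg G = (INF t\<in>{t. G t \<noteq> {0}}. ereal (real_of_int t))"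

definition annihilator :: "('r::comm_ring_1 \<Rightarrow> 'm::ab_group_add \<Rightarrow> 'm) \<Rightarrow> 'r set" where
  "annihilator sm = {f. \<forall>x. sm f x = 0}"

definition prime_ideal :: "'r::comm_ring_1 set \<Rightarrow> bool" where
  "prime_ideal I \<longleftrightarrow> module.subspace (*) I \<and> I \<noteq> UNIV
    \<and> (\<forall>a b. a * b \<in> I \<longrightarrow> a \<in> I \<or> b \<in> I)"

text \<open>The Krull dimension of \<open>R / Ann M\<close>, for \<open>M \<noteq> 0\<close>.\<close>

definition krull_dim :: "('r::comm_ring_1 \<Rightarrow> 'm::ab_group_add \<Rightarrow> 'm) \<Rightarrow> enat" where
  "krull_dim sm = (SUP l\<in>{l. \<exists>P. (\<forall>j\<le>l. prime_ideal (P j) \<and> annihilator sm \<subseteq> P j)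
                             \<and> (\<forall>j<l. P j \<subset> P (Suc j))}. enat l)"

section \<open>Hilbert polynomial\<close>

definition kscale :: "(('n::finite, 'k::field) mpoly \<Rightarrow> 'm \<Rightarrow> 'm) \<Rightarrow> 'k \<Rightarrow> 'm \<Rightarrow> 'm" where
  "kscale sm c = sm (const c)"

definition hilbert_function ::
  "(('n::finite, 'k::field) mpoly \<Rightarrow> 'm::ab_group_add \<Rightarrow> 'm) \<Rightarrow> (int \<Rightarrow> 'm set) \<Rightarrow> int \<Rightarrow> nat" where
  "hilbert_function sm G t = vector_space.dim (kscale sm) (G t)"

definition hilbert_poly ::
  "(('n::finite, 'k::field) mpoly \<Rightarrow> 'm::ab_group_add \<Rightarrow> 'm) \<Rightarrow> (int \<Rightarrow> 'm set) \<Rightarrow> rat poly" where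
  "hilbert_poly sm G =
    (THE P. \<forall>\<^sub>F t in at_top. poly P (of_int t) = of_nat (hilbert_function sm G t))"

definition backward_diff :: "'a::comm_ring_1 poly \<Rightarrow> 'a poly" where
  "backward_diff P = P - pcompose P [:-1, 1:]"

section \<open>Local cohomology and regularity\<close>

text \<open>The element \<open>m / f\<^sup>a\<close> of the localization \<open>M\<^sub>f\<close>, as the equivalence class
  of the pair \<open>(m, a)\<close>.\<close>

definition fraction :: "('r::comm_ring_1 \<Rightarrow> 'm::ab_group_add \<Rightarrow> 'm) \<Rightarrow> 'r \<Rightarrow> 'm \<Rightarrow> nat \<Rightarrow> ('m \<times> nat) set" where
  "fraction sm f m a = {(m', b). \<exists>c. sm (f ^ c) (sm (f ^ b) m) = sm (f ^ c) (sm (f ^ a) m')}"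

definition var_prod :: "'n set \<Rightarrow> ('n::finite, 'k::field) mpoly" where
  "var_prod S = (\<Prod>i\<in>S. var i)"

text \<open>\<open>H\<^sup>p\<^sub>\<mm>(M)\<close> is the cohomology of the Cech complex
  \<open>C\<^sup>p = \<Oplus>\<^bsub>|S| = p\<^esub> M\<^bsub>x_S\<^esub>\<close> on the variables, where \<open>x_S\<close> is the product of the variables
  in \<open>S\<close>. All maps are homogeneous of degree 0, so \<open>H\<^sup>p\<^sub>\<mm>(M)\<^sub>t\<close> is computed by the
  degree \<open>t\<close> strand; \<open>m / x_S\<^sup>a\<close> has degree \<open>deg m - a |S|\<close>.\<close>

definition cech_cochains ::
  "(('n::{finite,linorder}, 'k::field) mpoly \<Rightarrow> 'm::ab_group_add \<Rightarrow> 'm) \<Rightarrow> (int \<Rightarrow> 'm set)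
    \<Rightarrow> nat \<Rightarrow> int \<Rightarrow> ('n set \<Rightarrow> ('m \<times> nat) set) set" where
  "cech_cochains sm G p t =
    (\<Pi>\<^sub>E S\<in>{S. card S = p}. {fraction sm (var_prod S) m a | m a. m \<in> G (t + int a * int p)})"

definition cech_zero ::
  "(('n::{finite,linorder}, 'k::field) mpoly \<Rightarrow> 'm::ab_group_add \<Rightarrow> 'm)
    \<Rightarrow> nat \<Rightarrow> 'n set \<Rightarrow> ('m \<times> nat) set" where
  "cech_zero sm p = (\<lambda>S\<in>{S. card S = p}. fraction sm (var_prod S) 0 0)"

text \<open>The component at \<open>T\<close> is \<open>\<Sum>\<^bsub>i\<in>T\<^esub> \<plusminus> c (T - {i})\<close> in \<open>M\<^bsub>x_T\<^esub>\<close>. The summands are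
  written over a common exponent \<open>a\<close>, and \<open>m / x_S\<^sup>a\<close> with \<open>S = T - {i}\<close> is mapped to
  \<open>x\<^sub>i\<^sup>a m / x_T\<^sup>a\<close> by the localization map.\<close>

definition cech_diff ::
  "(('n::{finite,linorder}, 'k::field) mpoly \<Rightarrow> 'm::ab_group_add \<Rightarrow> 'm)
    \<Rightarrow> nat \<Rightarrow> ('n set \<Rightarrow> ('m \<times> nat) set) \<Rightarrow> 'n set \<Rightarrow> ('m \<times> nat) set" where
  "cech_diff sm p c = (\<lambda>T\<in>{T. card T = Suc p}.
     THE z. \<exists>m a. (\<forall>i\<in>T. c (T - {i}) = fraction sm (var_prod (T - {i})) (m i) a)
       \<and> z = fraction sm (var_prod T) (\<Sum>i\<in>T. sm ((-1) ^ card {j\<in>T. j < i} * var i ^ a) (m i)) a)"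

definition cech_cocycles ::
  "(('n::{finite,linorder}, 'k::field) mpoly \<Rightarrow> 'm::ab_group_add \<Rightarrow> 'm) \<Rightarrow> (int \<Rightarrow> 'm set)
    \<Rightarrow> nat \<Rightarrow> int \<Rightarrow> ('n set \<Rightarrow> ('m \<times> nat) set) set" where
  "cech_cocycles sm G p t = {c \<in> cech_cochains sm G p t. cech_diff sm p c = cech_zero sm (Suc p)}"

fun cech_coboundaries ::
  "(('n::{finite,linorder}, 'k::field) mpoly \<Rightarrow> 'm::ab_group_add \<Rightarrow> 'm) \<Rightarrow> (int \<Rightarrow> 'm set)
    \<Rightarrow> nat \<Rightarrow> int \<Rightarrow> ('n set \<Rightarrow> ('m \<times> nat) set) set" where
  "cech_coboundaries sm G 0 t = {cech_zero sm 0}"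
| "cech_coboundaries sm G (Suc p) t = cech_diff sm p ` cech_cochains sm G p t"

text \<open>\<open>H\<^sup>p\<^sub>\<mm>(M)\<^sub>t = 0\<close>.\<close>

definition local_cohomology_vanishes ::
  "(('n::{finite,linorder}, 'k::field) mpoly \<Rightarrow> 'm::ab_group_add \<Rightarrow> 'm) \<Rightarrow> (int \<Rightarrow> 'm set)
    \<Rightarrow> nat \<Rightarrow> int \<Rightarrow> bool" where
  "local_cohomology_vanishes sm G p t \<longleftrightarrow> cech_cocycles sm G p t = cech_coboundaries sm G p t"

text \<open>A finite supremum of a set of integers is attained, so this is the maximum
  whenever the maximum exists (which it does for finitely generated \<open>M \<noteq> 0\<close>).\<close>

definition regularity ::
  "(('n::{finite,linorder}, 'k::field) mpoly \<Rightarrow> 'm::ab_group_add \<Rightarrow> 'm) \<Rightarrow> (int \<Rightarrow> 'm set) \<Rightarrow> ereal" where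
  "regularity sm G =
    (SUP (p, t)\<in>{(p, t). \<not> local_cohomology_vanishes sm G p t}. ereal (real_of_int (int p + t)))"

section \<open>Tor\<close>

definition free_scale :: "'r::comm_ring_1 \<Rightarrow> ('b \<Rightarrow>\<^sub>0 'r) \<Rightarrow> ('b \<Rightarrow>\<^sub>0 'r)" where
  "free_scale a v = Poly_Mapping.map ((*) a) v"

text \<open>A free resolution \<open>\<dots> \<rightarrow> F\<^sub>1 \<rightarrow> F\<^sub>0 \<rightarrow> M \<rightarrow> 0\<close> with maps \<open>d i : F\<^bsub>i+1\<^esub> \<rightarrow> F\<^sub>i\<close>
  and augmentation \<open>\<epsilon>\<close>. All \<open>F\<^sub>i\<close> are taken to be \<open>R\<^sup>(\<^sup>\<nat>\<^sup>)\<close>: every countably generated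
  module over a polynomial ring over a field has such a resolution (a submodule of \<open>R\<^sup>(\<^sup>\<nat>\<^sup>)\<close> has
  countable dimension over the field), and Tor does not depend on the resolution.\<close>

definition free_resolution ::
  "('r::comm_ring_1 \<Rightarrow> 'm::ab_group_add \<Rightarrow> 'm)
    \<Rightarrow> (nat \<Rightarrow> (nat \<Rightarrow>\<^sub>0 'r) \<Rightarrow> (nat \<Rightarrow>\<^sub>0 'r)) \<Rightarrow> ((nat \<Rightarrow>\<^sub>0 'r) \<Rightarrow> 'm) \<Rightarrow> bool" where
  "free_resolution sm d \<epsilon> \<longleftrightarrow>
     (\<forall>i. module_hom free_scale free_scale (d i)) \<and> module_hom free_scale sm \<epsilon>
   \<and> surj \<epsilon> \<and> range (d 0) = {v. \<epsilon> v = 0} \<and> (\<forall>i. range (d (Suc i)) = {v. d i v = 0})"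

text \<open>\<open>A \<otimes> B\<close> is the free module on \<open>A \<times> B\<close> modulo the submodule \<open>tensor_relations\<close>;
  \<open>tensor_map f\<close> is the map of free modules inducing \<open>f \<otimes> id\<close>.\<close>

definition tensor_relations ::
  "('r::comm_ring_1 \<Rightarrow> 'a::ab_group_add \<Rightarrow> 'a) \<Rightarrow> ('r \<Rightarrow> 'b::ab_group_add \<Rightarrow> 'b)
    \<Rightarrow> ('a \<times> 'b \<Rightarrow>\<^sub>0 'r) set" where
  "tensor_relations sa sb = (let e = (\<lambda>x y. Poly_Mapping.single (x, y) (1::'r)) in
     module.span free_scale
      ({e (x + x') y - e x y - e x' y | x x' y. True}
     \<union> {e x (y + y') - e x y - e x y' | x y y'. True}
     \<union> {e (sa a x) y - free_scale a (e x y) | a x y. True}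
     \<union> {e x (sb a y) - free_scale a (e x y) | a x y. True}))"

definition tensor_map :: "('a \<Rightarrow> 'c) \<Rightarrow> ('a \<times> 'b \<Rightarrow>\<^sub>0 'r::comm_ring_1) \<Rightarrow> ('c \<times> 'b \<Rightarrow>\<^sub>0 'r)" where
  "tensor_map f z =
    (\<Sum>(x, y)\<in>Poly_Mapping.keys z. Poly_Mapping.single (f x, y) (Poly_Mapping.lookup z (x, y)))"

text \<open>Preimages, in the free module on \<open>F\<^sub>i \<times> N\<close>, of the cycles and the boundaries of
  \<open>F \<otimes> N\<close> in homological degree \<open>i\<close>.\<close>

fun tor_cycles ::
  "(nat \<Rightarrow> (nat \<Rightarrow>\<^sub>0 'r::comm_ring_1) \<Rightarrow> (nat \<Rightarrow>\<^sub>0 'r)) \<Rightarrow> ('r \<Rightarrow> 'b::ab_group_add \<Rightarrow> 'b)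
    \<Rightarrow> nat \<Rightarrow> ((nat \<Rightarrow>\<^sub>0 'r) \<times> 'b \<Rightarrow>\<^sub>0 'r) set" where
  "tor_cycles d sn 0 = UNIV"
| "tor_cycles d sn (Suc i) = {z. tensor_map (d i) z \<in> tensor_relations free_scale sn}"

definition tor_boundaries ::
  "(nat \<Rightarrow> (nat \<Rightarrow>\<^sub>0 'r::comm_ring_1) \<Rightarrow> (nat \<Rightarrow>\<^sub>0 'r)) \<Rightarrow> ('r \<Rightarrow> 'b::ab_group_add \<Rightarrow> 'b)
    \<Rightarrow> nat \<Rightarrow> ((nat \<Rightarrow>\<^sub>0 'r) \<times> 'b \<Rightarrow>\<^sub>0 'r) set" where
  "tor_boundaries d sn i =
    {tensor_map (d i) w + z | w z. z \<in> tensor_relations free_scale sn}"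

text \<open>The dimension of the quotient space \<open>Z / W\<close>, if finite: \<open>B\<close> ranges over the finite sets
  of representatives of the elements of a basis of \<open>Z / W\<close>.\<close>

definition quotient_dim :: "('k::field \<Rightarrow> 'v::ab_group_add \<Rightarrow> 'v) \<Rightarrow> 'v set \<Rightarrow> 'v set \<Rightarrow> nat" where
  "quotient_dim s Z W = (THE n. \<exists>B. finite B \<and> card B = n \<and> B \<subseteq> Z
     \<and> \<not> module.dependent s B \<and> module.span s B \<inter> W = {0} \<and> module.span s (B \<union> W) = Z)"

text \<open>The action of \<open>R\<close> on \<open>k = R / \<mm>\<close>.\<close>

definition residue_scale :: "('n::finite, 'k::field) mpoly \<Rightarrow> 'k \<Rightarrow> 'k" where
  "residue_scale f c = Poly_Mapping.lookup f 0 * c"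

text \<open>\<open>dim\<^sub>k Tor\<^sub>i(M, k)\<close>.\<close>

definition tor_dim ::
  "(('n::finite, 'k::field) mpoly \<Rightarrow> 'm::ab_group_add \<Rightarrow> 'm) \<Rightarrow> nat \<Rightarrow> nat" where
  "tor_dim sm i = (let d = (SOME d. \<exists>\<epsilon>. free_resolution sm d \<epsilon>) in
     quotient_dim (kscale free_scale) (tor_cycles d residue_scale i)
       (tor_boundaries d residue_scale i))"

end

theory Submission
  imports Defs "HOL-Library.Function_Algebras" "HOL-Library.Landau_Symbols"
begin

text \<open>
  Shifting along the syzygies of a free resolution identifies \<open>Tor\<^sub>i(M, k)\<close> with the Koszul homology
  \<open>H\<^sub>i(x; M)\<close>. A diagram chase in the double complex formed by the Cech and the Koszul complex shows
  that vanishing of \<open>H\<^sup>p\<^sub>\<mm>(M)\<^sub>t\<close> for \<open>p + t > r\<close> makes the Koszul complex exact wherever the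
  coefficients have degree \<open>> r\<close>. As \<open>M\<close> lives in degrees \<open>\<ge> r\<close>, only coefficients of degree \<open>r\<close>
  contribute, and the Betti numbers are the Euler characteristics
  \<open>\<beta>\<^sub>i = \<Sum>\<^sub>q (-1)\<^sup>q (n choose i-q) H\<^sub>M(r+q)\<close>. They vanish for \<open>i \<ge> n\<close> because the socle lies in
  \<open>H\<^sup>0\<^sub>\<mm>(M) = 0\<close>; this says that the \<open>n\<close>-th difference of \<open>H\<^sub>M\<close> vanishes from \<open>r\<close> on, so \<open>H\<^sub>M = P\<^sub>M\<close>
  there, and expanding at \<open>r\<close> in differences turns the sum into the stated one, with \<open>n\<close> in place of
  \<open>d\<close>. Finally \<open>deg P\<^sub>M < d\<close>: \<open>H\<^sub>M\<close> is bounded by Hilbert functions of quotients \<open>R/Ann(g)\<close>, and if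
  \<open>R/I\<close> grows like a polynomial of degree \<open>e\<close>, then a chain of \<open>e + 1\<close> strict inclusions of primes
  lies above \<open>I\<close>.
\<close>

section \<open>Dimensions of quotient spaces\<close>

definition independent_mod ::
  "('k::field \<Rightarrow> 'v::ab_group_add \<Rightarrow> 'v) \<Rightarrow> 'v set \<Rightarrow> nat \<Rightarrow> (nat \<Rightarrow> 'v) \<Rightarrow> bool" where
  "independent_mod s W n b \<longleftrightarrow> (\<forall>c. (\<Sum>i<n. s (c i) (b i)) \<in> W \<longrightarrow> (\<forall>i<n. c i = 0))"

lemma independent_modD:
  "independent_mod s W n b \<Longrightarrow> (\<Sum>i<n. s (c i) (b i)) \<in> W \<Longrightarrow> i < n \<Longrightarrow> c i = 0"
  by (simp add: independent_mod_def)

definition spanning_mod ::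
  "('k::field \<Rightarrow> 'v::ab_group_add \<Rightarrow> 'v) \<Rightarrow> 'v set \<Rightarrow> 'v set \<Rightarrow> nat \<Rightarrow> (nat \<Rightarrow> 'v) \<Rightarrow> bool" where
  "spanning_mod s Z W n b \<longleftrightarrow> (\<forall>z\<in>Z. \<exists>c. z - (\<Sum>i<n. s (c i) (b i)) \<in> W)"

text \<open>In contrast to \<open>quotient_dim\<close>, bases are indexed families, which can be lifted along linear
  maps without injectivity conditions, and \<open>W\<close> need not be contained in \<open>Z\<close>: the notion depends
  on \<open>Z \<inter> W\<close> only.\<close>

definition has_quotient_dim ::
  "('k::field \<Rightarrow> 'v::ab_group_add \<Rightarrow> 'v) \<Rightarrow> 'v set \<Rightarrow> 'v set \<Rightarrow> nat \<Rightarrow> bool" where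
  "has_quotient_dim s Z W n \<longleftrightarrow>
    (\<exists>b. (\<forall>i<n. b i \<in> Z) \<and> independent_mod s W n b \<and> spanning_mod s Z W n b)"

lemma has_quotient_dimE:
  assumes "has_quotient_dim s Z W n"
  obtains b where "\<And>i. i < n \<Longrightarrow> b i \<in> Z" "independent_mod s W n b" "spanning_mod s Z W n b"
  using assms unfolding has_quotient_dim_def by blast

lemma (in module) subspace_mem_cong:
  assumes "subspace W" "x - y \<in> W"
  shows "x \<in> W \<longleftrightarrow> y \<in> W"
  using subspace_add[OF assms, of y] subspace_diff[OF assms(1) _ assms(2), of x] by auto

context vector_space
begin

lemma independent_mod_mono: "independent_mod scale W n b \<Longrightarrow> V \<subseteq> W \<Longrightarrow> independent_mod scale V n b"
  unfolding independent_mod_def by blast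

lemma independent_mod_zero_inj_on:
  assumes "independent_mod scale {0} n b"
  shows "inj_on b {..<n}"
proof (rule inj_onI, rule ccontr)
  fix i j assume ij: "i \<in> {..<n}" "j \<in> {..<n}" "b i = b j" "i \<noteq> j"
  define c where "c = (\<lambda>k. if k = i then 1 else if k = j then -1 else (0::'a))"
  have "(\<Sum>k<n. scale (c k) (b k)) = (\<Sum>k\<in>{i, j}. scale (c k) (b k))"
    using ij by (intro sum.mono_neutral_right) (auto simp: c_def)
  also have "\<dots> = 0" using ij by (simp add: c_def)
  finally have "(\<Sum>k<n. scale (c k) (b k)) \<in> {0}" by simp
  then have "c i = 0" using ij by (intro independent_modD[OF assms]) auto
  then show False by (simp add: c_def)
qed

lemma independent_mod_zero_independent:
  assumes "independent_mod scale {0} n b"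
  shows "independent (b ` {..<n})"
proof (rule independent_if_scalars_zero)
  fix f x assume "(\<Sum>x\<in>b ` {..<n}. scale (f x) x) = 0" and x: "x \<in> b ` {..<n}"
  then have "(\<Sum>i<n. scale (f (b i)) (b i)) \<in> {0}"
    by (simp add: sum.reindex[OF independent_mod_zero_inj_on[OF assms]])
  then show "f x = 0" using independent_modD[OF assms, of "\<lambda>i. f (b i)"] x by auto
qed simp

lemma independent_mod_zero_le_card:
  assumes ind: "independent_mod scale {0} n b" and "finite T" "\<And>i. i < n \<Longrightarrow> b i \<in> span T"
  shows "n \<le> card T"
proof -
  have "b ` {..<n} \<subseteq> span T" using assms(3) by blast
  then have "card (b ` {..<n}) \<le> card T"
    using independent_span_bound[OF \<open>finite T\<close> independent_mod_zero_independent[OF ind]] by blast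
  then show ?thesis by (simp add: card_image independent_mod_zero_inj_on[OF ind])
qed

lemma independent_mod_cong:
  assumes W: "subspace W" and "\<And>i. i < n \<Longrightarrow> b i - b' i \<in> W"
  shows "independent_mod scale W n b \<longleftrightarrow> independent_mod scale W n b'"
proof -
  have "(\<Sum>i<n. scale (c i) (b i)) - (\<Sum>i<n. scale (c i) (b' i)) \<in> W" for c
    unfolding sum_subtractf[symmetric] scale_right_diff_distrib[symmetric]
    using assms by (intro subspace_sum subspace_scale) auto
  then have "(\<Sum>i<n. scale (c i) (b i)) \<in> W \<longleftrightarrow> (\<Sum>i<n. scale (c i) (b' i)) \<in> W" for c
    by (rule subspace_mem_cong[OF W])
  then show ?thesis by (simp add: independent_mod_def)
qed

lemma independent_mod_le_spanning_mod:
  assumes W: "subspace W" and Z: "\<And>i. i < n \<Longrightarrow> b i \<in> Z"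
    and ind: "independent_mod scale W n b" and spn: "spanning_mod scale Z W m b'"
  shows "n \<le> m"
proof -
  have "\<forall>i. \<exists>c. i < n \<longrightarrow> b i - (\<Sum>j<m. scale (c j) (b' j)) \<in> W"
    using Z spn unfolding spanning_mod_def by blast
  then obtain c where c: "\<And>i. i < n \<Longrightarrow> b i - (\<Sum>j<m. scale (c i j) (b' j)) \<in> W" by metis
  define v where "v i = (\<Sum>j<m. scale (c i j) (b' j))" for i
  have "independent_mod scale W n v"
    using ind independent_mod_cong[OF W, of n b v] c by (simp add: v_def)
  then have "independent_mod scale {0} n v"
    by (rule independent_mod_mono) (simp add: subspace_0[OF W])
  moreover have "v i \<in> span (b' ` {..<m})" for i
    unfolding v_def by (intro span_sum span_scale span_base) auto
  ultimately have "n \<le> card (b' ` {..<m})" by (intro independent_mod_zero_le_card) auto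
  also have "\<dots> \<le> m" using card_image_le[of "{..<m}" b'] by simp
  finally show ?thesis .
qed

lemma has_quotient_dim_unique:
  assumes "subspace W" "has_quotient_dim scale Z W n" "has_quotient_dim scale Z W m"
  shows "n = m"
  using assms unfolding has_quotient_dim_def by (meson antisym independent_mod_le_spanning_mod)

lemma has_quotient_dim_imp_basis:
  assumes Z: "subspace Z" and W: "subspace W" and "W \<subseteq> Z" and "has_quotient_dim scale Z W n"
  obtains B where "finite B" "card B = n" "B \<subseteq> Z" "independent B"
    "span B \<inter> W = {0}" "span (B \<union> W) = Z"
proof -
  obtain b where b: "\<And>i. i < n \<Longrightarrow> b i \<in> Z"
    and ind: "independent_mod scale W n b" and spn: "spanning_mod scale Z W n b"
    using assms(4) by (rule has_quotient_dimE) blast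
  let ?B = "b ` {..<n}"
  have ind0: "independent_mod scale {0} n b"
    using independent_mod_mono[OF ind] subspace_0[OF W] by simp
  note inj = independent_mod_zero_inj_on[OF ind0]
  have "x = 0" if x: "x \<in> span ?B" "x \<in> W" for x
  proof -
    obtain u where "x = (\<Sum>v\<in>?B. scale (u v) v)" using x(1) span_finite[of ?B] by auto
    then have u: "x = (\<Sum>i<n. scale (u (b i)) (b i))" by (simp add: sum.reindex[OF inj])
    then have "u (b i) = 0" if "i < n" for i
      using independent_modD[OF ind, of "\<lambda>i. u (b i)"] x(2) that by simp
    then show "x = 0" using u by simp
  qed
  then have "span ?B \<inter> W = {0}" using span_zero subspace_0[OF W] by blast
  moreover have "span (?B \<union> W) = Z"
  proof
    show "span (?B \<union> W) \<subseteq> Z" using b \<open>W \<subseteq> Z\<close> by (intro span_minimal Z) auto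
    show "Z \<subseteq> span (?B \<union> W)"
    proof
      fix z assume "z \<in> Z"
      then obtain c where "z - (\<Sum>i<n. scale (c i) (b i)) \<in> W" using spn by (auto simp: spanning_mod_def)
      then have "z - (\<Sum>i<n. scale (c i) (b i)) \<in> span (?B \<union> W)" by (intro span_base) auto
      moreover have "(\<Sum>i<n. scale (c i) (b i)) \<in> span (?B \<union> W)"
        by (intro span_sum span_scale span_base) auto
      ultimately show "z \<in> span (?B \<union> W)" using span_add by fastforce
    qed
  qed
  moreover have "card ?B = n" using inj by (simp add: card_image)
  moreover have "?B \<subseteq> Z" using b by blast
  ultimately show ?thesis using that[of ?B] independent_mod_zero_independent[OF ind0] by simp
qed

lemma has_quotient_dim_basis:
  assumes W: "subspace W" and "finite B" "B \<subseteq> Z" "independent B"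
    and "span B \<inter> W = {0}" "span (B \<union> W) = Z"
  shows "has_quotient_dim scale Z W (card B)"
proof -
  obtain b where "bij_betw b {..<card B} B"
    using ex_bij_betw_nat_finite[OF \<open>finite B\<close>] by (auto simp: atLeast0LessThan)
  then have inj: "inj_on b {..<card B}" and B: "b ` {..<card B} = B" by (auto simp: bij_betw_def)
  have sum_B: "(\<Sum>i<card B. scale (u (b i)) (b i)) = (\<Sum>v\<in>B. scale (u v) v)" for u
    using sum.reindex[OF inj, of "\<lambda>v. scale (u v) v"] B by simp
  have "independent_mod scale W (card B) b"
    unfolding independent_mod_def
  proof (intro allI impI)
    fix c i assume c: "(\<Sum>i<card B. scale (c i) (b i)) \<in> W" and i: "i < card B"
    define u where "u v = c (inv_into {..<card B} b v)" for v
    have u: "u (b j) = c j" if "j < card B" for j using inj that by (simp add: u_def)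
    have "(\<Sum>v\<in>B. scale (u v) v) \<in> W" using c sum_B[of u] by (simp add: u)
    moreover have "(\<Sum>v\<in>B. scale (u v) v) \<in> span B" by (intro span_sum span_scale span_base)
    ultimately have "(\<Sum>v\<in>B. scale (u v) v) = 0" using assms(5) by blast
    then have "u (b i) = 0" using independentD[OF \<open>independent B\<close> \<open>finite B\<close>] i B by blast
    then show "c i = 0" using u i by simp
  qed
  moreover have "spanning_mod scale Z W (card B) b"
    unfolding spanning_mod_def
  proof
    fix z assume "z \<in> Z"
    then obtain x y where xy: "z = x + y" "x \<in> span B" "y \<in> W"
      using assms(6) span_Un[of B W] span_eq_iff[THEN iffD2, OF W] by auto
    then obtain u where "x = (\<Sum>v\<in>B. scale (u v) v)" using span_finite[OF \<open>finite B\<close>] by auto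
    then have "z - (\<Sum>i<card B. scale (u (b i)) (b i)) \<in> W" using xy sum_B[of u] by simp
    then show "\<exists>c. z - (\<Sum>i<card B. scale (c i) (b i)) \<in> W" by (rule exI[of _ "\<lambda>i. u (b i)"])
  qed
  ultimately show ?thesis unfolding has_quotient_dim_def using B \<open>B \<subseteq> Z\<close> by blast
qed

lemma quotient_dim_eqI:
  assumes "subspace Z" and W: "subspace W" and "W \<subseteq> Z" and n: "has_quotient_dim scale Z W n"
  shows "quotient_dim scale Z W = n"
  unfolding quotient_dim_def
proof (rule the_equality)
  show "\<exists>B. finite B \<and> card B = n \<and> B \<subseteq> Z \<and> independent B \<and> span B \<inter> W = {0} \<and> span (B \<union> W) = Z"
    by (rule has_quotient_dim_imp_basis[OF assms]) blast
next
  fix m assume "\<exists>B. finite B \<and> card B = m \<and> B \<subseteq> Z \<and> independent B \<and> span B \<inter> W = {0} \<and> span (B \<union> W) = Z"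
  then show "m = n" using has_quotient_dim_basis[OF W] has_quotient_dim_unique[OF W] n by blast
qed

lemma dim_eq_if_has_quotient_dim:
  assumes Z: "subspace Z" and n: "has_quotient_dim scale Z {0} n"
  shows "dim Z = n"
proof -
  have "{0} \<subseteq> Z" using subspace_0[OF Z] by simp
  from has_quotient_dim_imp_basis[OF Z subspace_single_0 this n]
  obtain B where "finite B" "card B = n" "B \<subseteq> Z" "independent B" "span (B \<union> {0}) = Z" .
  then show ?thesis by (intro dim_unique[of B]) auto
qed

lemma has_quotient_dim_0: "Z \<subseteq> W \<Longrightarrow> has_quotient_dim scale Z W 0"
  unfolding has_quotient_dim_def independent_mod_def spanning_mod_def by auto

lemma has_quotient_dim_trans:
  assumes Z: "subspace Z" and V: "subspace V" and "W \<subseteq> V"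
    and "has_quotient_dim scale Z V m" and "has_quotient_dim scale (Z \<inter> V) W n"
  shows "has_quotient_dim scale Z W (m + n)"
proof -
  obtain f where f: "\<And>i. i < m \<Longrightarrow> f i \<in> Z"
    and ind_f: "independent_mod scale V m f" and spn_f: "spanning_mod scale Z V m f"
    using assms(4) by (rule has_quotient_dimE) blast
  obtain g where g: "\<And>i. i < n \<Longrightarrow> g i \<in> Z" "\<And>i. i < n \<Longrightarrow> g i \<in> V"
    and ind_g: "independent_mod scale W n g" and spn_g: "spanning_mod scale (Z \<inter> V) W n g"
    using assms(5) by (rule has_quotient_dimE) blast
  define h where "h i = (if i < m then f i else g (i - m))" for i
  have sum_h: "(\<Sum>i<m + n. scale (c i) (h i))
      = (\<Sum>i<m. scale (c i) (f i)) + (\<Sum>i<n. scale (c (m + i)) (g i))" for c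
    by (induction n) (simp_all add: h_def add.assoc)
  have gV: "(\<Sum>i<n. scale (c i) (g i)) \<in> V" for c using g(2) V by (intro subspace_sum subspace_scale) auto
  have "h i \<in> Z" if "i < m + n" for i
    using that f g(1)[of "i - m"] by (auto simp: h_def)
  moreover have "independent_mod scale W (m + n) h"
    unfolding independent_mod_def
  proof (intro allI impI)
    fix c i assume c: "(\<Sum>i<m + n. scale (c i) (h i)) \<in> W" and i: "i < m + n"
    have "(\<Sum>i<m. scale (c i) (f i)) \<in> V"
      using c \<open>W \<subseteq> V\<close> gV subspace_diff[OF V] unfolding sum_h by (metis add_diff_cancel_right' subsetD)
    then have c_f: "c i = 0" if "i < m" for i using independent_modD[OF ind_f] that by blast
    then have "(\<Sum>i<n. scale (c (m + i)) (g i)) \<in> W" using c unfolding sum_h by simp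
    then have "c (m + i) = 0" if "i < n" for i
      using independent_modD[OF ind_g, of "\<lambda>i. c (m + i)"] that by blast
    then show "c i = 0" using c_f i by (metis add_diff_inverse_nat nat_add_left_cancel_less)
  qed
  moreover have "spanning_mod scale Z W (m + n) h"
    unfolding spanning_mod_def
  proof
    fix z assume z: "z \<in> Z"
    then obtain c where "z - (\<Sum>i<m. scale (c i) (f i)) \<in> V" using spn_f by (auto simp: spanning_mod_def)
    moreover have "z - (\<Sum>i<m. scale (c i) (f i)) \<in> Z"
      using z f by (intro subspace_diff subspace_sum subspace_scale Z) auto
    ultimately obtain c' where c': "z - (\<Sum>i<m. scale (c i) (f i)) - (\<Sum>i<n. scale (c' i) (g i)) \<in> W"
      using spn_g by (auto simp: spanning_mod_def)
    define e where "e i = (if i < m then c i else c' (i - m))" for i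
    have "z - (\<Sum>i<m + n. scale (e i) (h i)) \<in> W"
      using c' unfolding sum_h by (simp add: e_def diff_diff_add)
    then show "\<exists>c. z - (\<Sum>i<m + n. scale (c i) (h i)) \<in> W" by blast
  qed
  ultimately show ?thesis unfolding has_quotient_dim_def by blast
qed

lemma independent_mod_extend:
  assumes W: "subspace W" and ind: "independent_mod scale W n b"
    and z: "\<And>c. z - (\<Sum>i<n. scale (c i) (b i)) \<notin> W"
  shows "independent_mod scale W (Suc n) (b(n := z))"
  unfolding independent_mod_def
proof (intro allI impI)
  fix c i assume "(\<Sum>i<Suc n. scale (c i) ((b(n := z)) i)) \<in> W" and i: "i < Suc n"
  then have c: "(\<Sum>i<n. scale (c i) (b i)) + scale (c n) z \<in> W" by simp
  have "c n = 0"
  proof (rule ccontr)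
    assume "c n \<noteq> 0"
    then have "scale (1 / c n) ((\<Sum>i<n. scale (c i) (b i)) + scale (c n) z)
        = z - (\<Sum>i<n. scale (- (c i / c n)) (b i))"
      by (simp add: scale_right_distrib scale_sum_right sum_negf)
    then show False using subspace_scale[OF W c, of "1 / c n"] z[of "\<lambda>i. - (c i / c n)"] by simp
  qed
  moreover from this have "c i = 0" if "i < n" for i
    using c independent_modD[OF ind _ that] by simp
  ultimately show "c i = 0" using i by (auto simp: less_Suc_eq)
qed

lemma has_quotient_dim_exists:
  assumes W: "subspace W" and T: "finite T" "Z \<subseteq> span T"
  obtains n where "has_quotient_dim scale Z W n"
proof -
  define independent_family where
    "independent_family n \<longleftrightarrow> (\<exists>b. (\<forall>i<n. b i \<in> Z) \<and> independent_mod scale W n b)" for n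
  have bound: "n \<le> card T" if n: "independent_family n" for n
  proof -
    obtain b where "\<forall>i<n. b i \<in> Z" "independent_mod scale {0} n b"
      using n independent_mod_mono subspace_0[OF W] unfolding independent_family_def by blast
    then show ?thesis using T by (intro independent_mod_zero_le_card[of n b]) auto
  qed
  have "independent_family 0" by (simp add: independent_family_def independent_mod_def)
  then obtain n where "independent_family n" and maximal: "\<And>m. independent_family m \<Longrightarrow> m \<le> n"
    using bound Nat.ex_has_greatest_nat[of independent_family 0 "card T"] by blast
  then obtain b where b: "\<And>i. i < n \<Longrightarrow> b i \<in> Z" "independent_mod scale W n b"
    unfolding independent_family_def by blast
  have "spanning_mod scale Z W n b"
    unfolding spanning_mod_def
  proof (rule ballI, rule ccontr)
    fix z assume z: "z \<in> Z" and "\<nexists>c. z - (\<Sum>i<n. scale (c i) (b i)) \<in> W"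
    then have "independent_mod scale W (Suc n) (b(n := z))" using b
      by (intro independent_mod_extend W) auto
    then have "independent_family (Suc n)" using b(1) z
      unfolding independent_family_def by (intro exI[of _ "b(n := z)"]) (auto simp: less_Suc_eq)
    then show False using maximal by fastforce
  qed
  then show ?thesis using b that unfolding has_quotient_dim_def by blast
qed

end

lemma mod_bases_linear_iff:
  assumes f: "Vector_Spaces.linear s s' f"
    and Z: "module.subspace s Z" and W': "module.subspace s' W'"
    and into: "\<And>z. z \<in> Z \<Longrightarrow> f z \<in> Z'"
    and onto: "\<And>z'. z' \<in> Z' \<Longrightarrow> \<exists>z\<in>Z. z' - f z \<in> W'"
    and preimage: "\<And>z. z \<in> Z \<Longrightarrow> f z \<in> W' \<longleftrightarrow> z \<in> W"
    and b: "\<And>i. i < n \<Longrightarrow> b i \<in> Z" and b': "\<And>i. i < n \<Longrightarrow> b' i - f (b i) \<in> W'"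
  shows "independent_mod s W n b \<longleftrightarrow> independent_mod s' W' n b'"
    and "spanning_mod s Z W n b \<longleftrightarrow> spanning_mod s' Z' W' n b'"
proof -
  interpret f: Vector_Spaces.linear s s' f by fact
  have sum_Z: "(\<Sum>i<n. s (c i) (b i)) \<in> Z" for c
    using b Z by (intro f.vs1.subspace_sum f.vs1.subspace_scale) auto
  have sum_W': "(\<Sum>i<n. s' (c i) (b' i)) - f (\<Sum>i<n. s (c i) (b i)) \<in> W'" for c
    unfolding f.sum f.scale sum_subtractf[symmetric] f.vs2.scale_right_diff_distrib[symmetric]
    using b' W' by (intro f.vs2.subspace_sum f.vs2.subspace_scale) auto
  have mem_iff: "z' - (\<Sum>i<n. s' (c i) (b' i)) \<in> W' \<longleftrightarrow> z - (\<Sum>i<n. s (c i) (b i)) \<in> W"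
    if z: "z \<in> Z" "z' - f z \<in> W'" for z z' c
  proof -
    have "(z' - (\<Sum>i<n. s' (c i) (b' i))) - f (z - (\<Sum>i<n. s (c i) (b i))) \<in> W'"
      using f.vs2.subspace_diff[OF W' z(2) sum_W'[of c]] by (simp add: f.diff algebra_simps)
    then show ?thesis
      using preimage[OF f.vs1.subspace_diff[OF Z z(1) sum_Z[of c]]] f.vs2.subspace_mem_cong[OF W']
      by blast
  qed
  show "independent_mod s W n b \<longleftrightarrow> independent_mod s' W' n b'"
    unfolding independent_mod_def preimage[OF sum_Z, symmetric]
    using f.vs2.subspace_mem_cong[OF W' sum_W'] by simp
  show "spanning_mod s Z W n b \<longleftrightarrow> spanning_mod s' Z' W' n b'"
  proof
    assume "spanning_mod s Z W n b"
    then show "spanning_mod s' Z' W' n b'" using onto mem_iff unfolding spanning_mod_def by meson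
  next
    assume "spanning_mod s' Z' W' n b'"
    moreover have "f z - f z \<in> W'" for z using f.vs2.subspace_0[OF W'] by simp
    ultimately show "spanning_mod s Z W n b" using into mem_iff unfolding spanning_mod_def by meson
  qed
qed

text \<open>The hypotheses say that \<open>f\<close> induces an isomorphism from \<open>Z / W\<close> to \<open>Z' / W'\<close>.\<close>

lemma has_quotient_dim_linear_iff:
  assumes f: "Vector_Spaces.linear s s' f"
    and Z: "module.subspace s Z" and W': "module.subspace s' W'"
    and into: "\<And>z. z \<in> Z \<Longrightarrow> f z \<in> Z'"
    and onto: "\<And>z'. z' \<in> Z' \<Longrightarrow> \<exists>z\<in>Z. z' - f z \<in> W'"
    and preimage: "\<And>z. z \<in> Z \<Longrightarrow> f z \<in> W' \<longleftrightarrow> z \<in> W"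
  shows "has_quotient_dim s Z W n \<longleftrightarrow> has_quotient_dim s' Z' W' n"
proof
  interpret f: Vector_Spaces.linear s s' f by fact
  note bases_iff = mod_bases_linear_iff[OF f Z W' into onto preimage]
  {
    assume "has_quotient_dim s Z W n"
    then obtain b where b: "\<And>i. i < n \<Longrightarrow> b i \<in> Z" "independent_mod s W n b" "spanning_mod s Z W n b"
      by (rule has_quotient_dimE) blast
    have "f (b i) - f (b i) \<in> W'" for i using f.vs2.subspace_0[OF W'] by simp
    with b have "independent_mod s' W' n (\<lambda>i. f (b i))" "spanning_mod s' Z' W' n (\<lambda>i. f (b i))"
      using bases_iff[of n b "\<lambda>i. f (b i)"] by blast+
    then show "has_quotient_dim s' Z' W' n"
      unfolding has_quotient_dim_def using b(1) into by (intro exI[of _ "\<lambda>i. f (b i)"]) simp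
  next
    assume "has_quotient_dim s' Z' W' n"
    then obtain b' where b': "\<And>i. i < n \<Longrightarrow> b' i \<in> Z'"
        "independent_mod s' W' n b'" "spanning_mod s' Z' W' n b'"
      by (rule has_quotient_dimE) blast
    then have "\<forall>i. \<exists>z. i < n \<longrightarrow> z \<in> Z \<and> b' i - f z \<in> W'" using onto by blast
    then obtain b where b: "\<And>i. i < n \<Longrightarrow> b i \<in> Z" "\<And>i. i < n \<Longrightarrow> b' i - f (b i) \<in> W'" by metis
    then have "independent_mod s W n b" "spanning_mod s Z W n b"
      using bases_iff[of n b b'] b'(2,3) by simp_all
    then show "has_quotient_dim s Z W n"
      unfolding has_quotient_dim_def using b(1) by (intro exI[of _ b]) simp
  }
qed

section \<open>Koszul complexes\<close>

definition fun_scale :: "('r \<Rightarrow> 'm \<Rightarrow> 'm) \<Rightarrow> 'r \<Rightarrow> ('u \<Rightarrow> 'm) \<Rightarrow> 'u \<Rightarrow> 'm" where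
  "fun_scale s c w = (\<lambda>U. s c (w U))"

lemma fun_scale_apply [simp]: "fun_scale s c w U = s c (w U)"
  by (simp add: fun_scale_def)

lemma module_fun_scale: "module s \<Longrightarrow> module (fun_scale s)"
  by (auto simp: module_def fun_eq_iff)

lemma sum_fun_apply: "(\<Sum>i\<in>A. f i) U = (\<Sum>i\<in>A. f i U)"
  by (induction A rule: infinite_finite_induct) simp_all

definition koszul_sign :: "'n::linorder \<Rightarrow> 'n set \<Rightarrow> 'r::comm_ring_1" where
  "koszul_sign i U = (-1) ^ card {j\<in>U. j < i}"

lemma koszul_sign_square [simp]: "koszul_sign i U * koszul_sign i U = 1"
  by (simp add: koszul_sign_def flip: power_mult_distrib)

lemma koszul_sign_cases: "koszul_sign i U = (1 :: 'r::comm_ring_1) \<or> koszul_sign i U = (-1 :: 'r)"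
  unfolding koszul_sign_def by (metis neg_one_even_power neg_one_odd_power)

lemma koszul_sign_insert:
  fixes U :: "'n::{finite,linorder} set"
  assumes "j \<notin> U"
  shows "koszul_sign i (insert j U)
      = (if j < i then - koszul_sign i U else koszul_sign i U :: 'r::comm_ring_1)"
proof -
  have "{k \<in> insert j U. k < i} = (if j < i then insert j {k\<in>U. k < i} else {k\<in>U. k < i})" by auto
  then show ?thesis using assms by (auto simp: koszul_sign_def)
qed

lemma koszul_sign_remove:
  fixes U :: "'n::{finite,linorder} set"
  assumes "j \<in> U"
  shows "koszul_sign i (U - {j})
      = (if j < i then - koszul_sign i U else koszul_sign i U :: 'r::comm_ring_1)"
  using koszul_sign_insert[of j "U - {j}" i, where 'r = 'r] assms
  by (cases "j < i") (simp_all add: insert_absorb)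

text \<open>A function \<open>w\<close> on sets of variables stands for the element \<open>\<Sum>\<^sub>U w U e\<^sub>U\<close> of the exterior
  algebra with coefficients in a module.\<close>

definition wedge ::
  "('r::comm_ring_1 \<Rightarrow> 'm::ab_group_add \<Rightarrow> 'm) \<Rightarrow> 'n::{finite,linorder} \<Rightarrow> ('n set \<Rightarrow> 'm) \<Rightarrow> 'n set \<Rightarrow> 'm" where
  "wedge sm i w U = (if i \<in> U then sm (koszul_sign i U) (w (U - {i})) else 0)"

definition contract ::
  "('r::comm_ring_1 \<Rightarrow> 'm::ab_group_add \<Rightarrow> 'm) \<Rightarrow> 'n::{finite,linorder} \<Rightarrow> ('n set \<Rightarrow> 'm) \<Rightarrow> 'n set \<Rightarrow> 'm" where
  "contract sm i w U = (if i \<in> U then 0 else sm (koszul_sign i U) (w (insert i U)))"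

definition koszul_diff ::
  "('r::comm_ring_1 \<Rightarrow> 'm::ab_group_add \<Rightarrow> 'm) \<Rightarrow> ('n::{finite,linorder} \<Rightarrow> 'r) \<Rightarrow> ('n set \<Rightarrow> 'm) \<Rightarrow> 'n set
      \<Rightarrow> 'm" where
  "koszul_diff sm y w = (\<Sum>i\<in>UNIV. fun_scale sm (y i) (contract sm i w))"

definition koszul_codiff ::
  "('r::comm_ring_1 \<Rightarrow> 'm::ab_group_add \<Rightarrow> 'm) \<Rightarrow> ('n::{finite,linorder} \<Rightarrow> 'r) \<Rightarrow> ('n set \<Rightarrow> 'm) \<Rightarrow> 'n set
      \<Rightarrow> 'm" where
  "koszul_codiff sm y w = (\<Sum>i\<in>UNIV. fun_scale sm (y i) (wedge sm i w))"

lemma sum_alternating_eq_0: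
  fixes g :: "'i \<Rightarrow> 'i \<Rightarrow> 'v::ab_group_add"
  assumes "finite A" and "\<And>i. g i i = 0" and antisym: "\<And>i j. g i j = - g j i"
  shows "(\<Sum>i\<in>A. \<Sum>j\<in>A. g i j) = 0"
  using \<open>finite A\<close>
proof (induction A)
  case (insert a A)
  have "(\<Sum>i\<in>A. g i a) = (\<Sum>i\<in>A. - g a i)" by (intro sum.cong refl antisym)
  then show ?case using insert by (simp add: sum.distrib sum_negf assms(2))
qed simp

context module
begin

lemma module_hom_fun:
  assumes "\<And>u w. f (u + w) = f u + f w" and "\<And>a w. f (fun_scale scale a w) = fun_scale scale a (f w)"
  shows "module_hom (fun_scale scale) (fun_scale scale) f"
  by (intro module_hom.intro module_hom_axioms.intro module_fun_scale module_axioms assms)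

lemma module_hom_wedge: "module_hom (fun_scale scale) (fun_scale scale) (wedge scale i)"
  by (rule module_hom_fun) (auto simp: wedge_def fun_eq_iff scale_right_distrib mult.commute)

lemma module_hom_contract: "module_hom (fun_scale scale) (fun_scale scale) (contract scale i)"
  by (rule module_hom_fun) (auto simp: contract_def fun_eq_iff scale_right_distrib mult.commute)

lemma wedge_wedge_same: "wedge scale i (wedge scale i w) = 0"
  by (simp add: wedge_def fun_eq_iff)

lemma wedge_wedge_swap: "wedge scale i (wedge scale j w) = - wedge scale j (wedge scale i w)"
proof (cases "i = j")
  case False
  have commute: "U - {i} - {j} = U - {j} - {i}" for U by blast
  consider "i < j" "\<not> j < i" | "j < i" "\<not> i < j" using False by fastforce
  then show ?thesis
    by cases (simp_all add: wedge_def fun_eq_iff koszul_sign_remove commute mult.commute)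
qed (simp add: wedge_wedge_same)

lemma contract_contract_same: "contract scale i (contract scale i w) = 0"
  by (simp add: contract_def fun_eq_iff)

lemma contract_contract_swap:
  "contract scale i (contract scale j w) = - contract scale j (contract scale i w)"
  by (cases i j rule: linorder_cases)
    (auto simp: contract_def fun_eq_iff koszul_sign_insert insert_commute mult.commute)

lemma contract_wedge:
  "contract scale i (wedge scale j w) = (if i = j then w else 0) - wedge scale j (contract scale i w)"
proof (cases i j rule: linorder_cases)
  case equal
  then show ?thesis
    by (auto simp: contract_def wedge_def fun_eq_iff koszul_sign_insert koszul_sign_remove insert_absorb)
qed (auto simp: contract_def wedge_def fun_eq_iff koszul_sign_insert koszul_sign_remove
    insert_Diff_if mult.commute)

lemma koszul_diff_apply:
  "koszul_diff scale y w U = (\<Sum>i\<in>- U. scale (koszul_sign i U * y i) (w (insert i U)))"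
  unfolding koszul_diff_def sum_fun_apply
  by (rule sum.mono_neutral_cong_right) (auto simp: contract_def mult.commute)

lemma koszul_codiff_apply:
  "koszul_codiff scale y w T = (\<Sum>i\<in>T. scale (koszul_sign i T * y i) (w (T - {i})))"
  unfolding koszul_codiff_def sum_fun_apply
  by (rule sum.mono_neutral_cong_right) (auto simp: wedge_def mult.commute)

lemma module_hom_koszul_diff: "module_hom (fun_scale scale) (fun_scale scale) (koszul_diff scale y)"
  by (rule module_hom_fun)
    (simp_all add: fun_eq_iff koszul_diff_apply scale_right_distrib sum.distrib scale_sum_right
        mult.commute)

lemmas koszul_diff_0 [simp] = module_hom.zero[OF module_hom_koszul_diff]
  and koszul_diff_add = module_hom.add[OF module_hom_koszul_diff]
  and koszul_diff_diff = module_hom.diff[OF module_hom_koszul_diff]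
  and koszul_diff_sum = module_hom.sum[OF module_hom_koszul_diff]
  and koszul_diff_scale = module_hom.scale[OF module_hom_koszul_diff]

lemma module_hom_koszul_codiff: "module_hom (fun_scale scale) (fun_scale scale) (koszul_codiff scale y)"
  by (rule module_hom_fun)
    (simp_all add: fun_eq_iff koszul_codiff_apply scale_right_distrib sum.distrib scale_sum_right
        mult.commute)

lemma koszul_diff_koszul_diff: "koszul_diff scale y (koszul_diff scale y w) = 0"
proof -
  interpret contract: module_hom "fun_scale scale" "fun_scale scale" "contract scale i" for i
    by (rule module_hom_contract)
  have "koszul_diff scale y (koszul_diff scale y w)
      = (\<Sum>i\<in>UNIV. \<Sum>j\<in>UNIV. fun_scale scale (y i * y j) (contract scale i (contract scale j w)))"
    by (simp add: koszul_diff_def contract.sum contract.scale contract.m1.scale_sum_right)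
  also have "\<dots> = 0"
  proof (rule sum_alternating_eq_0)
    show "fun_scale scale (y i * y j) (contract scale i (contract scale j w))
        = - fun_scale scale (y j * y i) (contract scale j (contract scale i w))" for i j
      by (subst contract_contract_swap) (simp add: mult.commute contract.m1.scale_minus_right)
  qed (simp_all add: contract_contract_same)
  finally show ?thesis .
qed

lemma koszul_codiff_koszul_codiff: "koszul_codiff scale y (koszul_codiff scale y w) = 0"
proof -
  interpret wedge: module_hom "fun_scale scale" "fun_scale scale" "wedge scale i" for i
    by (rule module_hom_wedge)
  have "koszul_codiff scale y (koszul_codiff scale y w)
      = (\<Sum>i\<in>UNIV. \<Sum>j\<in>UNIV. fun_scale scale (y i * y j) (wedge scale i (wedge scale j w)))"
    by (simp add: koszul_codiff_def wedge.sum wedge.scale wedge.m1.scale_sum_right)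
  also have "\<dots> = 0"
  proof (rule sum_alternating_eq_0)
    show "fun_scale scale (y i * y j) (wedge scale i (wedge scale j w))
        = - fun_scale scale (y j * y i) (wedge scale j (wedge scale i w))" for i j
      by (subst wedge_wedge_swap) (simp add: mult.commute wedge.m1.scale_minus_right)
  qed (simp_all add: wedge_wedge_same)
  finally show ?thesis .
qed

lemma koszul_diff_wedge:
  "koszul_diff scale y (wedge scale i w)
      = fun_scale scale (y i) w - wedge scale i (koszul_diff scale y w)"
proof -
  interpret wedge: module_hom "fun_scale scale" "fun_scale scale" "wedge scale i"
    by (rule module_hom_wedge)
  have "koszul_diff scale y (wedge scale i w)
      = (\<Sum>j\<in>UNIV. fun_scale scale (y j) (if j = i then w else 0))
        - wedge scale i (koszul_diff scale y w)"
    by (simp add: koszul_diff_def contract_wedge wedge.m1.scale_right_diff_distrib sum_subtractf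
        wedge.sum wedge.scale)
  also have "(\<Sum>j\<in>UNIV. fun_scale scale (y j) (if j = i then w else 0)) = fun_scale scale (y i) w"
    by (subst sum.mono_neutral_right[of _ "{i}"]) auto
  finally show ?thesis .
qed

end

lemma koszul_diff_module_hom:
  assumes "module_hom s s' f"
  shows "koszul_diff s' y (\<lambda>U. f (w U)) = (\<lambda>U. f (koszul_diff s y w U))"
proof -
  interpret module_hom s s' f by fact
  show ?thesis by (simp add: fun_eq_iff m1.koszul_diff_apply m2.koszul_diff_apply sum scale)
qed

lemma koszul_codiff_module_hom:
  assumes "module_hom s s' f"
  shows "koszul_codiff s' y (\<lambda>U. f (w U)) = (\<lambda>U. f (koszul_codiff s y w U))"
proof -
  interpret module_hom s s' f by fact
  show ?thesis by (simp add: fun_eq_iff m1.koszul_codiff_apply m2.koszul_codiff_apply sum scale)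
qed

definition koszul_chains :: "'m::zero set \<Rightarrow> nat \<Rightarrow> ('n set \<Rightarrow> 'm) set" where
  "koszul_chains N q = {w. \<forall>U. w U \<in> N \<and> (card U \<noteq> q \<longrightarrow> w U = 0)}"

definition koszul_cycles ::
  "('r::comm_ring_1 \<Rightarrow> 'm::ab_group_add \<Rightarrow> 'm) \<Rightarrow> ('n::{finite,linorder} \<Rightarrow> 'r) \<Rightarrow> 'm set \<Rightarrow> nat
      \<Rightarrow> ('n set \<Rightarrow> 'm) set" where
  "koszul_cycles sm y N q = {w \<in> koszul_chains N q. koszul_diff sm y w = 0}"

definition koszul_boundaries ::
  "('r::comm_ring_1 \<Rightarrow> 'm::ab_group_add \<Rightarrow> 'm) \<Rightarrow> ('n::{finite,linorder} \<Rightarrow> 'r) \<Rightarrow> 'm set \<Rightarrow> nat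
      \<Rightarrow> ('n set \<Rightarrow> 'm) set" where
  "koszul_boundaries sm y N q = koszul_diff sm y ` koszul_chains N (Suc q)"

context module
begin

lemma subspace_koszul_chains:
  assumes "subspace N"
  shows "module.subspace (fun_scale scale) (koszul_chains N q)"
  by (rule module.subspaceI[OF module_fun_scale[OF module_axioms]])
    (use assms in \<open>auto simp: koszul_chains_def subspace_0 subspace_add subspace_scale\<close>)

lemma koszul_diff_in_chains_degree:
  "w \<in> koszul_chains N (Suc q) \<Longrightarrow> card U \<noteq> q \<Longrightarrow> koszul_diff scale y w U = 0"
  unfolding koszul_diff_apply by (intro sum.neutral) (auto simp: koszul_chains_def)

lemma koszul_diff_chains:
  assumes "subspace N" and w: "w \<in> koszul_chains N (Suc q)"
  shows "koszul_diff scale y w \<in> koszul_chains N q"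
proof -
  have "koszul_diff scale y w U \<in> N" for U
    unfolding koszul_diff_apply using assms
    by (intro subspace_sum subspace_scale) (auto simp: koszul_chains_def)
  then show ?thesis using koszul_diff_in_chains_degree[OF w] by (simp add: koszul_chains_def)
qed

lemma koszul_cycles_0: "koszul_cycles scale y N 0 = koszul_chains N 0"
  by (auto simp: koszul_cycles_def koszul_chains_def fun_eq_iff koszul_diff_apply intro!: sum.neutral)

lemma wedge_chains:
  assumes "w \<in> koszul_chains UNIV q"
  shows "wedge scale i w \<in> koszul_chains UNIV (Suc q)"
proof -
  have "w (U - {i}) = 0" if "i \<in> U" "card U \<noteq> Suc q" for U
    using that assms card_Suc_Diff1[of U i] by (auto simp: koszul_chains_def)
  then show ?thesis by (simp add: koszul_chains_def wedge_def)
qed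

text \<open>If every \<open>y i\<close> can be divided off by an operator \<open>D i\<close> that is linear over the other \<open>y j\<close>,
  then \<open>w \<mapsto> e\<^sub>i \<and> D\<^sub>i w\<close> is a homotopy between the identity and a map that kills all components
  involving \<open>e\<^sub>i\<close>.\<close>

lemma koszul_homotopy:
  fixes y :: "'n::{finite,linorder} \<Rightarrow> 'a"
  assumes D_add: "\<And>u v. D (u + v) = D u + D v"
    and D_other: "\<And>j v. i \<noteq> j \<Longrightarrow> D (scale (y j) v) = scale (y j) (D v)"
    and D_same: "\<And>v. D (scale (y i) v) = v"
  shows "koszul_diff scale y (wedge scale i (D \<circ> w)) + wedge scale i (D \<circ> koszul_diff scale y w)
    = w - contract scale i (wedge scale i (w - fun_scale scale (y i) (D \<circ> w)))"
proof -
  interpret D: additive D by unfold_locales (rule D_add)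
  interpret wedge: module_hom "fun_scale scale" "fun_scale scale" "wedge scale i"
    by (rule module_hom_wedge)
  interpret contract: module_hom "fun_scale scale" "fun_scale scale" "contract scale i"
    by (rule module_hom_contract)
  let ?v = "w - fun_scale scale (y i) (D \<circ> w)"
  have D_sign: "D (scale (koszul_sign j U) x) = scale (koszul_sign j U) (D x)"
    for j and U :: "'n set" and x
    using koszul_sign_cases[of j U, where 'r = 'a] by (auto simp: D.minus)
  have D_contract: "D (scale (y j) (contract scale j w U))
      = scale (y j) (contract scale j (D \<circ> w) U) + (if j = i then contract scale i ?v U else 0)" for j U
    by (auto simp: contract_def D_other D_same D_sign D.zero scale_right_diff_distrib mult.commute)
  have "D \<circ> koszul_diff scale y w = koszul_diff scale y (D \<circ> w) + contract scale i ?v"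
  proof
    fix U
    have "(D \<circ> koszul_diff scale y w) U = (\<Sum>j\<in>UNIV. D (scale (y j) (contract scale j w U)))"
      by (simp add: koszul_diff_def sum_fun_apply D.sum)
    then show "(D \<circ> koszul_diff scale y w) U = (koszul_diff scale y (D \<circ> w) + contract scale i ?v) U"
      by (simp add: D_contract sum.distrib koszul_diff_def sum_fun_apply)
  qed
  then show ?thesis by (simp add: koszul_diff_wedge contract_wedge wedge.add)
qed

lemma koszul_homotopy_cycle:
  fixes y :: "'n::{finite,linorder} \<Rightarrow> 'a"
  assumes D_add: "\<And>u v. D (u + v) = D u + D v"
    and D_other: "\<And>j v. i \<noteq> j \<Longrightarrow> D (scale (y j) v) = scale (y j) (D v)"
    and D_same: "\<And>v. D (scale (y i) v) = v"
    and "koszul_diff scale y v = 0" and "i \<in> U \<or> v U = 0"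
  shows "(v - koszul_diff scale y (wedge scale i (D \<circ> v))) U = 0"
proof -
  interpret D: additive D by unfold_locales (rule D_add)
  have "wedge scale i (D \<circ> 0) = 0" by (simp add: fun_eq_iff wedge_def D.zero)
  then have "v - koszul_diff scale y (wedge scale i (D \<circ> v))
      = contract scale i (wedge scale i (v - fun_scale scale (y i) (D \<circ> v)))"
    using koszul_homotopy[of D i y v, OF D_add D_other D_same] by (simp add: assms(4) algebra_simps)
  then show ?thesis using assms(5) by (auto simp: contract_def wedge_def D.zero)
qed

lemma koszul_acyclic:
  fixes D :: "'n::{finite,linorder} \<Rightarrow> 'b \<Rightarrow> 'b"
  assumes D_add: "\<And>i u v. D i (u + v) = D i u + D i v"
    and D_other: "\<And>i j v. i \<noteq> j \<Longrightarrow> D i (scale (y j) v) = scale (y j) (D i v)"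
    and D_same: "\<And>i v. D i (scale (y i) v) = v"
    and w: "w \<in> koszul_cycles scale y UNIV q" and "q > 0"
  shows "w \<in> koszul_boundaries scale y UNIV q"
proof -
  interpret D: additive "D i" for i by unfold_locales (rule D_add)
  have "\<exists>u\<in>koszul_chains UNIV (Suc q). \<forall>U. U \<inter> A \<noteq> {} \<longrightarrow> (w - koszul_diff scale y u) U = 0"
    if "finite A" for A :: "'n set"
    using that
  proof (induction A)
    case empty
    show ?case by (intro bexI[of _ 0]) (auto simp: koszul_chains_def)
  next
    case (insert i A)
    then obtain u where u: "u \<in> koszul_chains UNIV (Suc q)"
      and vanish: "\<And>U. U \<inter> A \<noteq> {} \<Longrightarrow> (w - koszul_diff scale y u) U = 0" by blast
    define v where "v = w - koszul_diff scale y u"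
    have "v \<in> koszul_chains UNIV q"
      using w koszul_diff_chains[OF subspace_UNIV u, of y]
      by (auto simp: v_def koszul_cycles_def koszul_chains_def)
    then have "D i \<circ> v \<in> koszul_chains UNIV q" by (auto simp: koszul_chains_def D.zero)
    then have "wedge scale i (D i \<circ> v) \<in> koszul_chains UNIV (Suc q)" by (rule wedge_chains)
    then have chain: "u + wedge scale i (D i \<circ> v) \<in> koszul_chains UNIV (Suc q)"
      using u by (auto simp: koszul_chains_def)
    have "koszul_diff scale y v = 0"
      using w by (simp add: v_def koszul_cycles_def koszul_diff_diff koszul_diff_koszul_diff)
    then have "(v - koszul_diff scale y (wedge scale i (D i \<circ> v))) U = 0" if "U \<inter> insert i A \<noteq> {}" for U
      using that vanish[of U] by (intro koszul_homotopy_cycle D_add D_other D_same) (auto simp: v_def)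
    moreover have "w - koszul_diff scale y (u + wedge scale i (D i \<circ> v))
        = v - koszul_diff scale y (wedge scale i (D i \<circ> v))"
      by (simp add: koszul_diff_add v_def)
    ultimately show ?case using chain by metis
  qed
  from this[of UNIV] obtain u where u: "u \<in> koszul_chains UNIV (Suc q)"
    and vanish: "\<And>U. U \<noteq> {} \<Longrightarrow> (w - koszul_diff scale y u) U = 0" by auto
  moreover have "(w - koszul_diff scale y u) {} = 0"
    using w \<open>q > 0\<close> koszul_diff_in_chains_degree[OF u, of "{}" y]
    by (simp add: koszul_cycles_def koszul_chains_def)
  ultimately have "w - koszul_diff scale y u = 0" by (metis ext zero_fun_apply)
  then show ?thesis unfolding koszul_boundaries_def using u by auto
qed

end

section \<open>The polynomial ring and its modules\<close>

abbreviation "keys \<equiv> Poly_Mapping.keys"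
abbreviation "lookup \<equiv> Poly_Mapping.lookup"
abbreviation "single \<equiv> Poly_Mapping.single"

lemma poly_mapping_eq_sum_single: "v = (\<Sum>j\<in>keys v. single j (lookup v j))"
proof (rule poly_mapping_eqI)
  fix k
  have "(\<Sum>j\<in>keys v. lookup (single j (lookup v j)) k) = (\<Sum>j\<in>keys v. if j = k then lookup v j else 0)"
    by (intro sum.cong) (auto simp: lookup_single when_def)
  also have "\<dots> = lookup v k" by (auto simp: in_keys_iff)
  finally show "lookup v k = lookup (\<Sum>j\<in>keys v. single j (lookup v j)) k"
    by (simp add: lookup_sum)
qed

lemma additive_eqI_single:
  assumes "additive f" "additive g" and single: "\<And>j a. f (single j a) = g (single j a)"
  shows "f v = g v"
proof -
  interpret f: additive f by fact
  interpret g: additive g by fact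
  have "f (\<Sum>j\<in>keys v. single j (lookup v j)) = g (\<Sum>j\<in>keys v. single j (lookup v j))"
    by (simp add: f.sum g.sum single)
  then show ?thesis by (simp flip: poly_mapping_eq_sum_single)
qed

lemma const_add: "const (a + b) = const a + const b"
  by (simp add: const_def single_add)

lemma const_mult: "const (a * b) = const a * const b"
  by (simp add: const_def mult_single)

lemma const_one [simp]: "const 1 = 1"
  by (simp add: const_def)

lemma const_mult_single [simp]: "const a * single \<alpha> b = single \<alpha> (a * b)"
  by (simp add: const_def mult_single)

lemma lookup_const_0 [simp]: "lookup (const c) 0 = c"
  by (simp add: const_def)

lemma lookup_const_mult: "lookup (const c * f) \<alpha> = c * lookup f \<alpha>"
  by (simp add: const_def when_def Poly_Mapping.map.rep_eq flip: mult_map_scale_conv_mult)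

lemma vector_space_kscale:
  assumes "module sm"
  shows "vector_space (kscale sm)"
proof -
  interpret module sm by fact
  show ?thesis
    by unfold_locales (simp_all add: kscale_def const_add const_mult scale_right_distrib
        scale_left_distrib)
qed

lemma linear_kscale:
  assumes "module_hom s s' f"
  shows "Vector_Spaces.linear (kscale s) (kscale s') f"
proof -
  interpret module_hom s s' f by fact
  interpret v: vector_space "kscale s" by (rule vector_space_kscale) unfold_locales
  interpret v': vector_space "kscale s'" by (rule vector_space_kscale) unfold_locales
  show ?thesis by unfold_locales (simp_all add: add scale kscale_def)
qed

lemma subspace_kscale:
  assumes "module sm" "module.subspace sm N"
  shows "module.subspace (kscale sm) N"
proof -
  interpret module sm by fact
  interpret v: vector_space "kscale sm" by (rule vector_space_kscale) fact
  show ?thesis using assms(2)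
    by (intro v.subspaceI) (auto simp: kscale_def subspace_0 subspace_add subspace_scale)
qed

lemma kscale_fun_scale: "kscale (fun_scale sm) = fun_scale (kscale sm)"
  by (simp add: kscale_def fun_eq_iff)

lemma module_mult: "module ((*) :: 'r::comm_ring_1 \<Rightarrow> 'r \<Rightarrow> 'r)"
  by unfold_locales (auto simp: algebra_simps)

definition irrelevant_mult ::
  "(('n::finite, 'k::field) mpoly \<Rightarrow> 'm::ab_group_add \<Rightarrow> 'm) \<Rightarrow> 'm set \<Rightarrow> 'm set" where
  "irrelevant_mult sm N = {\<Sum>i\<in>UNIV. sm (var i) (v i) | v. \<forall>i. v i \<in> N}"

lemma irrelevant_multI: "(\<And>i. v i \<in> N) \<Longrightarrow> (\<Sum>i\<in>UNIV. sm (var i) (v i)) \<in> irrelevant_mult sm N"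
  unfolding irrelevant_mult_def by blast

lemma irrelevant_multE:
  assumes "x \<in> irrelevant_mult sm N"
  obtains v where "x = (\<Sum>i\<in>UNIV. sm (var i) (v i))" "\<And>i. v i \<in> N"
  using assms unfolding irrelevant_mult_def by blast

lemma irrelevant_mult_mono: "N \<subseteq> N' \<Longrightarrow> irrelevant_mult sm N \<subseteq> irrelevant_mult sm N'"
  unfolding irrelevant_mult_def by blast

lemma irrelevant_mult_image:
  assumes "module_hom s s' f"
  shows "f ` irrelevant_mult s N = irrelevant_mult s' (f ` N)"
proof -
  interpret module_hom s s' f by fact
  show ?thesis
  proof
    show "f ` irrelevant_mult s N \<subseteq> irrelevant_mult s' (f ` N)"
      by (auto elim!: irrelevant_multE intro!: irrelevant_multI simp: sum scale)
    show "irrelevant_mult s' (f ` N) \<subseteq> f ` irrelevant_mult s N"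
    proof
      fix x assume "x \<in> irrelevant_mult s' (f ` N)"
      then obtain v where x: "x = (\<Sum>i\<in>UNIV. s' (var i) (v i))" and "\<And>i. v i \<in> f ` N"
        by (rule irrelevant_multE) blast
      then obtain u where "\<And>i. u i \<in> N" "\<And>i. v i = f (u i)" unfolding image_iff by metis
      then show "x \<in> f ` irrelevant_mult s N"
        by (intro image_eqI[of _ _ "\<Sum>i\<in>UNIV. s (var i) (u i)"] irrelevant_multI)
            (simp_all add: x sum scale)
    qed
  qed
qed

lemma (in module) sum_UNIV_mult_delta:
  "(\<Sum>j\<in>UNIV. scale (y j) (if j = i then v else 0)) = scale (y (i :: 'i::finite)) v"
  by (subst sum.mono_neutral_right[of _ "{i}"]) auto

lemma scale_var_irrelevant_mult:
  assumes "module sm" "0 \<in> N" "v \<in> N"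
  shows "sm (var i) v \<in> irrelevant_mult sm N"
  using irrelevant_multI[of "\<lambda>j. if j = i then v else 0" N sm] assms
  by (simp add: module.sum_UNIV_mult_delta)

lemma subspace_irrelevant_mult:
  assumes "module sm" "module.subspace sm N"
  shows "module.subspace sm (irrelevant_mult sm N)"
proof -
  interpret module sm by fact
  note N = assms(2)
  show ?thesis
  proof (rule subspaceI)
    show "0 \<in> irrelevant_mult sm N"
      using irrelevant_multI[of "\<lambda>_. 0" N sm] subspace_0[OF N] by simp
  next
    fix x y assume "x \<in> irrelevant_mult sm N" "y \<in> irrelevant_mult sm N"
    then obtain u v where "x = (\<Sum>i\<in>UNIV. sm (var i) (u i))" "y = (\<Sum>i\<in>UNIV. sm (var i) (v i))"
      "\<And>i. u i \<in> N" "\<And>i. v i \<in> N"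
      unfolding irrelevant_mult_def by blast
    then show "x + y \<in> irrelevant_mult sm N"
      using irrelevant_multI[of "\<lambda>i. u i + v i" N sm]
      by (simp add: scale_right_distrib sum.distrib subspace_add[OF N])
  next
    fix c x assume "x \<in> irrelevant_mult sm N"
    then obtain u where "x = (\<Sum>i\<in>UNIV. sm (var i) (u i))" "\<And>i. u i \<in> N"
      by (rule irrelevant_multE) blast
    then show "sm c x \<in> irrelevant_mult sm N"
      using irrelevant_multI[of "\<lambda>i. sm c (u i)" N sm]
      by (simp add: scale_sum_right mult.commute subspace_scale[OF N])
  qed
qed

lemma irrelevant_ideal_generated_by_vars:
  fixes f :: "('n::finite, 'k::field) mpoly"
  assumes "lookup f 0 = 0"
  shows "f \<in> irrelevant_mult (*) UNIV"
proof -
  interpret ring: module "(*) :: ('n, 'k) mpoly \<Rightarrow> _" by (rule module_mult)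
  have "single \<alpha> (lookup f \<alpha>) \<in> irrelevant_mult (*) UNIV" if "\<alpha> \<in> keys f" for \<alpha>
  proof -
    have "\<alpha> \<noteq> 0" using that assms by (auto simp: in_keys_iff)
    then obtain i where i: "lookup \<alpha> i \<noteq> 0" by (metis poly_mapping_eqI lookup_zero)
    define \<beta> where "\<beta> = \<alpha> - single i 1"
    have "\<alpha> = single i 1 + \<beta>"
      by (rule poly_mapping_eqI)
          (use i in \<open>auto simp: \<beta>_def lookup_add lookup_minus lookup_single when_def\<close>)
    then have "single \<alpha> (lookup f \<alpha>) = var i * single \<beta> (lookup f \<alpha>)"
      by (simp add: var_def mult_single)
    also have "\<dots> \<in> irrelevant_mult (*) UNIV" by (rule scale_var_irrelevant_mult[OF module_mult]) auto
    finally show ?thesis .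
  qed
  then have "(\<Sum>\<alpha>\<in>keys f. single \<alpha> (lookup f \<alpha>)) \<in> irrelevant_mult (*) UNIV"
    by (intro ring.subspace_sum subspace_irrelevant_mult module_mult) auto
  then show ?thesis by (simp flip: poly_mapping_eq_sum_single)
qed

lemma scale_irrelevant_mult:
  assumes "module sm" "module.subspace sm N" "lookup f 0 = 0" "v \<in> N"
  shows "sm f v \<in> irrelevant_mult sm N"
proof -
  interpret module sm by fact
  obtain g where "f = (\<Sum>i\<in>UNIV. var i * g i)"
    using irrelevant_ideal_generated_by_vars[OF assms(3)] by (rule irrelevant_multE)
  then have "sm f v = (\<Sum>i\<in>UNIV. sm (var i) (sm (g i) v))" by (simp add: scale_sum_left)
  also have "\<dots> \<in> irrelevant_mult sm N"
    by (rule irrelevant_multI) (rule subspace_scale[OF assms(2,4)])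
  finally show ?thesis .
qed

section \<open>Free modules and their resolutions\<close>

lemma lookup_free_scale [simp]: "lookup (free_scale a v) j = a * lookup v j"
  by (auto simp: free_scale_def Poly_Mapping.map.rep_eq when_def)

lemma module_free_scale: "module free_scale"
  by unfold_locales (auto intro!: poly_mapping_eqI simp: lookup_add algebra_simps)

interpretation free: module free_scale by (rule module_free_scale)

lemma free_scale_single [simp]: "free_scale a (single j b) = single j (a * b)"
  by (rule poly_mapping_eqI) (auto simp: lookup_single when_def)

lemma free_subspace_mem:
  assumes "free.subspace S" "\<And>j. single j 1 \<in> S"
  shows "v \<in> S"
proof -
  have "(\<Sum>j\<in>keys v. free_scale (lookup v j) (single j 1)) \<in> S"
    using assms by (intro free.subspace_sum free.subspace_scale)
  then show ?thesis by (simp flip: poly_mapping_eq_sum_single)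
qed

definition lin_ext :: "('r::comm_ring_1 \<Rightarrow> 'm::ab_group_add \<Rightarrow> 'm) \<Rightarrow> ('b \<Rightarrow> 'm) \<Rightarrow> ('b \<Rightarrow>\<^sub>0 'r) \<Rightarrow> 'm" where
  "lin_ext sm g v = (\<Sum>j\<in>keys v. sm (lookup v j) (g j))"

context module
begin

lemma lin_ext_superset:
  assumes "finite A" "keys v \<subseteq> A"
  shows "lin_ext scale g v = (\<Sum>j\<in>A. scale (lookup v j) (g j))"
  unfolding lin_ext_def using assms by (intro sum.mono_neutral_left) (auto simp: in_keys_iff)

lemma module_hom_lin_ext: "module_hom free_scale scale (lin_ext scale g)"
proof (intro module_hom.intro module_hom_axioms.intro module_free_scale module_axioms)
  fix u v :: "'c \<Rightarrow>\<^sub>0 'a" and a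
  have "keys (u + v) \<subseteq> keys u \<union> keys v" by (rule Poly_Mapping.keys_add)
  then show "lin_ext scale g (u + v) = lin_ext scale g u + lin_ext scale g v"
    by (simp add: lin_ext_superset[of "keys u \<union> keys v"] lookup_add scale_left_distrib sum.distrib)
  have "keys (free_scale a v) \<subseteq> keys v" by (auto simp: in_keys_iff)
  then show "lin_ext scale g (free_scale a v) = scale a (lin_ext scale g v)"
    by (simp add: lin_ext_superset[of "keys v"] scale_sum_right)
qed

lemma lin_ext_single [simp]: "lin_ext scale g (single j a) = scale a (g j)"
  by (cases "a = 0") (auto simp: lin_ext_def)

lemma range_lin_ext: "range (lin_ext scale g) = span (range g)"
proof
  interpret lin_ext: module_hom free_scale scale "lin_ext scale g" by (rule module_hom_lin_ext)
  show "range (lin_ext scale g) \<subseteq> span (range g)"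
    unfolding lin_ext_def by (intro image_subsetI span_sum span_scale span_base) auto
  have "g j = lin_ext scale g (single j 1)" for j by simp
  then have "range g \<subseteq> range (lin_ext scale g)" by blast
  then show "span (range g) \<subseteq> range (lin_ext scale g)"
    by (intro span_minimal lin_ext.subspace_image) auto
qed

end

lemma (in vector_space) countable_independent:
  assumes T: "countable T" and B: "independent B" "B \<subseteq> span T"
  shows "countable B"
proof (rule countable_subset)
  let ?\<F> = "{F. finite F \<and> F \<subseteq> T}"
  show "B \<subseteq> (\<Union>F\<in>?\<F>. B \<inter> span F)"
  proof
    fix x assume x: "x \<in> B"
    then obtain F r where F: "finite F" "F \<subseteq> T" "x = (\<Sum>a\<in>F. scale (r a) a)"
      using B(2) span_explicit[of T] by auto
    then have "x \<in> span F" by (auto intro: span_sum span_scale span_base)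
    then show "x \<in> (\<Union>F\<in>?\<F>. B \<inter> span F)" using x F by blast
  qed
  show "countable (\<Union>F\<in>?\<F>. B \<inter> span F)"
  proof (rule countable_UN)
    show "countable ?\<F>" using T by (rule countable_Collect_finite_subset)
    show "countable (B \<inter> span F)" if "F \<in> ?\<F>" for F
      using that independent_span_bound[of F "B \<inter> span F"] independent_mono[OF B(1)]
      by (intro countable_finite) auto
  qed
qed

lemma countable_monomials: "countable (UNIV :: ('n::finite \<Rightarrow>\<^sub>0 nat) set)"
proof (rule countableI')
  show "inj (to_nat \<circ> lookup :: ('n \<Rightarrow>\<^sub>0 nat) \<Rightarrow> nat)"
    by (auto intro!: injI poly_mapping_eqI)
qed

lemma submodule_free_countably_generated:
  fixes K :: "(nat \<Rightarrow>\<^sub>0 ('n::finite, 'k::field) mpoly) set"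
  assumes K: "free.subspace K"
  obtains g :: "nat \<Rightarrow> _" where "free.span (range g) = K"
proof -
  interpret k: vector_space "kscale (free_scale :: ('n, 'k) mpoly \<Rightarrow> (nat \<Rightarrow>\<^sub>0 _) \<Rightarrow> _)"
    by (rule vector_space_kscale) (rule module_free_scale)
  define T :: "(nat \<Rightarrow>\<^sub>0 ('n, 'k) mpoly) set" where "T = range (\<lambda>(j, \<alpha>). single j (single \<alpha> 1))"
  have "countable T"
    unfolding T_def using countable_SIGMA[of "UNIV :: nat set" "\<lambda>_. UNIV :: ('n \<Rightarrow>\<^sub>0 nat) set"]
    by (intro countable_image) (simp add: countable_monomials)
  have span_T: "v \<in> k.span T" for v
  proof -
    have "single j f \<in> k.span T" for j and f :: "('n, 'k) mpoly"
    proof -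
      interpret single: additive "single j" by unfold_locales (rule single_add)
      have "single j f = (\<Sum>\<alpha>\<in>keys f. single j (single \<alpha> (lookup f \<alpha>)))"
        by (simp flip: single.sum poly_mapping_eq_sum_single)
      also have "\<dots> = (\<Sum>\<alpha>\<in>keys f. kscale free_scale (lookup f \<alpha>) (single j (single \<alpha> 1)))"
        by (simp add: kscale_def)
      also have "\<dots> \<in> k.span T" by (intro k.span_sum k.span_scale k.span_base) (auto simp: T_def)
      finally show ?thesis .
    qed
    then have "(\<Sum>j\<in>keys v. single j (lookup v j)) \<in> k.span T" by (intro k.span_sum)
    then show ?thesis by (simp flip: poly_mapping_eq_sum_single)
  qed
  obtain B where B: "B \<subseteq> K" "k.independent B" "K \<subseteq> k.span B" using k.maximal_independent_subset by blast
  have "countable B"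
    using span_T by (intro k.countable_independent[OF \<open>countable T\<close> B(2)] subsetI)
  define g where "g = from_nat_into (insert 0 B)"
  have g: "range g = insert 0 B"
    unfolding g_def by (rule range_from_nat_into) (simp_all add: \<open>countable B\<close>)
  have "free.span (range g) = K"
  proof
    show "free.span (range g) \<subseteq> K"
      using B(1) free.subspace_0[OF K] unfolding g by (intro free.span_minimal K) auto
    have "k.span B \<subseteq> free.span (range g)"
      unfolding g by (intro k.span_minimal subspace_kscale module_free_scale free.subspace_span)
        (auto intro: free.span_base)
    then show "K \<subseteq> free.span (range g)" using B(3) by blast
  qed
  then show ?thesis by (rule that)
qed

lemma kernel_free_presentation:
  fixes f :: "(nat \<Rightarrow>\<^sub>0 ('n::finite, 'k::field) mpoly) \<Rightarrow> 'm::ab_group_add"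
  assumes "module_hom free_scale sm f"
  obtains d :: "(nat \<Rightarrow>\<^sub>0 ('n, 'k) mpoly) \<Rightarrow> nat \<Rightarrow>\<^sub>0 ('n, 'k) mpoly"
  where "module_hom free_scale free_scale d" "range d = {v. f v = 0}"
proof -
  interpret f: module_hom free_scale sm f by fact
  obtain g :: "nat \<Rightarrow> _" where "free.span (range g) = {v. f v = 0}"
    using f.subspace_kernel by (rule submodule_free_countably_generated)
  then show ?thesis using that[OF free.module_hom_lin_ext] free.range_lin_ext by metis
qed

lemma free_resolution_exists:
  fixes sm :: "('n::finite, 'k::field) mpoly \<Rightarrow> 'm::ab_group_add \<Rightarrow> 'm"
  assumes "module sm" "finitely_generated sm"
  shows "\<exists>d \<epsilon>. free_resolution sm d \<epsilon>"
proof -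
  interpret module sm by fact
  obtain B where B: "finite B" "span B = UNIV" using assms(2) unfolding finitely_generated_def by blast
  define g where "g = from_nat_into (insert 0 B)"
  have g: "range g = insert 0 B"
    unfolding g_def by (rule range_from_nat_into) (simp_all add: countable_finite B(1))
  define \<epsilon> where "\<epsilon> = lin_ext sm g"
  have \<epsilon>: "module_hom free_scale sm \<epsilon>" unfolding \<epsilon>_def by (rule module_hom_lin_ext)
  have "surj \<epsilon>" using span_mono[of B "insert 0 B"] B(2) by (auto simp: \<epsilon>_def range_lin_ext g)
  obtain d\<^sub>0 :: "(nat \<Rightarrow>\<^sub>0 ('n, 'k) mpoly) \<Rightarrow> nat \<Rightarrow>\<^sub>0 ('n, 'k) mpoly"
    where d\<^sub>0: "module_hom free_scale free_scale d\<^sub>0" "range d\<^sub>0 = {v. \<epsilon> v = 0}"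
    using kernel_free_presentation[OF \<epsilon>] .
  have "\<exists>d. \<forall>i. (module_hom free_scale free_scale (d i) \<and> (i = 0 \<longrightarrow> d i = d\<^sub>0))
      \<and> range (d (Suc i)) = {v. d i v = 0}"
  proof (rule dependent_nat_choice)
    fix d :: "(nat \<Rightarrow>\<^sub>0 ('n, 'k) mpoly) \<Rightarrow> nat \<Rightarrow>\<^sub>0 ('n, 'k) mpoly" and i :: nat
    assume "module_hom free_scale free_scale d \<and> (i = 0 \<longrightarrow> d = d\<^sub>0)"
    then obtain d' :: "(nat \<Rightarrow>\<^sub>0 ('n, 'k) mpoly) \<Rightarrow> nat \<Rightarrow>\<^sub>0 ('n, 'k) mpoly"
      where "module_hom free_scale free_scale d'" "range d' = {v. d v = 0}"
      using kernel_free_presentation by blast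
    then show "\<exists>d'. (module_hom free_scale free_scale d' \<and> (Suc i = 0 \<longrightarrow> d' = d\<^sub>0))
        \<and> range d' = {v. d v = 0}"
      by blast
  qed (use d\<^sub>0 in blast)
  then obtain d where "\<And>i. module_hom free_scale free_scale (d i)" "d 0 = d\<^sub>0"
    "\<And>i. range (d (Suc i)) = {v. d i v = 0}" by blast
  then have "free_resolution sm d \<epsilon>" unfolding free_resolution_def using d\<^sub>0(2) \<epsilon> \<open>surj \<epsilon>\<close> by simp
  then show ?thesis by blast
qed

section \<open>The Koszul complex of a free module\<close>

definition var_div :: "'n \<Rightarrow> ('n::finite, 'k::field) mpoly \<Rightarrow> ('n, 'k) mpoly" where
  "var_div i f = Poly_Mapping.map_key (\<lambda>\<alpha>. single i 1 + \<alpha>) f"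

lemma lookup_var_div: "lookup (var_div i f) \<alpha> = lookup f (single i 1 + \<alpha>)"
  unfolding var_div_def by (subst map_key.rep_eq) (auto intro: injI)

lemma var_div_add: "var_div i (f + g) = var_div i f + var_div i g"
  by (rule poly_mapping_eqI) (simp add: lookup_var_div lookup_add)

lemma var_div_zero [simp]: "var_div i 0 = 0"
  by (rule poly_mapping_eqI) (simp add: lookup_var_div)

lemma var_div_single:
  fixes c :: "'k::field" and \<alpha> :: "'n::finite \<Rightarrow>\<^sub>0 nat"
  shows
  "var_div i (single \<alpha> c) = (if lookup \<alpha> i = 0 then 0 else single (\<alpha> - single i 1) c)"
proof (rule poly_mapping_eqI)
  fix \<beta>
  have "\<alpha> = single i 1 + \<beta> \<longleftrightarrow> lookup \<alpha> i \<noteq> 0 \<and> \<alpha> - single i 1 = \<beta>"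
  proof
    assume "lookup \<alpha> i \<noteq> 0 \<and> \<alpha> - single i 1 = \<beta>"
    then show "\<alpha> = single i 1 + \<beta>"
      by (intro poly_mapping_eqI) (auto simp: lookup_add lookup_minus lookup_single when_def)
  qed (simp add: lookup_add)
  then show "lookup (var_div i (single \<alpha> c)) \<beta>
      = lookup (if lookup \<alpha> i = 0 then 0 else single (\<alpha> - single i 1) c) \<beta>"
    by (auto simp: lookup_var_div lookup_single when_def)
qed

lemma var_div_var_mult_same:
  fixes f :: "('n::finite, 'k::field) mpoly"
  shows "var_div i (var i * f) = f"
proof (rule additive_eqI_single[where v = f])
  show "var_div i (var i * single \<alpha> c) = single \<alpha> c" for \<alpha> and c :: 'k
    by (simp add: var_def mult_single var_div_single lookup_add)
qed (simp_all add: additive_def var_div_add distrib_left)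

lemma var_div_var_mult_other:
  fixes f :: "('n::finite, 'k::field) mpoly"
  assumes "i \<noteq> j"
  shows "var_div i (var j * f) = var j * var_div i f"
proof (rule additive_eqI_single[where v = f])
  fix \<alpha> :: "'n \<Rightarrow>\<^sub>0 nat" and c :: 'k
  have "single j 1 + \<alpha> - single i 1 = single j 1 + (\<alpha> - single i 1)"
    by (rule poly_mapping_eqI) (use assms in \<open>auto simp: lookup_add lookup_minus lookup_single when_def\<close>)
  then show "var_div i (var j * single \<alpha> c) = var j * var_div i (single \<alpha> c)"
    using assms by (simp add: var_def mult_single var_div_single lookup_add lookup_single)
qed (simp_all add: additive_def var_div_add distrib_left)

lemma koszul_cycles_free_subset_boundaries:
  assumes "q > 0"
  shows "koszul_cycles (free_scale :: ('n::{finite,linorder}, 'k::field) mpoly \<Rightarrow> ('b \<Rightarrow>\<^sub>0 _) \<Rightarrow> _)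
      var UNIV q
    \<subseteq> koszul_boundaries free_scale var UNIV q"
proof
  fix w :: "'n set \<Rightarrow> 'b \<Rightarrow>\<^sub>0 ('n, 'k) mpoly"
  have lookup_map: "lookup (Poly_Mapping.map (var_div i) v) j = var_div i (lookup v j)"
    for i and v :: "'b \<Rightarrow>\<^sub>0 ('n, 'k) mpoly" and j
    by (auto simp: Poly_Mapping.map.rep_eq when_def)
  assume "w \<in> koszul_cycles free_scale var UNIV q"
  then show "w \<in> koszul_boundaries free_scale var UNIV q"
    by (rule free.koszul_acyclic[where D = "\<lambda>i. Poly_Mapping.map (var_div i)", rotated 3])
      (auto intro!: poly_mapping_eqI
        simp: \<open>q > 0\<close> lookup_map lookup_add var_div_add var_div_var_mult_same var_div_var_mult_other)
qed

section \<open>Koszul homology along a free resolution\<close>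

lemma module_hom_fun_comp:
  assumes "module_hom s s' f"
  shows "module_hom (fun_scale s) (fun_scale s') (\<lambda>w U. f (w U))"
proof -
  interpret module_hom s s' f by fact
  show ?thesis
    by (intro module_hom.intro module_hom_axioms.intro module_fun_scale m1.module_axioms
        m2.module_axioms)
      (simp_all add: fun_eq_iff add scale)
qed

lemma kscale_subspace_koszul_chains:
  assumes "module sm" "module.subspace (kscale sm) N"
  shows "module.subspace (kscale (fun_scale sm)) (koszul_chains N q)"
proof -
  interpret vector_space "kscale sm" by (rule vector_space_kscale) fact
  show ?thesis unfolding kscale_fun_scale by (rule subspace_koszul_chains) fact
qed

lemma subspace_koszul_cycles:
  assumes "module sm" "module.subspace (kscale sm) N"
  shows "module.subspace (kscale (fun_scale sm)) (koszul_cycles sm y N q)"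
proof -
  interpret module sm by fact
  interpret diff: Vector_Spaces.linear "kscale (fun_scale sm)" "kscale (fun_scale sm)" "koszul_diff sm y"
    by (rule linear_kscale[OF module_hom_koszul_diff])
  have "koszul_cycles sm y N q = koszul_chains N q \<inter> {w. koszul_diff sm y w = 0}"
    by (auto simp: koszul_cycles_def)
  then show ?thesis
    by (simp add: diff.vs1.subspace_inter diff.subspace_kernel kscale_subspace_koszul_chains assms)
qed

lemma subspace_koszul_boundaries:
  assumes "module sm" "module.subspace (kscale sm) N"
  shows "module.subspace (kscale (fun_scale sm)) (koszul_boundaries sm y N q)"
proof -
  interpret module sm by fact
  interpret diff: Vector_Spaces.linear "kscale (fun_scale sm)" "kscale (fun_scale sm)" "koszul_diff sm y"
    by (rule linear_kscale[OF module_hom_koszul_diff])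
  show ?thesis
    unfolding koszul_boundaries_def by (intro diff.subspace_image kscale_subspace_koszul_chains assms)
qed

lemma koszul_chains_lift:
  assumes "w \<in> koszul_chains (range f) q" "f 0 = 0"
  obtains u where "u \<in> koszul_chains UNIV q" "(\<lambda>U. f (u U)) = w"
proof
  let ?u = "\<lambda>U. if card U = q then inv f (w U) else 0"
  show "?u \<in> koszul_chains UNIV q" by (simp add: koszul_chains_def)
  show "(\<lambda>U. f (?u U)) = w"
    using assms by (auto simp: koszul_chains_def fun_eq_iff f_inv_into_f)
qed

lemma koszul_boundaries_syzygy_iff:
  fixes \<pi> :: "('b \<Rightarrow>\<^sub>0 ('n::{finite,linorder}, 'k::field) mpoly) \<Rightarrow> 'm::ab_group_add"
  assumes hom: "module_hom free_scale sm \<pi>" and y: "y \<in> koszul_chains UNIV (Suc q)"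
  shows "(\<lambda>U. \<pi> (y U)) \<in> koszul_boundaries sm var (range \<pi>) (Suc q)
    \<longleftrightarrow> koszul_diff free_scale var y \<in> koszul_boundaries free_scale var {v. \<pi> v = 0} q"
proof
  interpret \<pi>: module_hom free_scale sm \<pi> by fact
  note diff_\<pi> = koszul_diff_module_hom[OF hom, of var]
  {
    assume "(\<lambda>U. \<pi> (y U)) \<in> koszul_boundaries sm var (range \<pi>) (Suc q)"
    then obtain u where u: "u \<in> koszul_chains (range \<pi>) (Suc (Suc q))"
      and \<pi>_y: "(\<lambda>U. \<pi> (y U)) = koszul_diff sm var u"
      unfolding koszul_boundaries_def by blast
    obtain u' where u': "u' \<in> koszul_chains UNIV (Suc (Suc q))" "(\<lambda>U. \<pi> (u' U)) = u"
      using koszul_chains_lift[OF u \<pi>.zero] .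
    define v where "v = y - koszul_diff free_scale var u'"
    have "(\<lambda>U. \<pi> (v U)) = (\<lambda>U. \<pi> (y U)) - koszul_diff sm var (\<lambda>U. \<pi> (u' U))"
      by (simp add: v_def diff_\<pi> \<pi>.diff fun_eq_iff)
    then have "\<pi> (v U) = 0" for U by (simp add: \<pi>_y u'(2) fun_eq_iff)
    moreover have "koszul_diff free_scale var u' \<in> koszul_chains UNIV (Suc q)"
      using u'(1) by (rule free.koszul_diff_chains[OF free.subspace_UNIV])
    ultimately have "v \<in> koszul_chains {v. \<pi> v = 0} (Suc q)"
      using y by (simp add: v_def koszul_chains_def)
    moreover have "koszul_diff free_scale var v = koszul_diff free_scale var y"
      by (simp add: v_def free.koszul_diff_diff free.koszul_diff_koszul_diff)
    ultimately show "koszul_diff free_scale var y \<in> koszul_boundaries free_scale var {v. \<pi> v = 0} q"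
      unfolding koszul_boundaries_def by (metis image_eqI)
  }
  assume "koszul_diff free_scale var y \<in> koszul_boundaries free_scale var {v. \<pi> v = 0} q"
  then obtain v where v: "v \<in> koszul_chains {v. \<pi> v = 0} (Suc q)"
    and diff_v: "koszul_diff free_scale var y = koszul_diff free_scale var v"
    unfolding koszul_boundaries_def by blast
  have "y - v \<in> koszul_cycles free_scale var UNIV (Suc q)"
    using y v diff_v by (simp add: koszul_cycles_def koszul_chains_def free.koszul_diff_diff)
  then have "y - v \<in> koszul_boundaries free_scale var UNIV (Suc q)"
    using koszul_cycles_free_subset_boundaries[of "Suc q"] by blast
  then obtain u where u: "u \<in> koszul_chains UNIV (Suc (Suc q))" "y - v = koszul_diff free_scale var u"
    unfolding koszul_boundaries_def by blast
  have "(\<lambda>U. \<pi> (y U)) = (\<lambda>U. \<pi> ((y - v) U))"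
    using v by (simp add: koszul_chains_def \<pi>.diff)
  also have "\<dots> = koszul_diff sm var (\<lambda>U. \<pi> (u U))" by (simp add: u(2) diff_\<pi>)
  also have "\<dots> \<in> koszul_boundaries sm var (range \<pi>) (Suc q)"
    unfolding koszul_boundaries_def using u(1) by (intro imageI) (simp add: koszul_chains_def)
  finally show "(\<lambda>U. \<pi> (y U)) \<in> koszul_boundaries sm var (range \<pi>) (Suc q)" .
qed

definition syzygy_lifts ::
  "(('b \<Rightarrow>\<^sub>0 ('n::{finite,linorder}, 'k::field) mpoly) \<Rightarrow> 'm::zero) \<Rightarrow> nat
      \<Rightarrow> ('n set \<Rightarrow> 'b \<Rightarrow>\<^sub>0 ('n, 'k) mpoly) set" where
  "syzygy_lifts \<pi> q =
    {y \<in> koszul_chains UNIV (Suc q). koszul_diff free_scale var y \<in> koszul_chains {v. \<pi> v = 0} q}"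

lemma syzygy_lifts_iff:
  assumes hom: "module_hom free_scale sm \<pi>" and y: "y \<in> koszul_chains UNIV (Suc q)"
  shows "y \<in> syzygy_lifts \<pi> q \<longleftrightarrow> (\<lambda>U. \<pi> (y U)) \<in> koszul_cycles sm var (range \<pi>) (Suc q)"
  using y free.koszul_diff_chains[OF free.subspace_UNIV y, of var] module_hom.zero[OF hom]
  by (auto simp: syzygy_lifts_def koszul_cycles_def koszul_chains_def koszul_diff_module_hom[OF hom]
      fun_eq_iff)

lemma subspace_syzygy_lifts:
  fixes \<pi> :: "('b \<Rightarrow>\<^sub>0 ('n::{finite,linorder}, 'k::field) mpoly) \<Rightarrow> 'm::ab_group_add"
  assumes hom: "module_hom free_scale sm \<pi>"
  shows "module.subspace (kscale (fun_scale free_scale)) (syzygy_lifts \<pi> q)"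
proof -
  interpret \<pi>: module_hom free_scale sm \<pi> by fact
  interpret diff: Vector_Spaces.linear "kscale (fun_scale free_scale)" "kscale (fun_scale free_scale)"
    "koszul_diff (free_scale :: ('n, 'k) mpoly \<Rightarrow> ('b \<Rightarrow>\<^sub>0 _) \<Rightarrow> _) var"
    by (rule linear_kscale[OF free.module_hom_koszul_diff])
  have "diff.vs1.subspace (koszul_chains UNIV (Suc q))"
    by (intro kscale_subspace_koszul_chains subspace_kscale module_free_scale free.subspace_UNIV)
  moreover have "diff.vs1.subspace {y. koszul_diff free_scale var y \<in> koszul_chains {v. \<pi> v = 0} q}"
    by (intro diff.subspace_linear_preimage kscale_subspace_koszul_chains subspace_kscale
        module_free_scale \<pi>.subspace_kernel)
  ultimately show ?thesis
    using diff.vs1.subspace_inter unfolding syzygy_lifts_def Collect_conj_eq Collect_mem_eq by blast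
qed

text \<open>The connecting isomorphism of the exact sequence \<open>0 \<rightarrow> ker \<pi> \<rightarrow> F \<rightarrow> range \<pi> \<rightarrow> 0\<close> with \<open>F\<close>
  free: both sides are quotients of \<open>syzygy_lifts \<pi> q\<close>, by \<open>y \<mapsto> \<pi> \<circ> y\<close> and by the differential.\<close>

lemma has_quotient_dim_koszul_syzygy_iff:
  fixes \<pi> :: "('b \<Rightarrow>\<^sub>0 ('n::{finite,linorder}, 'k::field) mpoly) \<Rightarrow> 'm::ab_group_add"
  assumes hom: "module_hom free_scale sm \<pi>"
  shows "has_quotient_dim (kscale (fun_scale sm))
      (koszul_cycles sm var (range \<pi>) (Suc q)) (koszul_boundaries sm var (range \<pi>) (Suc q)) n
    \<longleftrightarrow> has_quotient_dim (kscale (fun_scale free_scale))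
      (koszul_chains {v. \<pi> v = 0} q \<inter> koszul_boundaries free_scale var UNIV q)
      (koszul_boundaries free_scale var {v. \<pi> v = 0} q) n"
    (is "has_quotient_dim _ ?Z ?W n \<longleftrightarrow> has_quotient_dim _ ?Z' ?W' n")
proof -
  interpret \<pi>: module_hom free_scale sm \<pi> by fact
  let ?diff = "koszul_diff (free_scale :: ('n, 'k) mpoly \<Rightarrow> ('b \<Rightarrow>\<^sub>0 _) \<Rightarrow> _) var"
  interpret diff: Vector_Spaces.linear "kscale (fun_scale free_scale)"
      "kscale (fun_scale free_scale)" ?diff
    by (rule linear_kscale[OF free.module_hom_koszul_diff])
  interpret comp: Vector_Spaces.linear "kscale (fun_scale free_scale)" "kscale (fun_scale sm)"
    "\<lambda>(y :: 'n set \<Rightarrow> _) U. \<pi> (y U)"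
    by (intro linear_kscale module_hom_fun_comp hom)
  note lifts = subspace_syzygy_lifts[OF hom, of q]
  let ?B = "{y. ?diff y \<in> ?W'}"
  have "has_quotient_dim (kscale (fun_scale free_scale)) (syzygy_lifts \<pi> q) ?B n
    \<longleftrightarrow> has_quotient_dim (kscale (fun_scale sm)) ?Z ?W n"
  proof (rule has_quotient_dim_linear_iff[OF comp.linear_axioms lifts])
    show W: "comp.vs2.subspace ?W"
      by (intro subspace_koszul_boundaries subspace_kscale \<pi>.m2.module_axioms \<pi>.subspace_image
          free.subspace_UNIV)
    fix z assume z: "z \<in> ?Z"
    then have "z \<in> koszul_chains (range \<pi>) (Suc q)" by (simp add: koszul_cycles_def)
    then obtain y where y: "y \<in> koszul_chains UNIV (Suc q)" "(\<lambda>U. \<pi> (y U)) = z"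
      using \<pi>.zero by (rule koszul_chains_lift)
    then show "\<exists>y\<in>syzygy_lifts \<pi> q. z - (\<lambda>U. \<pi> (y U)) \<in> ?W"
      using z syzygy_lifts_iff[OF hom y(1)] comp.vs2.subspace_0[OF W] by (intro bexI[of _ y]) simp_all
  next
    fix y assume y: "y \<in> syzygy_lifts \<pi> q"
    then have chain: "y \<in> koszul_chains UNIV (Suc q)" by (simp add: syzygy_lifts_def)
    show "(\<lambda>U. \<pi> (y U)) \<in> ?Z" using syzygy_lifts_iff[OF hom chain] y by blast
    show "(\<lambda>U. \<pi> (y U)) \<in> ?W \<longleftrightarrow> y \<in> ?B" using koszul_boundaries_syzygy_iff[OF hom chain] by blast
  qed
  moreover have "has_quotient_dim (kscale (fun_scale free_scale)) (syzygy_lifts \<pi> q) ?B n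
    \<longleftrightarrow> has_quotient_dim (kscale (fun_scale free_scale)) ?Z' ?W' n"
  proof (rule has_quotient_dim_linear_iff[OF diff.linear_axioms lifts])
    show W': "diff.vs1.subspace ?W'"
      by (intro subspace_koszul_boundaries subspace_kscale module_free_scale \<pi>.subspace_kernel)
    fix z assume "z \<in> ?Z'"
    then obtain y where "y \<in> syzygy_lifts \<pi> q" "z = ?diff y"
      by (auto simp: koszul_boundaries_def syzygy_lifts_def)
    then show "\<exists>y\<in>syzygy_lifts \<pi> q. z - ?diff y \<in> ?W'" using diff.vs1.subspace_0[OF W']
      by (intro bexI[of _ y]) simp_all
  qed (auto simp: syzygy_lifts_def koszul_boundaries_def)
  ultimately show ?thesis by blast
qed

lemma free_resolutionD:
  assumes "free_resolution sm d \<epsilon>"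
  shows "module_hom free_scale free_scale (d i)" "module_hom free_scale sm \<epsilon>" "surj \<epsilon>"
    "range (d 0) = {v. \<epsilon> v = 0}" "range (d (Suc i)) = {v. d i v = 0}"
  using assms unfolding free_resolution_def by auto

lemma koszul_cycles_eq_chains_Int_boundaries:
  assumes "free.subspace N" "q > 0"
  shows "koszul_cycles (free_scale :: ('n::{finite,linorder}, 'k::field) mpoly \<Rightarrow> ('b \<Rightarrow>\<^sub>0 _) \<Rightarrow> _) var N q
    = koszul_chains N q \<inter> koszul_boundaries free_scale var UNIV q"
  using koszul_cycles_free_subset_boundaries[OF \<open>q > 0\<close>, where 'n = 'n and 'k = 'k and 'b = 'b]
  by (auto simp: koszul_cycles_def koszul_boundaries_def koszul_chains_def free.koszul_diff_koszul_diff)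

lemma has_quotient_dim_koszul_resolution_iff:
  fixes sm :: "('n::{finite,linorder}, 'k::field) mpoly \<Rightarrow> 'm::ab_group_add \<Rightarrow> 'm"
  assumes res: "free_resolution sm d \<epsilon>"
  shows "has_quotient_dim (kscale (fun_scale sm))
      (koszul_cycles sm var UNIV (Suc q + j)) (koszul_boundaries sm var UNIV (Suc q + j)) n
    \<longleftrightarrow> has_quotient_dim (kscale (fun_scale free_scale))
      (koszul_chains (range (d j)) q \<inter> koszul_boundaries free_scale var UNIV q)
      (koszul_boundaries free_scale var (range (d j)) q) n"
proof (induction j arbitrary: q)
  case 0
  show ?case
    using has_quotient_dim_koszul_syzygy_iff[OF free_resolutionD(2)[OF res], of q n]
    unfolding free_resolutionD(3,4)[OF res] add_0_right .
next
  case (Suc j)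
  interpret d: module_hom free_scale free_scale "d j" by (rule free_resolutionD(1)[OF res])
  have "free.subspace (range (d j))" by (intro d.subspace_image free.subspace_UNIV)
  note cycles = koszul_cycles_eq_chains_Int_boundaries[OF this zero_less_Suc]
  show ?case
    using Suc.IH[of "Suc q"] has_quotient_dim_koszul_syzygy_iff[OF free_resolutionD(1)[OF res], of j q n]
    unfolding free_resolutionD(5)[OF res] cycles add_Suc add_Suc_right by (rule trans)
qed

lemma koszul_chains_0_iff:
  "0 \<in> N \<Longrightarrow> (w :: 'n::finite set \<Rightarrow> _) \<in> koszul_chains N 0 \<longleftrightarrow> w {} \<in> N \<and> (\<forall>U. U \<noteq> {} \<longrightarrow> w U = 0)"
  unfolding koszul_chains_def mem_Collect_eq card_0_eq[OF finite] by metis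

lemma koszul_boundaries_0_iff:
  assumes "module sm" "0 \<in> N" and w: "w \<in> koszul_chains UNIV 0"
  shows "w \<in> koszul_boundaries sm var N 0 \<longleftrightarrow> w {} \<in> irrelevant_mult sm N"
proof
  interpret module sm by fact
  have diff_empty: "koszul_diff sm var u {} = (\<Sum>i\<in>UNIV. sm (var i) (u {i}))" for u
    by (simp add: koszul_diff_apply koszul_sign_def)
  {
    assume "w \<in> koszul_boundaries sm var N 0"
    then show "w {} \<in> irrelevant_mult sm N"
      by (auto simp: koszul_boundaries_def koszul_chains_def diff_empty intro!: irrelevant_multI)
  }
  assume "w {} \<in> irrelevant_mult sm N"
  then obtain v where v: "w {} = (\<Sum>i\<in>UNIV. sm (var i) (v i))" "\<And>i. v i \<in> N"
    by (rule irrelevant_multE) blast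
  define u where "u U = (if card U = 1 then v (the_elem U) else 0)" for U
  have u: "u \<in> koszul_chains N (Suc 0)" using v(2) assms(2) by (auto simp: koszul_chains_def u_def)
  have "w U = koszul_diff sm var u U" for U
  proof (cases "U = {}")
    case True
    then show ?thesis using v(1) by (simp add: diff_empty u_def)
  next
    case False
    then show ?thesis
      using w koszul_diff_in_chains_degree[OF u, of U var] by (simp add: koszul_chains_def)
  qed
  then show "w \<in> koszul_boundaries sm var N 0" unfolding koszul_boundaries_def using u by blast
qed

lemma has_quotient_dim_koszul_0_iff:
  fixes sm :: "('n::{finite,linorder}, 'k::field) mpoly \<Rightarrow> 'm::ab_group_add \<Rightarrow> 'm"
  assumes sm: "module sm" and A: "module.subspace (kscale sm) A" and N: "module.subspace sm N"
  shows "has_quotient_dim (kscale (fun_scale sm)) (koszul_chains A 0) (koszul_boundaries sm var N 0) n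
    \<longleftrightarrow> has_quotient_dim (kscale sm) A (irrelevant_mult sm N) n"
proof (rule has_quotient_dim_linear_iff[where f = "\<lambda>w. w {}"])
  interpret module sm by fact
  interpret k: vector_space "kscale sm" by (rule vector_space_kscale) fact
  show "Vector_Spaces.linear (kscale (fun_scale sm)) (kscale sm) (\<lambda>w :: 'n set \<Rightarrow> 'm. w {})"
    by (intro linear_kscale module_hom.intro module_hom_axioms.intro module_fun_scale sm) simp_all
  show "module.subspace (kscale (fun_scale sm)) (koszul_chains A 0)"
    by (rule kscale_subspace_koszul_chains[OF sm A])
  show irr: "k.subspace (irrelevant_mult sm N)"
    by (intro subspace_kscale subspace_irrelevant_mult sm N)
  fix a assume "a \<in> A"
  then have "(\<lambda>U. if U = {} then a else 0) \<in> koszul_chains A 0"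
    using k.subspace_0[OF A] by (simp add: koszul_chains_def)
  then show "\<exists>w\<in>koszul_chains A 0. a - w {} \<in> irrelevant_mult sm N"
    using k.subspace_0[OF irr] by (intro bexI) auto
next
  fix w :: "'n set \<Rightarrow> 'm" assume "w \<in> koszul_chains A 0"
  then show "w {} \<in> A" by (simp add: koszul_chains_def)
  have "w \<in> koszul_chains UNIV 0" using \<open>w \<in> koszul_chains A 0\<close> by (simp add: koszul_chains_def)
  then show "w {} \<in> irrelevant_mult sm N \<longleftrightarrow> w \<in> koszul_boundaries sm var N 0"
    using koszul_boundaries_0_iff[OF sm module.subspace_0[OF sm N]] by blast
qed

section \<open>Tor by Koszul homology\<close>

definition pure_tensor :: "'a \<Rightarrow> 'b \<Rightarrow> ('a \<times> 'b \<Rightarrow>\<^sub>0 'r::comm_ring_1)" where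
  "pure_tensor x y = single (x, y) 1"

definition tensor_generators ::
  "('r::comm_ring_1 \<Rightarrow> 'a::ab_group_add \<Rightarrow> 'a) \<Rightarrow> ('r \<Rightarrow> 'b::ab_group_add \<Rightarrow> 'b) \<Rightarrow> ('a \<times> 'b \<Rightarrow>\<^sub>0 'r) set" where
  "tensor_generators sa sb =
      {pure_tensor (x + x') y - pure_tensor x y - pure_tensor x' y | x x' y. True}
    \<union> {pure_tensor x (y + y') - pure_tensor x y - pure_tensor x y' | x y y'. True}
    \<union> {pure_tensor (sa a x) y - free_scale a (pure_tensor x y) | a x y. True}
    \<union> {pure_tensor x (sb a y) - free_scale a (pure_tensor x y) | a x y. True}"

lemma tensor_relations_eq_span: "tensor_relations sa sb = free.span (tensor_generators sa sb)"
  unfolding tensor_relations_def tensor_generators_def pure_tensor_def Let_def by (rule refl)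

lemma subspace_tensor_relations: "free.subspace (tensor_relations sa sb)"
  by (simp add: tensor_relations_eq_span)

lemma pure_tensor_add_left:
  "pure_tensor (x + x') y - pure_tensor x y - pure_tensor x' y \<in> tensor_relations sa sb"
  unfolding tensor_relations_eq_span by (rule free.span_base) (unfold tensor_generators_def, blast)

lemma pure_tensor_add_right:
  "pure_tensor x (y + y') - pure_tensor x y - pure_tensor x y' \<in> tensor_relations sa sb"
  unfolding tensor_relations_eq_span by (rule free.span_base) (unfold tensor_generators_def, blast)

lemma pure_tensor_scale_left:
  "pure_tensor (sa a x) y - free_scale a (pure_tensor x y) \<in> tensor_relations sa sb"
  unfolding tensor_relations_eq_span by (rule free.span_base) (unfold tensor_generators_def, blast)

lemma pure_tensor_scale_right:
  "pure_tensor x (sb a y) - free_scale a (pure_tensor x y) \<in> tensor_relations sa sb"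
  unfolding tensor_relations_eq_span by (rule free.span_base) (unfold tensor_generators_def, blast)

lemma pure_tensor_0_left: "pure_tensor 0 y \<in> tensor_relations sa sb"
  using free.subspace_neg[OF subspace_tensor_relations pure_tensor_add_left[of 0 0 y sa sb]] by simp

lemma pure_tensor_0_right: "pure_tensor x 0 \<in> tensor_relations sa sb"
  using free.subspace_neg[OF subspace_tensor_relations pure_tensor_add_right[of x 0 0 sa sb]] by simp

definition tensor_contract ::
  "(('n::finite, 'k::field) mpoly \<Rightarrow> 'm::ab_group_add \<Rightarrow> 'm) \<Rightarrow> ('m \<times> 'k \<Rightarrow>\<^sub>0 ('n, 'k) mpoly) \<Rightarrow> 'm" where
  "tensor_contract sm = lin_ext sm (\<lambda>(x, y). sm (const y) x)"

lemma module_hom_tensor_contract: "module sm \<Longrightarrow> module_hom free_scale sm (tensor_contract sm)"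
  unfolding tensor_contract_def by (rule module.module_hom_lin_ext)

lemma tensor_contract_single: "module sm \<Longrightarrow> tensor_contract sm (single (x, y) a) = sm (a * const y) x"
  by (simp add: tensor_contract_def module.lin_ext_single module.scale_scale)

lemma tensor_contract_pure: "module sm \<Longrightarrow> tensor_contract sm (pure_tensor x y) = sm (const y) x"
  by (simp add: pure_tensor_def tensor_contract_single)

lemma tensor_contract_relations:
  fixes sm :: "('n::finite, 'k::field) mpoly \<Rightarrow> 'm::ab_group_add \<Rightarrow> 'm"
  assumes sm: "module sm" and z: "z \<in> tensor_relations sm residue_scale"
  shows "tensor_contract sm z \<in> irrelevant_mult sm UNIV"
proof -
  interpret module sm by fact
  interpret contract: module_hom free_scale sm "tensor_contract sm"
    by (rule module_hom_tensor_contract[OF sm])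
  have irr: "subspace (irrelevant_mult sm UNIV)" by (intro subspace_irrelevant_mult sm subspace_UNIV)
  have "tensor_contract sm g \<in> irrelevant_mult sm UNIV"
    if g: "g \<in> tensor_generators sm residue_scale" for g
  proof -
    consider x x' y where "g = pure_tensor (x + x') y - pure_tensor x y - pure_tensor x' y"
      | x y y' where "g = pure_tensor x (y + y') - pure_tensor x y - pure_tensor x y'"
      | a x y where "g = pure_tensor (sm a x) y - free_scale a (pure_tensor x y)"
      | a x y where "g = pure_tensor x (residue_scale a y) - free_scale a (pure_tensor x y)"
      using g unfolding tensor_generators_def by blast
    then show ?thesis
    proof cases
      case 4
      then have "tensor_contract sm g = sm (const (lookup a 0) - a) (sm (const y) x)"
        by (simp add: contract.diff contract.scale tensor_contract_pure[OF sm] residue_scale_def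
            const_mult scale_left_diff_distrib left_diff_distrib)
      also have "\<dots> \<in> irrelevant_mult sm UNIV"
        by (rule scale_irrelevant_mult[OF sm]) (simp_all add: lookup_minus)
      finally show ?thesis .
    qed (simp_all add: contract.diff contract.scale tensor_contract_pure[OF sm] subspace_0[OF irr]
        const_add scale_right_distrib scale_left_distrib mult.commute)
  qed
  then have "tensor_generators sm residue_scale
      \<subseteq> {z. tensor_contract sm z \<in> irrelevant_mult sm UNIV}" by blast
  then have "tensor_relations sm residue_scale \<subseteq> {z. tensor_contract sm z \<in> irrelevant_mult sm UNIV}"
    unfolding tensor_relations_eq_span by (intro free.span_minimal contract.subspace_linear_preimage irr)
  then show ?thesis using z by blast
qed

lemma tensor_contract_pure_one:
  fixes sm :: "('n::finite, 'k::field) mpoly \<Rightarrow> 'm::ab_group_add \<Rightarrow> 'm"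
  assumes sm: "module sm"
  shows "z - pure_tensor (tensor_contract sm z) 1 \<in> tensor_relations sm residue_scale"
proof -
  interpret module sm by fact
  interpret contract: module_hom free_scale sm "tensor_contract sm"
    by (rule module_hom_tensor_contract) fact
  let ?T = "tensor_relations sm residue_scale"
  note T = subspace_tensor_relations[of sm residue_scale]
  have "z \<in> {z. z - pure_tensor (tensor_contract sm z) 1 \<in> ?T}"
  proof (rule free_subspace_mem)
    show "free.subspace {z. z - pure_tensor (tensor_contract sm z) 1 \<in> ?T}"
    proof (rule free.subspaceI; unfold mem_Collect_eq)
      show "0 - pure_tensor (tensor_contract sm 0) 1 \<in> ?T"
        using free.subspace_neg[OF T pure_tensor_0_left[of 1 sm residue_scale]] by simp
    next
      fix z w
      assume "z - pure_tensor (tensor_contract sm z) 1 \<in> ?T"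
          "w - pure_tensor (tensor_contract sm w) 1 \<in> ?T"
      from free.subspace_diff[OF T free.subspace_add[OF T this]
          pure_tensor_add_left[of "tensor_contract sm z" "tensor_contract sm w" 1]]
      show "z + w - pure_tensor (tensor_contract sm (z + w)) 1 \<in> ?T"
        by (simp add: contract.add algebra_simps)
    next
      fix a z assume "z - pure_tensor (tensor_contract sm z) 1 \<in> ?T"
      from free.subspace_diff[OF T free.subspace_scale[OF T this, of a]
          pure_tensor_scale_left[of sm a "tensor_contract sm z" 1]]
      show "free_scale a z - pure_tensor (tensor_contract sm (free_scale a z)) 1 \<in> ?T"
        by (simp add: contract.scale free.scale_right_diff_distrib)
    qed
  next
    fix p :: "'m \<times> 'k"
    obtain x y where p: "p = (x, y)" by (cases p)
    have "pure_tensor x (residue_scale (const y :: ('n, 'k) mpoly) 1)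
        - pure_tensor (sm (const y) x) 1 \<in> ?T"
      using free.subspace_diff[OF T pure_tensor_scale_right[of x residue_scale "const y" 1 sm]
          pure_tensor_scale_left[of sm "const y" x 1 residue_scale]] by simp
    then have "pure_tensor x y - pure_tensor (tensor_contract sm (pure_tensor x y)) 1 \<in> ?T"
      by (simp add: residue_scale_def tensor_contract_pure[OF sm])
    then show "single p 1 \<in> {z. z - pure_tensor (tensor_contract sm z) 1 \<in> ?T}"
      by (simp add: p pure_tensor_def)
  qed
  then show ?thesis by simp
qed

lemma pure_tensor_irrelevant_mult:
  fixes sm :: "('n::finite, 'k::field) mpoly \<Rightarrow> 'm::ab_group_add \<Rightarrow> 'm"
  assumes sm: "module sm" and v: "v \<in> irrelevant_mult sm UNIV"
  shows "pure_tensor v 1 \<in> tensor_relations sm residue_scale"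
proof -
  interpret module sm by fact
  let ?T = "tensor_relations sm residue_scale"
  note T = subspace_tensor_relations[of sm residue_scale]
  have sub: "subspace {v. pure_tensor v 1 \<in> ?T}"
  proof (rule subspaceI; unfold mem_Collect_eq)
    show "pure_tensor 0 1 \<in> ?T" by (rule pure_tensor_0_left)
    show "pure_tensor (u + v) 1 \<in> ?T" if "pure_tensor u 1 \<in> ?T" "pure_tensor v 1 \<in> ?T" for u v
      using free.subspace_add[OF T free.subspace_add[OF T that] pure_tensor_add_left[of u v 1]] by simp
    show "pure_tensor (sm a v) 1 \<in> ?T" if "pure_tensor v 1 \<in> ?T" for a v
      using free.subspace_mem_cong[OF T pure_tensor_scale_left] free.subspace_scale[OF T that] by blast
  qed
  have "pure_tensor (sm (var i) u) 1 \<in> ?T" for i u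
  proof -
    have "lookup (var i :: ('n, 'k) mpoly) 0 = 0"
      by (simp add: var_def lookup_single when_def) (metis lookup_single_eq lookup_zero nat.distinct(1))
    then have "pure_tensor u (residue_scale (var i :: ('n, 'k) mpoly) 1) \<in> ?T"
      by (simp add: residue_scale_def pure_tensor_0_right)
    then have "free_scale (var i) (pure_tensor u 1) \<in> ?T"
      using free.subspace_mem_cong[OF T pure_tensor_scale_right] by blast
    then show ?thesis using free.subspace_mem_cong[OF T pure_tensor_scale_left] by blast
  qed
  then have "(\<Sum>i\<in>UNIV. sm (var i) (u i)) \<in> {v. pure_tensor v 1 \<in> ?T}" for u
    by (intro subspace_sum[OF sub]) simp
  then show ?thesis using v by (auto elim: irrelevant_multE)
qed

lemma tensor_relations_residue_iff:
  fixes sm :: "('n::finite, 'k::field) mpoly \<Rightarrow> 'm::ab_group_add \<Rightarrow> 'm"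
  assumes "module sm"
  shows "z \<in> tensor_relations sm residue_scale \<longleftrightarrow> tensor_contract sm z \<in> irrelevant_mult sm UNIV"
  using tensor_contract_relations[OF assms] pure_tensor_irrelevant_mult[OF assms]
    free.subspace_mem_cong[OF subspace_tensor_relations tensor_contract_pure_one[OF assms]] by blast

lemma tensor_contract_tensor_map:
  fixes f :: "'a::ab_group_add \<Rightarrow> 'b::ab_group_add"
    and z :: "'a \<times> 'k::field \<Rightarrow>\<^sub>0 ('n::finite, 'k) mpoly"
  assumes "module_hom s s' f"
  shows "tensor_contract s' (tensor_map f z) = f (tensor_contract s z)"
proof -
  interpret f: module_hom s s' f by fact
  have "tensor_map f = lin_ext (free_scale :: ('n, 'k) mpoly \<Rightarrow> _) (\<lambda>(x, y :: 'k). single (f x, y) 1)"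
    by (auto simp: tensor_map_def lin_ext_def fun_eq_iff intro!: sum.cong)
  then interpret map: module_hom free_scale free_scale "tensor_map f :: ('a \<times> 'k \<Rightarrow>\<^sub>0 ('n, 'k) mpoly) \<Rightarrow> _"
    using free.module_hom_lin_ext by metis
  interpret contract: module_hom free_scale s "tensor_contract s"
    by (rule module_hom_tensor_contract[OF f.m1.module_axioms])
  interpret contract': module_hom free_scale s' "tensor_contract s'"
    by (rule module_hom_tensor_contract[OF f.m2.module_axioms])
  have "tensor_contract s' (tensor_map f (single p a)) = f (tensor_contract s (single p a))" for p a
    by (cases p) (simp add: tensor_map_def tensor_contract_single[OF f.m1.module_axioms]
        tensor_contract_single[OF f.m2.module_axioms] f.scale)
  then show ?thesis
    using additive_eqI_single[of "\<lambda>z. tensor_contract s' (tensor_map f z)"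
        "\<lambda>z. f (tensor_contract s z)" z]
    by (simp add: additive_def map.add contract.add contract'.add f.add)
qed

lemma tor_cycles_residue_Suc:
  assumes "module_hom free_scale free_scale (d j)"
  shows "tor_cycles d residue_scale (Suc j)
      = {z. d j (tensor_contract free_scale z) \<in> irrelevant_mult free_scale UNIV}"
  by (simp add: tensor_relations_residue_iff[OF module_free_scale] tensor_contract_tensor_map[OF assms])

lemma tor_boundaries_residue_iff:
  assumes d: "module_hom free_scale free_scale (d i)"
    and f: "module_hom free_scale sm f" and exact: "range (d i) = {v. f v = 0}"
  shows "z \<in> tor_boundaries d residue_scale i
    \<longleftrightarrow> f (tensor_contract free_scale z) \<in> irrelevant_mult sm (range f)"
proof
  interpret f: module_hom free_scale sm f by fact
  note contract_map = tensor_contract_tensor_map[OF d]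
  note relations_iff = tensor_relations_residue_iff[OF module_free_scale]
  interpret contract: module_hom free_scale free_scale "tensor_contract free_scale"
    by (rule module_hom_tensor_contract[OF module_free_scale])
  {
    assume "z \<in> tor_boundaries d residue_scale i"
    then obtain w u where z: "z = tensor_map (d i) w + u"
      and u: "u \<in> tensor_relations free_scale residue_scale"
      unfolding tor_boundaries_def by blast
    have "f (d i v) = 0" for v using exact by blast
    then have "f (tensor_contract free_scale z) = f (tensor_contract free_scale u)"
      by (simp add: z contract.add contract_map f.add)
    then show "f (tensor_contract free_scale z) \<in> irrelevant_mult sm (range f)"
      using u relations_iff irrelevant_mult_image[OF f] by blast
  }
  assume "f (tensor_contract free_scale z) \<in> irrelevant_mult sm (range f)"
  then obtain m where m: "m \<in> irrelevant_mult free_scale UNIV" "f (tensor_contract free_scale z) = f m"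
    using irrelevant_mult_image[OF f] by blast
  then have "tensor_contract free_scale z - m \<in> range (d i)" unfolding exact by (simp add: f.diff)
  then obtain v where v: "tensor_contract free_scale z - m = d i v" by blast
  define w :: "(nat \<Rightarrow>\<^sub>0 ('a, 'b) mpoly) \<times> 'b \<Rightarrow>\<^sub>0 ('a, 'b) mpoly" where "w = pure_tensor v 1"
  have "tensor_contract free_scale (z - tensor_map (d i) w) = m"
    using v by (simp add: contract.diff contract_map w_def
        tensor_contract_pure[OF module_free_scale] algebra_simps)
  then have "z - tensor_map (d i) w \<in> tensor_relations free_scale residue_scale"
    using m(1) relations_iff by metis
  moreover have "z = tensor_map (d i) w + (z - tensor_map (d i) w)" by simp
  ultimately show "z \<in> tor_boundaries d residue_scale i" unfolding tor_boundaries_def by blast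
qed

lemma subspace_irrelevant_mult_range:
  assumes "module_hom s s' f"
  shows "module.subspace (kscale s') (irrelevant_mult s' (range f))"
proof -
  interpret module_hom s s' f by fact
  show ?thesis
    by (intro subspace_kscale subspace_irrelevant_mult m2.module_axioms subspace_image m1.subspace_UNIV)
qed

lemma linear_comp_tensor_contract:
  assumes "module_hom free_scale sm f"
  shows "Vector_Spaces.linear (kscale free_scale) (kscale sm) (\<lambda>z. f (tensor_contract free_scale z))"
  using module_hom_compose[OF module_hom_tensor_contract[OF module_free_scale] assms]
  by (intro linear_kscale) (simp add: comp_def)

lemma subspace_tor_boundaries:
  fixes d :: "nat \<Rightarrow> (nat \<Rightarrow>\<^sub>0 ('n::finite, 'k::field) mpoly) \<Rightarrow> _"
  assumes d: "module_hom free_scale free_scale (d i)"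
    and f: "module_hom free_scale sm f" and exact: "range (d i) = {v. f v = 0}"
  shows "module.subspace (kscale free_scale) (tor_boundaries d residue_scale i)"
proof -
  interpret f: Vector_Spaces.linear "kscale free_scale" "kscale sm"
    "\<lambda>z :: (nat \<Rightarrow>\<^sub>0 ('n, 'k) mpoly) \<times> 'k \<Rightarrow>\<^sub>0 ('n, 'k) mpoly. f (tensor_contract free_scale z)"
    by (rule linear_comp_tensor_contract[OF f])
  have "tor_boundaries d residue_scale i
      = {z. f (tensor_contract free_scale z) \<in> irrelevant_mult sm (range f)}"
    using tor_boundaries_residue_iff[where d = d, OF d f exact] by blast
  then show ?thesis using f.subspace_linear_preimage[OF subspace_irrelevant_mult_range[OF f]] by simp
qed

lemma has_quotient_dim_tor_iff:
  fixes d :: "nat \<Rightarrow> (nat \<Rightarrow>\<^sub>0 ('n::finite, 'k::field) mpoly) \<Rightarrow> _"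
  assumes d: "module_hom free_scale free_scale (d i)"
    and f: "module_hom free_scale sm f" and exact: "range (d i) = {v. f v = 0}"
    and A: "module.subspace (kscale sm) A"
  shows "has_quotient_dim (kscale free_scale) {z. f (tensor_contract free_scale z) \<in> A}
      (tor_boundaries d residue_scale i) n
    \<longleftrightarrow> has_quotient_dim (kscale sm) (range f \<inter> A) (irrelevant_mult sm (range f)) n"
proof (rule has_quotient_dim_linear_iff[OF linear_comp_tensor_contract[OF f]])
  interpret f: Vector_Spaces.linear "kscale free_scale" "kscale sm"
    "\<lambda>z :: (nat \<Rightarrow>\<^sub>0 ('n, 'k) mpoly) \<times> 'k \<Rightarrow>\<^sub>0 ('n, 'k) mpoly. f (tensor_contract free_scale z)"
    by (rule linear_comp_tensor_contract[OF f])
  show "f.vs1.subspace {z. f (tensor_contract free_scale z) \<in> A}"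
    by (rule f.subspace_linear_preimage[OF A])
  show irr: "f.vs2.subspace (irrelevant_mult sm (range f))"
    by (rule subspace_irrelevant_mult_range[OF f])
  fix x assume x: "x \<in> range f \<inter> A"
  then obtain v where "x = f v" by blast
  then show "\<exists>z\<in>{z. f (tensor_contract free_scale z) \<in> A}. x - f (tensor_contract free_scale z)
      \<in> irrelevant_mult sm (range f)"
    using x f.vs2.subspace_0[OF irr]
    by (intro bexI[of _ "pure_tensor v 1"]) (simp_all add: tensor_contract_pure[OF module_free_scale])
qed (simp_all add: tor_boundaries_residue_iff[where d = d, OF d f exact])

lemma has_quotient_dim_tor_koszul_iff:
  fixes sm :: "('n::{finite,linorder}, 'k::field) mpoly \<Rightarrow> 'm::ab_group_add \<Rightarrow> 'm"
  assumes sm: "module sm" and res: "free_resolution sm d \<epsilon>"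
  shows "has_quotient_dim (kscale free_scale) (tor_cycles d residue_scale i)
      (tor_boundaries d residue_scale i) n
    \<longleftrightarrow> has_quotient_dim (kscale (fun_scale sm)) (koszul_cycles sm var UNIV i)
        (koszul_boundaries sm var UNIV i) n"
proof (cases i)
  case 0
  interpret module sm by fact
  note res = free_resolutionD[OF res]
  have "subspace UNIV" "module.subspace (kscale sm) UNIV"
    by (simp_all add: subspace_kscale sm)
  then show ?thesis
    using has_quotient_dim_tor_iff[where d = d and i = 0, OF res(1,2,4), of UNIV n]
        has_quotient_dim_koszul_0_iff[OF sm, of UNIV UNIV n]
    unfolding 0 koszul_cycles_0 res(3) by simp
next
  case (Suc j)
  interpret d: module_hom free_scale free_scale "d j" by (rule free_resolutionD(1)[OF res])
  interpret k: vector_space "kscale (free_scale :: ('n, 'k) mpoly \<Rightarrow> (nat \<Rightarrow>\<^sub>0 _) \<Rightarrow> _)"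
    by (rule vector_space_kscale[OF module_free_scale])
  let ?\<mm>F = "irrelevant_mult free_scale (UNIV :: (nat \<Rightarrow>\<^sub>0 ('n, 'k) mpoly) set)"
  have range: "free.subspace (range (d j))" by (intro d.subspace_image free.subspace_UNIV)
  have \<mm>F: "k.subspace ?\<mm>F"
    by (intro subspace_kscale subspace_irrelevant_mult module_free_scale free.subspace_UNIV)
  have A: "k.subspace (range (d j) \<inter> ?\<mm>F)"
    by (intro k.subspace_inter \<mm>F subspace_kscale[OF module_free_scale range])
  have "koszul_chains (range (d j)) 0 \<inter> koszul_boundaries free_scale var UNIV 0
      = (koszul_chains (range (d j) \<inter> ?\<mm>F) 0 :: ('n set \<Rightarrow> nat \<Rightarrow>\<^sub>0 ('n, 'k) mpoly) set)"
    using free.subspace_0[OF range] k.subspace_0[OF \<mm>F] k.subspace_0[OF A]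
    by (auto simp: koszul_chains_0_iff koszul_boundaries_0_iff[OF module_free_scale])
  then show ?thesis
    using has_quotient_dim_koszul_resolution_iff[OF res, of 0 j n]
      has_quotient_dim_koszul_0_iff[OF module_free_scale A range, of n]
      has_quotient_dim_tor_iff[where d = d and i = "Suc j" and f = "d j" and A = ?\<mm>F and n = n,
        OF free_resolutionD(1,1,5)[OF res] \<mm>F]
    unfolding Suc tor_cycles_residue_Suc[OF free_resolutionD(1)[OF res]] by (simp only: add_Suc add_0)
qed

lemma tor_dim_eq_koszul_homology:
  fixes sm :: "('n::{finite,linorder}, 'k::field) mpoly \<Rightarrow> 'm::ab_group_add \<Rightarrow> 'm"
  assumes sm: "module sm" and "finitely_generated sm"
    and n: "has_quotient_dim (kscale (fun_scale sm)) (koszul_cycles sm var UNIV i)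
        (koszul_boundaries sm var UNIV i) n"
  shows "tor_dim sm i = n"
proof -
  define d where "d = (SOME d. \<exists>\<epsilon>. free_resolution sm d \<epsilon>)"
  obtain \<epsilon> where "free_resolution sm d \<epsilon>"
    unfolding d_def using someI_ex[OF free_resolution_exists[OF assms(1,2)]] by blast
  note res = this free_resolutionD[OF this]
  let ?V = "kscale (free_scale :: ('n, 'k) mpoly \<Rightarrow> ((nat \<Rightarrow>\<^sub>0 ('n, 'k) mpoly) \<times> 'k \<Rightarrow>\<^sub>0 _) \<Rightarrow> _)"
  interpret V: vector_space ?V by (rule vector_space_kscale[OF module_free_scale])
  have "V.subspace (tor_cycles d residue_scale i) \<and> V.subspace (tor_boundaries d residue_scale i)
    \<and> tor_boundaries d residue_scale i \<subseteq> tor_cycles d residue_scale i"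
  proof (cases i)
    case 0
    then show ?thesis using subspace_tor_boundaries[where d = d and i = 0, OF res(2,3,5)] by simp
  next
    case (Suc j)
    interpret d_tensor: Vector_Spaces.linear ?V "kscale free_scale"
        "\<lambda>z. d j (tensor_contract free_scale z)"
      by (rule linear_comp_tensor_contract[OF res(2)])
    have cycles: "tor_cycles d residue_scale (Suc j)
        = {z. d j (tensor_contract free_scale z) \<in> irrelevant_mult free_scale UNIV}"
      by (rule tor_cycles_residue_Suc[OF res(2)])
    have "V.subspace (tor_cycles d residue_scale (Suc j))"
      unfolding cycles
      by (intro d_tensor.subspace_linear_preimage subspace_kscale subspace_irrelevant_mult
          module_free_scale free.subspace_UNIV)
    moreover have "tor_boundaries d residue_scale (Suc j) \<subseteq> tor_cycles d residue_scale (Suc j)"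
      unfolding cycles using tor_boundaries_residue_iff[where d = d and i = "Suc j"
          and f = "d j", OF res(2,2,6)] irrelevant_mult_mono[OF subset_UNIV] by blast
    ultimately show ?thesis
      using subspace_tor_boundaries[where d = d and i = "Suc j" and f = "d j", OF res(2,2,6)] Suc by blast
  qed
  moreover have "has_quotient_dim ?V (tor_cycles d residue_scale i) (tor_boundaries d residue_scale i) n"
    using has_quotient_dim_tor_koszul_iff[OF sm res(1)] n by blast
  ultimately show ?thesis unfolding tor_dim_def Let_def d_def by (intro V.quotient_dim_eqI) blast+
qed

section \<open>Graded modules over the polynomial ring\<close>

definition monomial_degree :: "('n::finite \<Rightarrow>\<^sub>0 nat) \<Rightarrow> nat" where
  "monomial_degree \<alpha> = (\<Sum>i\<in>UNIV. lookup \<alpha> i)"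

lemma monomial_degree_add: "monomial_degree (\<alpha> + \<beta>) = monomial_degree \<alpha> + monomial_degree \<beta>"
  by (simp add: monomial_degree_def lookup_add sum.distrib)

lemma monomial_degree_0_iff: "monomial_degree \<alpha> = 0 \<longleftrightarrow> \<alpha> = 0"
  by (auto simp: monomial_degree_def intro: poly_mapping_eqI)

lemma finite_monomial_degree_eq: "finite {\<alpha> :: 'n::finite \<Rightarrow>\<^sub>0 nat. monomial_degree \<alpha> = d}"
proof (rule finite_imageD)
  have "lookup \<alpha> \<in> Pi\<^sub>E UNIV (\<lambda>_. {..d})" if "monomial_degree \<alpha> = d" for \<alpha> :: "'n \<Rightarrow>\<^sub>0 nat"
    using that member_le_sum[of _ UNIV "lookup \<alpha>"] by (auto simp: monomial_degree_def PiE_UNIV_domain)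
  then have "lookup ` {\<alpha> :: 'n \<Rightarrow>\<^sub>0 nat. monomial_degree \<alpha> = d} \<subseteq> Pi\<^sub>E UNIV (\<lambda>_. {..d})" by blast
  then show "finite (lookup ` {\<alpha> :: 'n \<Rightarrow>\<^sub>0 nat. monomial_degree \<alpha> = d})"
    by (rule finite_subset) (intro finite_PiE, auto)
qed (rule inj_onI, simp only: poly_mapping_eq_iff)

definition forms :: "int \<Rightarrow> ('n::finite, 'k::field) mpoly set" where
  "forms t = {f. \<forall>\<alpha>. lookup f \<alpha> \<noteq> 0 \<longrightarrow> int (monomial_degree \<alpha>) = t}"

lemma homogeneous_iff_forms: "homogeneous e f \<longleftrightarrow> f \<in> forms (int e)"
  by (auto simp: homogeneous_def forms_def in_keys_iff simp flip: monomial_degree_def)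

lemma forms_negative: "f \<in> forms t \<Longrightarrow> t < 0 \<Longrightarrow> f = 0"
  by (rule poly_mapping_eqI) (auto simp: forms_def)

lemma forms_zero [simp]: "0 \<in> forms t"
  by (simp add: forms_def)

lemma forms_add: "f \<in> forms t \<Longrightarrow> g \<in> forms t \<Longrightarrow> f + g \<in> forms t"
  by (auto simp: forms_def lookup_add) (metis add.right_neutral)

lemma forms_sum: "(\<And>i. i \<in> A \<Longrightarrow> f i \<in> forms t) \<Longrightarrow> sum f A \<in> forms t"
  by (induction A rule: infinite_finite_induct) (auto simp: forms_add)

lemma forms_diff: "f \<in> forms t \<Longrightarrow> g \<in> forms t \<Longrightarrow> f - g \<in> forms t"
  by (auto simp: forms_def lookup_minus) metis

lemma forms_mult:
  assumes "f \<in> forms s" "g \<in> forms t"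
  shows "f * g \<in> forms (s + t)"
proof -
  have "int (monomial_degree \<alpha>) = s + t" if "\<alpha> \<in> keys (f * g)" for \<alpha>
  proof -
    obtain \<beta> \<gamma> where "\<alpha> = \<beta> + \<gamma>" "\<beta> \<in> keys f" "\<gamma> \<in> keys g"
      using keys_mult[of f g] \<open>\<alpha> \<in> keys (f * g)\<close> by blast
    then show ?thesis using assms by (simp add: monomial_degree_add forms_def in_keys_iff)
  qed
  then show ?thesis by (simp add: forms_def in_keys_iff)
qed

lemma forms_single: "int (monomial_degree \<alpha>) = t \<Longrightarrow> single \<alpha> c \<in> forms t"
  by (auto simp: forms_def lookup_single when_def)

lemma const_in_forms: "const c \<in> forms 0"
  unfolding const_def by (rule forms_single) (simp add: monomial_degree_0_iff)

lemma var_in_forms: "var i \<in> forms 1"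
  unfolding var_def by (rule forms_single) (simp add: monomial_degree_def lookup_single when_def)

locale graded_components = module sm
  for sm :: "('n::{finite,linorder}, 'k::field) mpoly \<Rightarrow> 'm::ab_group_add \<Rightarrow> 'm" +
  fixes G :: "int \<Rightarrow> 'm set"
  assumes G_zero [simp]: "0 \<in> G t"
    and G_diff: "x \<in> G t \<Longrightarrow> y \<in> G t \<Longrightarrow> x - y \<in> G t"
    and G_scale: "f \<in> forms s \<Longrightarrow> x \<in> G t \<Longrightarrow> sm f x \<in> G (t + s)"
begin

lemma G_minus: "x \<in> G t \<Longrightarrow> - x \<in> G t"
  using G_diff[of 0 t x] by simp

lemma G_add: "x \<in> G t \<Longrightarrow> y \<in> G t \<Longrightarrow> x + y \<in> G t"
  using G_diff[OF _ G_minus] by fastforce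

lemma G_sum: "(\<And>i. i \<in> A \<Longrightarrow> f i \<in> G t) \<Longrightarrow> sum f A \<in> G t"
  by (induction A rule: infinite_finite_induct) (auto simp: G_add)

sublocale k: vector_space "kscale sm"
  by (rule vector_space_kscale) unfold_locales

lemma subspace_G: "k.subspace (G t)"
  by (rule k.subspaceI) (use G_scale[OF const_in_forms, of _ t] in \<open>auto simp: G_add kscale_def\<close>)

end

definition component_sum :: "(int \<Rightarrow>\<^sub>0 'm::ab_group_add) \<Rightarrow> 'm" where
  "component_sum c = (\<Sum>t\<in>keys c. lookup c t)"

lemma component_sum_superset: "finite T \<Longrightarrow> keys c \<subseteq> T \<Longrightarrow> component_sum c = (\<Sum>t\<in>T. lookup c t)"
  unfolding component_sum_def by (rule sum.mono_neutral_left) (auto simp: in_keys_iff)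

lemma additive_component_sum: "additive (component_sum :: _ \<Rightarrow> 'm::ab_group_add)"
proof
  fix c d :: "int \<Rightarrow>\<^sub>0 'm"
  have "keys (c + d) \<subseteq> keys c \<union> keys d" by (rule Poly_Mapping.keys_add)
  then show "component_sum (c + d) = component_sum c + component_sum d"
    by (simp add: component_sum_superset[of "keys c \<union> keys d"] lookup_add sum.distrib)
qed

lemma component_sum_single [simp]: "component_sum (single t x) = x"
  by (simp add: component_sum_superset[of "{t}"])

locale graded = graded_components sm G
  for sm :: "('n::{finite,linorder}, 'k::field) mpoly \<Rightarrow> 'm::ab_group_add \<Rightarrow> 'm" and G +
  assumes decomposition_ex1: "\<exists>!c. (\<forall>t. lookup c t \<in> G t) \<and> x = component_sum c"
begin

definition decomposition :: "'m \<Rightarrow> int \<Rightarrow>\<^sub>0 'm" where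
  "decomposition x = (THE c. (\<forall>t. lookup c t \<in> G t) \<and> x = component_sum c)"

definition component :: "int \<Rightarrow> 'm \<Rightarrow> 'm" where
  "component t x = lookup (decomposition x) t"

lemma decomposition_properties:
  "(\<forall>t. lookup (decomposition x) t \<in> G t) \<and> x = component_sum (decomposition x)"
  unfolding decomposition_def by (rule theI'[OF decomposition_ex1])

lemma decomposition_eqI: "(\<And>t. lookup c t \<in> G t) \<Longrightarrow> component_sum c = x \<Longrightarrow> decomposition x = c"
  using decomposition_ex1[of x] decomposition_properties[of x] by blast

lemma component_in_G [simp]: "component t x \<in> G t"
  using decomposition_properties by (simp add: component_def)

lemma finite_components: "finite {t. component t x \<noteq> 0}"
  by (simp add: component_def)

lemma eq_sum_components:
  assumes "finite T" "{t. component t x \<noteq> 0} \<subseteq> T"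
  shows "x = (\<Sum>t\<in>T. component t x)"
proof -
  have "component_sum (decomposition x) = (\<Sum>t\<in>T. component t x)"
    using assms unfolding component_def by (intro component_sum_superset) (auto simp: in_keys_iff)
  then show ?thesis using decomposition_properties by simp
qed

lemma component_add: "component t (x + y) = component t x + component t y"
proof -
  have "decomposition (x + y) = decomposition x + decomposition y"
    using decomposition_properties[of x] decomposition_properties[of y]
    by (intro decomposition_eqI) (simp_all add: lookup_add G_add additive.add[OF additive_component_sum])
  then show ?thesis by (simp add: component_def lookup_add)
qed

sublocale component: additive "component t" for t
  by unfold_locales (rule component_add)

lemma component_of_G:
  assumes "x \<in> G s"
  shows "component t x = (if t = s then x else 0)"
proof -
  have "decomposition x = single s x"
    using assms by (intro decomposition_eqI) (auto simp: lookup_single when_def)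
  then show ?thesis by (simp add: component_def lookup_single when_def)
qed

lemma component_scale:
  assumes "f \<in> forms e"
  shows "component (t + e) (sm f x) = sm f (component t x)"
proof -
  let ?T = "insert t {t. component t x \<noteq> 0}"
  have "finite ?T" using finite_components by simp
  then have "x = (\<Sum>s\<in>?T. component s x)" by (rule eq_sum_components) blast
  then have "component (t + e) (sm f x) = component (t + e) (sm f (\<Sum>s\<in>?T. component s x))" by simp
  also have "\<dots> = (\<Sum>s\<in>?T. component (t + e) (sm f (component s x)))"
    by (simp only: scale_sum_right component.sum)
  also have "\<dots> = (\<Sum>s\<in>?T. if s = t then sm f (component t x) else 0)"
    using component_of_G[OF G_scale[OF assms component_in_G]] by (intro sum.cong) auto
  also have "\<dots> = sm f (component t x)" using \<open>finite ?T\<close> by simp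
  finally show ?thesis .
qed

lemma component_koszul_diff:
  "koszul_diff sm var (\<lambda>U. component t (w U)) = (\<lambda>U. component (t + 1) (koszul_diff sm var w U))"
proof -
  have "koszul_sign i U * var i \<in> (forms 1 :: ('n, 'k) mpoly set)" for i and U
    using koszul_sign_cases[of i U, where 'r = "('n, 'k) mpoly"]
        forms_diff[OF forms_zero var_in_forms[of i]]
    by (auto simp: var_in_forms)
  then show ?thesis by (simp add: fun_eq_iff koszul_diff_apply component.sum component_scale)
qed

end

lemma graded_if_graded_module:
  assumes "graded_module sm G"
  shows "graded sm G"
proof -
  interpret module sm using assms by (simp add: graded_module_def)
  have "0 \<in> G t" "x \<in> G t \<Longrightarrow> y \<in> G t \<Longrightarrow> x - y \<in> G t" for t x y
    using assms by (auto simp: graded_module_def)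
  moreover have "sm f x \<in> G (t + s)" if f: "f \<in> forms s" and x: "x \<in> G t" for f x s t
  proof (cases "s < 0")
    case True
    then show ?thesis using forms_negative[OF f] \<open>\<And>t. 0 \<in> G t\<close> by simp
  next
    case False
    then have "homogeneous (nat s) f" using f by (simp add: homogeneous_iff_forms)
    then have "sm f x \<in> G (t + int (nat s))" using assms x unfolding graded_module_def by blast
    then show ?thesis using False by simp
  qed
  moreover have "\<exists>!c. (\<forall>t. lookup c t \<in> G t) \<and> x = component_sum c" for x
    using assms unfolding graded_module_def component_sum_def by blast
  ultimately show ?thesis by unfold_locales
qed

lemma mpoly_decomposition_ex1:
  fixes f :: "('n::finite, 'k::field) mpoly"
  shows "\<exists>!c. (\<forall>t. lookup c t \<in> forms t) \<and> f = component_sum c"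
proof (rule ex_ex1I)
  interpret total: additive component_sum by (rule additive_component_sum)
  define c where "c = (\<Sum>\<alpha>\<in>keys f. single (int (monomial_degree \<alpha>)) (single \<alpha> (lookup f \<alpha>)))"
  have "lookup c t \<in> forms t" for t
    unfolding c_def lookup_sum by (intro forms_sum) (simp add: lookup_single when_def forms_single)
  moreover have "component_sum c = f"
    by (simp add: c_def total.sum flip: poly_mapping_eq_sum_single)
  ultimately show "\<exists>c. (\<forall>t. lookup c t \<in> forms t) \<and> f = component_sum c"
    by (intro exI[of _ c]) simp
next
  have lookup_component: "lookup (lookup c t) \<alpha>
      = (if int (monomial_degree \<alpha>) = t then lookup (component_sum c) \<alpha> else 0)"
    if c: "\<forall>t. lookup c t \<in> forms t" for c :: "int \<Rightarrow>\<^sub>0 ('n, 'k) mpoly" and t \<alpha>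
  proof -
    have zero: "lookup (lookup c s) \<alpha> = 0" if "int (monomial_degree \<alpha>) \<noteq> s" for s
      using c that by (auto simp: forms_def)
    have "lookup (component_sum c) \<alpha> = (\<Sum>s\<in>keys c. lookup (lookup c s) \<alpha>)"
      by (simp add: component_sum_def lookup_sum)
    also have "\<dots> = (\<Sum>s\<in>{int (monomial_degree \<alpha>)}. lookup (lookup c s) \<alpha>)"
      by (rule sum.mono_neutral_cong) (auto simp: zero in_keys_iff)
    finally show ?thesis using zero by simp
  qed
  fix c d :: "int \<Rightarrow>\<^sub>0 ('n, 'k) mpoly"
  assume "(\<forall>t. lookup c t \<in> forms t) \<and> f = component_sum c"
    "(\<forall>t. lookup d t \<in> forms t) \<and> f = component_sum d"
  then show "c = d" by (auto intro!: poly_mapping_eqI simp: lookup_component)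
qed

interpretation mpoly: graded "(*) :: ('n::{finite,linorder}, 'k::field) mpoly \<Rightarrow> _" forms
proof (intro graded.intro graded_components.intro graded_components_axioms.intro graded_axioms.intro
    module_mult)
  show "f * g \<in> forms (t + s)" if "f \<in> forms s" "g \<in> forms t" for f g :: "('n, 'k) mpoly" and s t
    using forms_mult[OF that] by (simp add: add.commute)
qed (simp_all add: forms_diff mpoly_decomposition_ex1)

declare mpoly.scale_scale [simp del] \<comment> \<open>loops with associativity of multiplication\<close>

context graded
begin

lemma component_scale_of_G:
  assumes "g \<in> G a"
  shows "component t (sm f g) = sm (mpoly.component (t - a) f) g"
proof -
  let ?E = "insert (t - a) {e. mpoly.component e f \<noteq> 0}"
  have "finite ?E" using mpoly.finite_components by simp
  then have "f = (\<Sum>e\<in>?E. mpoly.component e f)" by (rule mpoly.eq_sum_components) blast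
  then have "component t (sm f g) = component t (sm (\<Sum>e\<in>?E. mpoly.component e f) g)" by simp
  also have "\<dots> = (\<Sum>e\<in>?E. component t (sm (mpoly.component e f) g))"
    by (simp only: scale_sum_left component.sum)
  also have "\<dots> = (\<Sum>e\<in>?E. if e = t - a then sm (mpoly.component (t - a) f) g else 0)"
    using component_of_G[OF G_scale[OF mpoly.component_in_G assms]] by (intro sum.cong) auto
  also have "\<dots> = sm (mpoly.component (t - a) f) g" using \<open>finite ?E\<close> by simp
  finally show ?thesis .
qed

lemma finite_homogeneous_generators:
  assumes "finitely_generated sm"
  obtains S deg where "finite S" "span S = UNIV" "\<forall>g\<in>S. g \<in> G (deg g)"
proof -
  obtain B where B: "finite B" "span B = UNIV" using assms unfolding finitely_generated_def by blast
  define S where "S = (\<Union>b\<in>B. (\<lambda>t. component t b) ` {t. component t b \<noteq> 0})"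
  have "b \<in> span S" if "b \<in> B" for b
  proof -
    have "(\<Sum>t\<in>{t. component t b \<noteq> 0}. component t b) \<in> span S"
      using that by (intro span_sum span_base) (auto simp: S_def)
    then show ?thesis using eq_sum_components[OF finite_components order_refl, of b] by simp
  qed
  then have "span S = UNIV" using span_minimal[of B "span S"] B(2) by auto
  moreover have "finite S" using B(1) finite_components by (simp add: S_def)
  moreover have "\<forall>g\<in>S. \<exists>a. g \<in> G a"
    using component_in_G unfolding S_def by blast
  ultimately show ?thesis using that by metis
qed

lemma G_eq_sum_forms_scale:
  assumes S: "finite S" "span S = UNIV" "\<forall>g\<in>S. g \<in> G (deg g)" and x: "x \<in> G t"
  obtains f where "\<forall>g. f g \<in> forms (t - deg g)" "x = (\<Sum>g\<in>S. sm (f g) g)"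
proof -
  obtain f where f: "x = (\<Sum>g\<in>S. sm (f g) g)" using S(2) span_finite[OF S(1)] by auto
  have "x = component t x" using component_of_G[OF x] by simp
  also have "\<dots> = (\<Sum>g\<in>S. component t (sm (f g) g))" unfolding f by (rule component.sum)
  also have "\<dots> = (\<Sum>g\<in>S. sm (mpoly.component (t - deg g) (f g)) g)"
    by (intro sum.cong refl component_scale_of_G bspec[OF S(3)])
  finally show ?thesis by (intro that[of "\<lambda>g. mpoly.component (t - deg g) (f g)"]) simp_all
qed

end

lemma forms_finite_dimensional:
  "\<exists>T :: ('n::{finite,linorder}, 'k::field) mpoly set. finite T \<and> forms t \<subseteq> mpoly.k.span T"
proof (intro exI conjI)
  let ?M = "{\<alpha> :: 'n \<Rightarrow>\<^sub>0 nat. monomial_degree \<alpha> = nat t}"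
  let ?T = "(\<lambda>\<alpha>. single \<alpha> 1) ` ?M :: ('n, 'k) mpoly set"
  show "finite ?T" by (simp add: finite_monomial_degree_eq)
  show "forms t \<subseteq> mpoly.k.span ?T"
  proof
    fix f :: "('n, 'k) mpoly" assume "f \<in> forms t"
    then have "keys f \<subseteq> ?M" by (auto simp: forms_def in_keys_iff)
    then have "(\<Sum>\<alpha>\<in>keys f. kscale (*) (lookup f \<alpha>) (single \<alpha> 1)) \<in> mpoly.k.span ?T"
      by (intro mpoly.k.span_sum mpoly.k.span_scale mpoly.k.span_base) auto
    then show "f \<in> mpoly.k.span ?T" by (simp add: kscale_def flip: poly_mapping_eq_sum_single)
  qed
qed

section \<open>The Cech complex\<close>

lemma forms_power: "f \<in> forms t \<Longrightarrow> f ^ n \<in> forms (int n * t)"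
  using const_in_forms[of 1] by (induction n) (auto simp: distrib_right dest: forms_mult)

lemma var_prod_empty [simp]: "var_prod {} = 1"
  by (simp add: var_prod_def)

lemma var_prod_remove:
  "i \<in> T \<Longrightarrow> (var_prod T :: ('n::finite, 'k::field) mpoly) = var i * var_prod (T - {i})"
  unfolding var_prod_def by (rule prod.remove) auto

lemma koszul_sign_in_forms: "koszul_sign i U \<in> forms 0"
  using koszul_sign_cases[of i U, where 'r = "('a, 'b) mpoly"] const_in_forms[of 1]
      forms_diff[OF forms_zero const_in_forms[of 1]]
  by auto

lemma var_prod_in_forms: "var_prod S \<in> forms (int (card S))"
  using const_in_forms[of 1]
  by (induction S rule: finite_induct[OF finite])
      (auto simp: var_prod_def dest: forms_mult[OF var_in_forms])

lemma (in module) koszul_codiff_cong: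
  "(\<And>i. i \<in> T \<Longrightarrow> w (T - {i}) = w' (T - {i})) \<Longrightarrow> koszul_codiff scale y w T = koszul_codiff scale y w' T"
  unfolding koszul_codiff_apply by (intro sum.cong) auto

lemma (in module) fraction_eq_iff:
  "fraction scale f m a = fraction scale f m' b \<longleftrightarrow> (\<exists>c. scale (f ^ (c + b)) m = scale (f ^ (c + a)) m')"
proof
  assume "fraction scale f m a = fraction scale f m' b"
  moreover have "(m', b) \<in> fraction scale f m' b" by (auto simp: fraction_def)
  ultimately have "(m', b) \<in> fraction scale f m a" by simp
  then show "\<exists>c. scale (f ^ (c + b)) m = scale (f ^ (c + a)) m'" by (auto simp: fraction_def power_add)
next
  have trans: "\<exists>c. scale (f ^ (c + e)) m = scale (f ^ (c + a)) m''"
    if "scale (f ^ (c + b)) m = scale (f ^ (c + a)) m'"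
      "scale (f ^ (c' + e)) m' = scale (f ^ (c' + b)) m''"
    for m m' m'' a b e c c'
  proof -
    have "scale (f ^ ((c + c' + b) + e)) m = scale (f ^ (c' + e)) (scale (f ^ (c + b)) m)"
      by (simp add: power_add[symmetric] add_ac)
    also have "\<dots> = scale (f ^ (c + a)) (scale (f ^ (c' + e)) m')"
      unfolding that(1) by (simp add: mult.commute)
    also have "\<dots> = scale (f ^ ((c + c' + b) + a)) m''"
      unfolding that(2) by (simp add: power_add[symmetric] add_ac)
    finally show ?thesis by blast
  qed
  assume "\<exists>c. scale (f ^ (c + b)) m = scale (f ^ (c + a)) m'"
  then obtain c where c: "scale (f ^ (c + b)) m = scale (f ^ (c + a)) m'" by blast
  have "(m'', e) \<in> fraction scale f m a \<longleftrightarrow> (m'', e) \<in> fraction scale f m' b" for m'' e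
    unfolding fraction_def using trans[OF c] trans[OF c[symmetric]] by (auto simp: power_add[symmetric])
  then show "fraction scale f m a = fraction scale f m' b" by auto
qed

text \<open>The localizations at \<open>x\<^sub>S\<close> are the colimits of \<open>M \<rightarrow> M \<rightarrow> \<dots>\<close> along multiplication by \<open>x\<^sub>S\<close>, so the
  Cech complex is the colimit along \<open>cech_shift\<close> of the Koszul complexes on the powers of the
  variables. Here \<open>m\<close> represents the cochain with values \<open>m S / x\<^sub>S\<^sup>a\<close>.\<close>

definition cech_fractions ::
  "(('n::finite, 'k::field) mpoly \<Rightarrow> 'm::ab_group_add \<Rightarrow> 'm) \<Rightarrow> nat \<Rightarrow> nat \<Rightarrow> ('n set \<Rightarrow> 'm) \<Rightarrow> 'n set
      \<Rightarrow> ('m \<times> nat) set" where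
  "cech_fractions sm p a m = (\<lambda>S\<in>{S. card S = p}. fraction sm (var_prod S) (m S) a)"

definition cech_shift ::
  "(('n::finite, 'k::field) mpoly \<Rightarrow> 'm::ab_group_add \<Rightarrow> 'm) \<Rightarrow> nat \<Rightarrow> ('n set \<Rightarrow> 'm) \<Rightarrow> 'n set \<Rightarrow> 'm" where
  "cech_shift sm e m = (\<lambda>S. sm (var_prod S ^ e) (m S))"

abbreviation cech_codiff ::
  "(('n::{finite,linorder}, 'k::field) mpoly \<Rightarrow> 'm::ab_group_add \<Rightarrow> 'm) \<Rightarrow> nat \<Rightarrow> ('n set \<Rightarrow> 'm) \<Rightarrow> 'n set
      \<Rightarrow> 'm" where
  "cech_codiff sm a \<equiv> koszul_codiff sm (\<lambda>i. var i ^ a)"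

definition cech_strand :: "(int \<Rightarrow> 'm set) \<Rightarrow> int \<Rightarrow> nat \<Rightarrow> ('n::finite set \<Rightarrow> 'm) set" where
  "cech_strand G t a = {m. \<forall>S. m S \<in> G (t + int a * int (card S))}"

context
  fixes sm :: "('n::{finite,linorder}, 'k::field) mpoly \<Rightarrow> 'm::ab_group_add \<Rightarrow> 'm"
  assumes sm: "module sm"
begin

interpretation module sm by (rule sm)

lemma cech_shift_shift: "cech_shift sm e (cech_shift sm f m) = cech_shift sm (e + f) m"
  by (simp add: cech_shift_def power_add)

lemma cech_shift_codiff:
  "cech_shift sm e (cech_codiff sm a m) = cech_codiff sm (a + e) (cech_shift sm e m)"
proof
  fix T
  have "var_prod T ^ e * (koszul_sign i T * var i ^ a)
      = (koszul_sign i T * var i ^ (a + e) * var_prod (T - {i}) ^ e :: ('n, 'k) mpoly)" if "i \<in> T" for i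
    using var_prod_remove[OF that, where 'k = 'k] by (simp add: power_mult_distrib power_add mult_ac)
  then show "cech_shift sm e (cech_codiff sm a m) T = cech_codiff sm (a + e) (cech_shift sm e m) T"
    unfolding cech_shift_def koszul_codiff_apply scale_sum_right
    by (intro sum.cong) (simp_all only: scale_scale)
qed

lemma cech_fractions_eq_iff:
  "cech_fractions sm p a m = cech_fractions sm p b m'
    \<longleftrightarrow> (\<exists>e. \<forall>S. card S = p \<longrightarrow> cech_shift sm (e + b) m S = cech_shift sm (e + a) m' S)"
proof
  assume eq: "cech_fractions sm p a m = cech_fractions sm p b m'"
  have "fraction sm (var_prod S) (m S) a = fraction sm (var_prod S) (m' S) b" if "card S = p" for S
    using fun_cong[OF eq, of S] that by (simp add: cech_fractions_def)
  then have "\<forall>S. \<exists>c. card S = p \<longrightarrow> cech_shift sm (c + b) m S = cech_shift sm (c + a) m' S"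
    unfolding fraction_eq_iff cech_shift_def by blast
  then obtain c where c: "\<And>S. card S = p \<Longrightarrow> cech_shift sm (c S + b) m S = cech_shift sm (c S + a) m' S"
    by metis
  define e where "e = (\<Sum>S\<in>UNIV. c S)"
  have "cech_shift sm (e + b) m S = cech_shift sm (e + a) m' S" if "card S = p" for S
  proof -
    have "c S \<le> e" unfolding e_def by (intro member_le_sum) auto
    then have "e + b = (e - c S) + (c S + b)" "e + a = (e - c S) + (c S + a)" by simp_all
    then show ?thesis using c[OF that]
      by (simp only: cech_shift_shift[symmetric]) (simp only: cech_shift_def)
  qed
  then show "\<exists>e. \<forall>S. card S = p \<longrightarrow> cech_shift sm (e + b) m S = cech_shift sm (e + a) m' S" by blast
next
  assume "\<exists>e. \<forall>S. card S = p \<longrightarrow> cech_shift sm (e + b) m S = cech_shift sm (e + a) m' S"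
  then show "cech_fractions sm p a m = cech_fractions sm p b m'"
    unfolding cech_fractions_def cech_shift_def by (intro restrict_ext) (auto simp: fraction_eq_iff)
qed

lemma cech_zero_eq: "cech_zero sm p = cech_fractions sm p a 0"
proof -
  have "cech_fractions sm p 0 0 = cech_fractions sm p a 0"
    unfolding cech_fractions_eq_iff by (simp add: cech_shift_def)
  then show ?thesis by (simp add: cech_zero_def cech_fractions_def)
qed

lemma fraction_codiff_cong:
  assumes "\<And>i. i \<in> T \<Longrightarrow> fraction sm (var_prod (T - {i})) (m i) a
      = fraction sm (var_prod (T - {i})) (m' i) b"
  shows "fraction sm (var_prod T) (\<Sum>i\<in>T. sm (s i * var i ^ a) (m i)) a
    = fraction sm (var_prod T) (\<Sum>i\<in>T. sm (s i * var i ^ b) (m' i)) b"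
proof -
  let ?x = "\<lambda>i. var_prod (T - {i})"
  have "\<forall>i. \<exists>c. i \<in> T \<longrightarrow> sm (?x i ^ (c + b)) (m i) = sm (?x i ^ (c + a)) (m' i)"
    using assms unfolding fraction_eq_iff by blast
  then obtain c where c: "\<And>i. i \<in> T \<Longrightarrow> sm (?x i ^ (c i + b)) (m i) = sm (?x i ^ (c i + a)) (m' i)"
    by metis
  define e where "e = (\<Sum>i\<in>T. c i)"
  have "sm (var_prod T ^ (e + b)) (sm (s i * var i ^ a) (m i))
      = sm (var_prod T ^ (e + a)) (sm (s i * var i ^ b) (m' i))"
    if i: "i \<in> T" for i
  proof -
    have "c i \<le> e" unfolding e_def using i by (intro member_le_sum) auto
    then obtain k where e: "e = k + c i" by (metis add.commute le_Suc_ex)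
    have "sm (var_prod T ^ (e + b)) (sm (s i * var i ^ a) (m i))
        = sm (s i * var i ^ (e + a + b) * ?x i ^ k) (sm (?x i ^ (c i + b)) (m i))"
      using var_prod_remove[OF i, where 'k = 'k] by (simp add: e power_mult_distrib power_add mult_ac)
    also have "\<dots> = sm (var_prod T ^ (e + a)) (sm (s i * var i ^ b) (m' i))"
      unfolding c[OF i] using var_prod_remove[OF i, where 'k = 'k]
      by (simp add: e power_mult_distrib power_add mult_ac)
    finally show ?thesis .
  qed
  then have "sm (var_prod T ^ (e + b)) (\<Sum>i\<in>T. sm (s i * var i ^ a) (m i))
      = sm (var_prod T ^ (e + a)) (\<Sum>i\<in>T. sm (s i * var i ^ b) (m' i))"
    unfolding scale_sum_right by (intro sum.cong refl)
  then show ?thesis unfolding fraction_eq_iff by blast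
qed

lemma cech_diff_fractions:
  "cech_diff sm p (cech_fractions sm p a m) = cech_fractions sm (Suc p) a (cech_codiff sm a m)"
  unfolding cech_diff_def cech_fractions_def[of sm "Suc p"]
proof (rule restrict_ext)
  fix T :: "'n set" assume "T \<in> {T. card T = Suc p}"
  then have frac: "cech_fractions sm p a m (T - {i}) = fraction sm (var_prod (T - {i})) (m (T - {i})) a"
    if "i \<in> T" for i using that by (simp add: cech_fractions_def)
  let ?z = "\<lambda>m a. fraction sm (var_prod T) (\<Sum>i\<in>T. sm ((-1) ^ card {j\<in>T. j < i} * var i ^ a) (m i)) a"
  have "(THE z. \<exists>m' b. (\<forall>i\<in>T. cech_fractions sm p a m (T - {i})
      = fraction sm (var_prod (T - {i})) (m' i) b)
      \<and> z = ?z m' b) = ?z (\<lambda>i. m (T - {i})) a"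
  proof (rule the_equality)
    fix z assume "\<exists>m' b. (\<forall>i\<in>T. cech_fractions sm p a m (T - {i})
        = fraction sm (var_prod (T - {i})) (m' i) b)
      \<and> z = ?z m' b"
    then obtain m' b where m': "\<And>i. i \<in> T \<Longrightarrow> cech_fractions sm p a m (T - {i})
        = fraction sm (var_prod (T - {i})) (m' i) b"
      and z: "z = ?z m' b" by blast
    have "fraction sm (var_prod (T - {i})) (m' i) b = fraction sm (var_prod (T - {i})) (m (T - {i})) a"
      if "i \<in> T" for i using m'[OF that] frac[OF that] by simp
    then show "z = ?z (\<lambda>i. m (T - {i})) a" unfolding z by (rule fraction_codiff_cong)
  qed (intro exI[of _ "\<lambda>i. m (T - {i})"] exI[of _ a], simp add: frac)
  then show "(THE z. \<exists>m' b. (\<forall>i\<in>T. cech_fractions sm p a m (T - {i})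
      = fraction sm (var_prod (T - {i})) (m' i) b)
      \<and> z = ?z m' b) = fraction sm (var_prod T) (cech_codiff sm a m T) a"
    by (simp add: koszul_codiff_apply koszul_sign_def)
qed

end

context graded_components
begin

lemma G_koszul_sign: "x \<in> G t \<Longrightarrow> sm (koszul_sign i U) x \<in> G t"
  using G_scale[OF koszul_sign_in_forms, of x t] by simp

lemma cech_shift_strand:
  assumes "m \<in> cech_strand G t a"
  shows "cech_shift sm e m \<in> cech_strand G t (a + e)"
proof -
  have "sm (var_prod S ^ e) (m S) \<in> G (t + int a * int (card S) + int e * int (card S))" for S
    using assms by (intro G_scale forms_power var_prod_in_forms) (simp add: cech_strand_def)
  then show ?thesis by (simp add: cech_strand_def cech_shift_def algebra_simps)
qed

lemma cech_codiff_strand: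
  assumes m: "m \<in> cech_strand G t a"
  shows "cech_codiff sm a m \<in> cech_strand G t a"
proof -
  have "sm (koszul_sign i T * var i ^ a) (m (T - {i})) \<in> G (t + int a * int (card T))" if "i \<in> T" for i T
  proof -
    have "sm (koszul_sign i T * var i ^ a) (m (T - {i}))
        \<in> G (t + int a * int (card (T - {i})) + (0 + int a * 1))"
      using m by (intro G_scale forms_mult forms_power var_in_forms koszul_sign_in_forms)
          (simp add: cech_strand_def)
    moreover have "int (card T) = int (card (T - {i})) + 1" using card_Suc_Diff1[OF finite that] by simp
    ultimately show ?thesis by (simp add: algebra_simps)
  qed
  then show ?thesis by (auto simp: cech_strand_def koszul_codiff_apply intro!: G_sum)
qed

lemma cech_cochains_eq: "cech_cochains sm G p t = {cech_fractions sm p a m | a m. m \<in> cech_strand G t a}"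
proof (intro equalityI subsetI)
  fix c assume c: "c \<in> cech_cochains sm G p t"
  have "\<forall>S. \<exists>m a. card S = p \<longrightarrow> c S = fraction sm (var_prod S) m a \<and> m \<in> G (t + int a * int p)"
    using c unfolding cech_cochains_def by (fastforce simp: PiE_iff)
  then obtain m a where c_eq: "\<And>S. card S = p \<Longrightarrow> c S = fraction sm (var_prod S) (m S) (a S)"
    and mG: "\<And>S. card S = p \<Longrightarrow> m S \<in> G (t + int (a S) * int p)" by metis
  define b where "b = (\<Sum>S\<in>UNIV. a S)"
  have exponent_le: "a S \<le> b" for S unfolding b_def by (intro member_le_sum) auto
  define m' where "m' S = (if card S = p then sm (var_prod S ^ (b - a S)) (m S) else 0)" for S
  have "m' S \<in> G (t + int b * int (card S))" for S
  proof (cases "card S = p")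
    case True
    then have "m' S \<in> G (t + int (a S) * int p + int (b - a S) * int (card S))"
      unfolding m'_def if_P[OF True] by (intro G_scale forms_power var_prod_in_forms mG)
    then show ?thesis using exponent_le[of S] True by (simp add: of_nat_diff algebra_simps)
  qed (simp add: m'_def)
  moreover have "c = cech_fractions sm p b m'"
  proof
    fix S
    have "fraction sm (var_prod S) (m S) (a S)
        = fraction sm (var_prod S) (sm (var_prod S ^ (b - a S)) (m S)) b"
      unfolding fraction_eq_iff using exponent_le[of S] by (intro exI[of _ 0]) (simp flip: power_add)
    then show "c S = cech_fractions sm p b m' S"
      using c c_eq by (simp add: cech_fractions_def m'_def cech_cochains_def PiE_iff extensional_def)
  qed
  ultimately show "c \<in> {cech_fractions sm p a m | a m. m \<in> cech_strand G t a}"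
    by (auto simp: cech_strand_def)
qed (auto simp: cech_cochains_def cech_fractions_def cech_strand_def, blast)

end

definition cech_exact ::
  "(('n::{finite,linorder}, 'k::field) mpoly \<Rightarrow> 'm::ab_group_add \<Rightarrow> 'm) \<Rightarrow> (int \<Rightarrow> 'm set) \<Rightarrow> nat \<Rightarrow> int
      \<Rightarrow> bool" where
  "cech_exact sm G p t \<longleftrightarrow> (\<forall>a. \<forall>m\<in>cech_strand G t a.
     (\<forall>T. card T = Suc p \<longrightarrow> cech_codiff sm a m T = 0) \<longrightarrow>
     (\<exists>b\<ge>a. \<exists>m'\<in>cech_strand G t b. \<forall>S. card S = p \<longrightarrow> cech_codiff sm b m' S = cech_shift sm (b - a) m S))"

lemma cech_exactD:
  assumes "cech_exact sm G p t" "m \<in> cech_strand G t a"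
    and "\<And>T. card T = Suc p \<Longrightarrow> cech_codiff sm a m T = 0"
  obtains b m' where "b \<ge> a" "m' \<in> cech_strand G t b"
    "\<forall>S. card S = p \<longrightarrow> cech_codiff sm b m' S = cech_shift sm (b - a) m S"
  using assms unfolding cech_exact_def by blast

context graded_components
begin

lemma cech_exact_if_local_cohomology_vanishes:
  assumes "local_cohomology_vanishes sm G p t"
  shows "cech_exact sm G p t"
  unfolding cech_exact_def
proof (intro allI ballI impI)
  fix a and m :: "'n set \<Rightarrow> 'm"
  assume m: "m \<in> cech_strand G t a" and "\<forall>T. card T = Suc p \<longrightarrow> cech_codiff sm a m T = 0"
  then have "cech_fractions sm (Suc p) a (cech_codiff sm a m) = cech_zero sm (Suc p)"
    unfolding cech_zero_eq[OF module_axioms, of _ a]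
    by (simp add: cech_fractions_def cong: restrict_cong)
  moreover have "cech_fractions sm p a m \<in> cech_cochains sm G p t" using m cech_cochains_eq by blast
  ultimately have "cech_fractions sm p a m \<in> cech_cocycles sm G p t"
    by (simp add: cech_cocycles_def cech_diff_fractions[OF module_axioms])
  then have boundary: "cech_fractions sm p a m \<in> cech_coboundaries sm G p t"
    using assms by (simp add: local_cohomology_vanishes_def)
  show "\<exists>b\<ge>a. \<exists>m'\<in>cech_strand G t b. \<forall>S. card S = p \<longrightarrow> cech_codiff sm b m' S = cech_shift sm (b - a) m S"
  proof (cases p)
    case 0
    then have "cech_fractions sm 0 a m = cech_fractions sm 0 a 0"
      using boundary cech_zero_eq[OF module_axioms] by simp
    then have "m {} = 0" unfolding cech_fractions_eq_iff[OF module_axioms] by (auto simp: cech_shift_def)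
    then show ?thesis using 0 by (intro exI[of _ a] conjI bexI[of _ 0])
        (auto simp: cech_strand_def cech_shift_def koszul_codiff_apply)
  next
    case (Suc q)
    then obtain b m' where m': "m' \<in> cech_strand G t b"
      and "cech_fractions sm p a m = cech_diff sm q (cech_fractions sm q b m')"
      using boundary cech_cochains_eq by auto
    then have "cech_fractions sm p a m = cech_fractions sm p b (cech_codiff sm b m')"
      using Suc by (simp add: cech_diff_fractions[OF module_axioms])
    then obtain e where e: "\<And>S. card S = p \<Longrightarrow>
        cech_shift sm (e + b) m S = cech_shift sm (e + a) (cech_codiff sm b m') S"
      unfolding cech_fractions_eq_iff[OF module_axioms] by blast
    show ?thesis
      using e cech_shift_strand[OF m', of "e + a"]
      by (intro exI[of _ "b + (e + a)"] conjI bexI[of _ "cech_shift sm (e + a) m'"])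
        (simp_all add: cech_shift_codiff[OF module_axioms] add_ac)
  qed
qed

lemma socle_eq_0:
  assumes "local_cohomology_vanishes sm G 0 t" and x: "x \<in> G t" and "\<And>i. sm (var i) x = 0"
  shows "x = 0"
proof -
  define m where "m S = (if S = {} then x else 0)" for S :: "'n set"
  have "m \<in> cech_strand G t 1" using x by (simp add: m_def cech_strand_def)
  moreover have "cech_codiff sm 1 m T = 0" for T
    unfolding koszul_codiff_apply using assms(3)
    by (intro sum.neutral) (simp add: m_def scale_scale[symmetric] del: scale_scale)
  ultimately obtain b m' where "\<And>S. card S = 0 \<Longrightarrow> cech_codiff sm b m' S = cech_shift sm (b - 1) m S"
    using cech_exactD[OF cech_exact_if_local_cohomology_vanishes[OF assms(1)]] by metis
  from this[of "{}"] show "x = 0" by (simp add: koszul_codiff_apply cech_shift_def m_def)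
qed

end

section \<open>From local cohomology to Koszul homology\<close>

definition fun_components :: "(int \<Rightarrow> 'm set) \<Rightarrow> int \<Rightarrow> ('u \<Rightarrow> 'm) set" where
  "fun_components G t = {w. \<forall>U. w U \<in> G t}"

definition row_primitive ::
  "(('n::{finite,linorder}, 'k::field) mpoly \<Rightarrow> 'm::ab_group_add \<Rightarrow> 'm) \<Rightarrow> ('n set \<Rightarrow> 'n set \<Rightarrow> 'm)
      \<Rightarrow> 'n set \<Rightarrow> 'n set \<Rightarrow> 'm" where
  "row_primitive sm X S =
    (if S = {} then 0 else fun_scale sm (var_prod (S - {Min S})) (wedge sm (Min S) (X S)))"

context graded_components
begin

lemma graded_components_fun: "graded_components (fun_scale sm) (fun_components G)"
  by (intro graded_components.intro graded_components_axioms.intro module_fun_scale module_axioms)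
    (auto simp: fun_components_def G_diff G_scale)

lemma cech_exact_fun:
  assumes exact: "cech_exact sm G p t"
  shows "cech_exact (fun_scale sm) (fun_components G :: int \<Rightarrow> ('u::finite \<Rightarrow> 'm) set) p t"
  unfolding cech_exact_def
proof (intro allI ballI impI)
  fix a and w :: "'n set \<Rightarrow> 'u \<Rightarrow> 'm"
  assume w: "w \<in> cech_strand (fun_components G) t a"
    and cocycle: "\<forall>T. card T = Suc p \<longrightarrow> cech_codiff (fun_scale sm) a w T = 0"
  have eval: "cech_codiff (fun_scale sm) a w T U = cech_codiff sm a (\<lambda>S. w S U) T" for a T U
    and w :: "'n set \<Rightarrow> 'u \<Rightarrow> 'm"
    by (simp add: koszul_codiff_apply sum_fun_apply
        module.koszul_codiff_apply[OF module_fun_scale[OF module_axioms]])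
  have "\<exists>b m'. b \<ge> a \<and> m' \<in> cech_strand G t b \<and>
      (\<forall>S. card S = p \<longrightarrow> cech_codiff sm b m' S = cech_shift sm (b - a) (\<lambda>S. w S U) S)" for U
  proof -
    have "(\<lambda>S. w S U) \<in> cech_strand G t a" using w by (simp add: cech_strand_def fun_components_def)
    moreover have "cech_codiff sm a (\<lambda>S. w S U) T = 0" if "card T = Suc p" for T
      using cocycle that by (simp flip: eval)
    ultimately show ?thesis using exact unfolding cech_exact_def by blast
  qed
  then obtain b m' where ba: "\<And>U. b U \<ge> a" and m': "\<And>U. m' U \<in> cech_strand G t (b U)"
    and m'_eq: "\<And>U S. card S = p \<Longrightarrow> cech_codiff sm (b U) (m' U) S = cech_shift sm (b U - a) (\<lambda>S. w S U) S"
    by metis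
  define B where "B = a + (\<Sum>U\<in>UNIV. b U)"
  have bB: "b U \<le> B" for U unfolding B_def by (intro trans_le_add2 member_le_sum) auto
  define u where "u S U = cech_shift sm (B - b U) (m' U) S" for S U
  have "cech_shift sm (B - b U) (m' U) \<in> cech_strand G t B" for U
    using cech_shift_strand[OF m', of "B - b U" U] bB by simp
  then have "u \<in> cech_strand (fun_components G) t B"
    by (simp add: cech_strand_def fun_components_def u_def)
  moreover have "cech_codiff (fun_scale sm) B u S = cech_shift (fun_scale sm) (B - a) w S"
    if "card S = p" for S
  proof
    fix U
    have "cech_codiff (fun_scale sm) B u S U
        = cech_codiff sm (b U + (B - b U)) (cech_shift sm (B - b U) (m' U)) S"
      using bB[of U] by (simp add: eval u_def)
    also have "\<dots> = cech_shift sm (B - b U) (cech_codiff sm (b U) (m' U)) S"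
      unfolding cech_shift_codiff[OF module_axioms] ..
    also have "\<dots> = cech_shift sm ((B - b U) + (b U - a)) (\<lambda>S. w S U) S"
      using m'_eq[OF that] by (simp add: cech_shift_def power_add)
    finally show "cech_codiff (fun_scale sm) B u S U = cech_shift (fun_scale sm) (B - a) w S U"
      using ba[of U] bB[of U] by (simp add: cech_shift_def)
  qed
  ultimately show "\<exists>b\<ge>a. \<exists>m'\<in>cech_strand (fun_components G) t b.
      \<forall>S. card S = p \<longrightarrow> cech_codiff (fun_scale sm) b m' S = cech_shift (fun_scale sm) (b - a) w S"
    by (intro exI[of _ B]) (auto simp: B_def)
qed

lemma koszul_diff_strand:
  assumes "u \<in> cech_strand (fun_components G) t a"
  shows "(\<lambda>S. koszul_diff sm var (u S)) \<in> cech_strand (fun_components G) (t + 1) a"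
proof -
  have "sm (koszul_sign i U * var i) (u S V) \<in> G (t + int a * int (card S) + (0 + 1))" for i S U V
    using assms by (intro G_scale forms_mult koszul_sign_in_forms var_in_forms)
      (simp add: cech_strand_def fun_components_def)
  then show ?thesis
    by (auto simp: cech_strand_def fun_components_def koszul_diff_apply algebra_simps intro!: G_sum)
qed

lemma koszul_diff_row_primitive:
  assumes "card S > 0" "koszul_diff sm var (X S) = 0"
  shows "koszul_diff sm var (row_primitive sm X S) = fun_scale sm (var_prod S) (X S)"
proof -
  interpret koszul: module "fun_scale sm" by (rule module_fun_scale[OF module_axioms])
  have "S \<noteq> {}" using assms(1) by auto
  have "wedge sm (Min S) 0 = (0 :: 'n set \<Rightarrow> 'm)" by (simp add: wedge_def fun_eq_iff)
  then have "koszul_diff sm var (row_primitive sm X S)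
      = fun_scale sm (var_prod (S - {Min S})) (fun_scale sm (var (Min S)) (X S))"
    using assms \<open>S \<noteq> {}\<close> by (simp add: row_primitive_def koszul_diff_scale koszul_diff_wedge)
  also have "\<dots> = fun_scale sm (var_prod S) (X S)"
    using \<open>S \<noteq> {}\<close> var_prod_remove[of "Min S" S, where 'k = 'k] by (simp add: mult.commute)
  finally show ?thesis .
qed

lemma row_primitive_chains:
  assumes "X S \<in> koszul_chains UNIV l"
  shows "row_primitive sm X S \<in> koszul_chains UNIV (Suc l)"
  using wedge_chains[OF assms] by (simp add: row_primitive_def koszul_chains_def)

lemma row_primitive_strand:
  assumes X: "X \<in> cech_strand (fun_components G) t a"
  shows "row_primitive sm X \<in> cech_strand (fun_components G) (t - 1) (a + 1)"
proof -
  have "row_primitive sm X S U \<in> G (t - 1 + int (a + 1) * int (card S))" for S U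
  proof (cases "S = {}")
    case False
    then have "Min S \<in> S" by simp
    have "wedge sm (Min S) (X S) U \<in> G (t + int a * int (card S))"
      using X by (simp add: wedge_def cech_strand_def fun_components_def G_koszul_sign)
    then have "sm (var_prod (S - {Min S})) (wedge sm (Min S) (X S) U)
        \<in> G (t + int a * int (card S) + int (card (S - {Min S})))"
      by (intro G_scale var_prod_in_forms)
    moreover have "int (card (S - {Min S})) = int (card S) - 1"
      using card_Suc_Diff1[OF finite \<open>Min S \<in> S\<close>] by linarith
    ultimately show ?thesis using False by (simp only:) (simp add: row_primitive_def algebra_simps)
  qed (simp add: row_primitive_def)
  then show ?thesis by (simp add: cech_strand_def fun_components_def)
qed

interpretation koszul: graded_components "fun_scale sm" "fun_components G :: int \<Rightarrow> ('n set \<Rightarrow> 'm) set"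
  by (rule graded_components_fun)

lemma koszul_diff_codiff:
  "koszul_diff sm var (cech_codiff (fun_scale sm) e u T)
    = cech_codiff (fun_scale sm) e (\<lambda>S. koszul_diff sm var (u S)) T"
  by (simp add: koszul_codiff_module_hom[OF module_hom_koszul_diff])

lemma koszul_diff_shift:
  "koszul_diff sm var (cech_shift (fun_scale sm) e u S)
    = cech_shift (fun_scale sm) e (\<lambda>S. koszul_diff sm var (u S)) S"
  by (simp add: cech_shift_def koszul_diff_scale)

lemma row_primitive_cocycle:
  assumes X: "cech_codiff (fun_scale sm) a X = 0"
    and diff_X: "\<And>S. card S = Suc q \<Longrightarrow> koszul_diff sm var (X S) = 0" and T: "card T = Suc (Suc q)"
  shows "koszul_diff sm var (cech_codiff (fun_scale sm) (a + 1) (row_primitive sm X) T) = 0"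
proof -
  have "koszul_diff sm var (row_primitive sm X (T - {i})) = cech_shift (fun_scale sm) 1 X (T - {i})"
    if "i \<in> T" for i
    unfolding cech_shift_def power_one_right
  proof (rule koszul_diff_row_primitive)
    have "card (T - {i}) = Suc q" using that T by simp
    then show "card (T - {i}) > 0" "koszul_diff sm var (X (T - {i})) = 0" using diff_X by simp_all
  qed
  then have "koszul_diff sm var (cech_codiff (fun_scale sm) (a + 1) (row_primitive sm X) T)
      = cech_codiff (fun_scale sm) (a + 1) (cech_shift (fun_scale sm) 1 X) T"
    unfolding koszul_diff_codiff by (rule koszul.koszul_codiff_cong)
  also have "\<dots> = cech_shift (fun_scale sm) 1 (cech_codiff (fun_scale sm) a X) T"
    unfolding cech_shift_codiff[OF koszul.module_axioms] ..
  finally show ?thesis by (simp add: X cech_shift_def)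
qed

definition cech_koszul_decomposable :: "int \<Rightarrow> nat \<Rightarrow> nat \<Rightarrow> ('n set \<Rightarrow> 'n set \<Rightarrow> 'm) \<Rightarrow> bool" where
  "cech_koszul_decomposable t a q w \<longleftrightarrow>
    (\<exists>b\<ge>a. \<exists>u\<in>cech_strand (fun_components G) t b. \<exists>v\<in>cech_strand (fun_components G) (t - 1) b.
      \<forall>S. card S = q \<longrightarrow> cech_shift (fun_scale sm) (b - a) w S
        = koszul_diff sm var (v S) + cech_codiff (fun_scale sm) b u S)"

lemma cech_koszul_decomposable_0:
  assumes "\<And>S. card S = q \<Longrightarrow> w S = 0"
  shows "cech_koszul_decomposable t a q w"
proof -
  have "cech_shift (fun_scale sm) (a - a) w S
      = koszul_diff sm var (0 S) + cech_codiff (fun_scale sm) a 0 S" if "card S = q" for S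
    using assms[OF that] by (simp add: cech_shift_def module_hom.zero[OF koszul.module_hom_koszul_codiff])
  moreover have "0 \<in> cech_strand (fun_components G) s a" for s
    by (simp add: cech_strand_def fun_components_def)
  ultimately show ?thesis
    unfolding cech_koszul_decomposable_def by (intro exI[of _ a] conjI bexI[of _ 0] allI impI order_refl)
qed

lemma cech_koszul_column:
  assumes exact: "cech_exact (fun_scale sm) (fun_components G :: int \<Rightarrow> ('n set \<Rightarrow> 'm) set) q t"
    and w: "w \<in> cech_strand (fun_components G) t a" and "a \<le> b"
    and u: "u \<in> cech_strand (fun_components G) (t - 1) b"
    and diff_u: "\<And>T. card T = Suc q \<Longrightarrow> koszul_diff sm var (cech_codiff (fun_scale sm) b u T)
      = cech_codiff (fun_scale sm) b (cech_shift (fun_scale sm) (b - a) w) T"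
  shows "cech_koszul_decomposable t a q w"
proof -
  define y where "y = cech_shift (fun_scale sm) (b - a) w - (\<lambda>S. koszul_diff sm var (u S))"
  have y: "y \<in> cech_strand (fun_components G) t b"
    using koszul.cech_shift_strand[OF w, of "b - a"] koszul_diff_strand[OF u] \<open>a \<le> b\<close> koszul.G_diff
    by (simp add: y_def cech_strand_def)
  have cocycle: "cech_codiff (fun_scale sm) b y T = 0" if "card T = Suc q" for T
    using diff_u[OF that] by (simp add: y_def module_hom.diff[OF koszul.module_hom_koszul_codiff]
        koszul_diff_codiff)
  obtain c m where c: "c \<ge> b" and m: "m \<in> cech_strand (fun_components G) t c"
    and m_eq: "\<forall>S. card S = q \<longrightarrow> cech_codiff (fun_scale sm) c m S = cech_shift (fun_scale sm) (c - b) y S"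
    using cech_exactD[OF exact y cocycle] .
  have decomposition: "cech_shift (fun_scale sm) (c - a) w S
      = koszul_diff sm var (cech_shift (fun_scale sm) (c - b) u S) + cech_codiff (fun_scale sm) c m S"
    if "card S = q" for S
  proof -
    have "cech_shift (fun_scale sm) (c - a) w S
        = cech_shift (fun_scale sm) (c - b) (cech_shift (fun_scale sm) (b - a) w) S"
      using \<open>a \<le> b\<close> c by (simp add: cech_shift_shift[OF koszul.module_axioms])
    then show ?thesis
      using m_eq[rule_format, OF that] unfolding koszul_diff_shift
      by (simp add: y_def cech_shift_def[of _ "c - b"] koszul.scale_right_diff_distrib)
  qed
  have v: "cech_shift (fun_scale sm) (c - b) u \<in> cech_strand (fun_components G) (t - 1) c"
    using koszul.cech_shift_strand[OF u, of "c - b"] c by simp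
  have "a \<le> c" using \<open>a \<le> b\<close> c by simp
  then show ?thesis
    unfolding cech_koszul_decomposable_def
    by (intro exI[of _ c] conjI bexI[OF _ m] bexI[OF _ v] allI impI decomposition)
qed

lemma koszul_diff_cech_codiff_row_primitive:
  assumes "cech_shift (fun_scale sm) (b - (a + 1)) (row_primitive sm X) T
      = koszul_diff sm var v + cech_codiff (fun_scale sm) b u T"
    and diff_X: "koszul_diff sm var (X T) = 0" and "card T > 0" and "a + 1 \<le> b"
  shows "koszul_diff sm var (cech_codiff (fun_scale sm) b u T) = cech_shift (fun_scale sm) (b - a) X T"
proof -
  have "koszul_diff sm var (cech_codiff (fun_scale sm) b u T)
      = koszul_diff sm var (cech_shift (fun_scale sm) (b - (a + 1)) (row_primitive sm X) T)"
    unfolding assms(1) by (simp add: koszul_diff_add koszul_diff_koszul_diff)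
  also have "\<dots> = fun_scale sm (var_prod T ^ (b - (a + 1))) (fun_scale sm (var_prod T) (X T))"
    using koszul_diff_row_primitive[where X = X, OF \<open>card T > 0\<close> diff_X]
    by (simp add: cech_shift_def koszul_diff_scale del: koszul.scale_scale)
  also have "\<dots> = cech_shift (fun_scale sm) (b - a) X T"
    using \<open>a + 1 \<le> b\<close> by (simp add: cech_shift_def Suc_diff_Suc Suc_le_lessD flip: power_Suc2)
  finally show ?thesis .
qed

text \<open>The rows of the double complex are exact at all nonempty \<open>S\<close>, because some variable is invertible
  there, and the columns are exact in the degrees at hand. The induction runs along the
  antidiagonal, away from the corner \<open>S = {}\<close>, and ends where there are no sets \<open>U\<close> of size \<open>l\<close>.\<close>

lemma cech_koszul_chase:
  assumes exact: "\<And>p t. r < int p + t \<Longrightarrow> cech_exact sm G p t"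
  shows "CARD('n) < l + k \<Longrightarrow> r < int q + t \<Longrightarrow> w \<in> cech_strand (fun_components G) t a \<Longrightarrow>
    (\<And>S. card S = q \<Longrightarrow> w S \<in> koszul_chains UNIV l) \<Longrightarrow>
    (\<And>T. card T = Suc q \<Longrightarrow> koszul_diff sm var (cech_codiff (fun_scale sm) a w T) = 0) \<Longrightarrow>
    cech_koszul_decomposable t a q w"
proof (induction k arbitrary: l q t w a)
  case 0
  have "w S = 0" if "card S = q" for S
  proof -
    have "card U \<noteq> l" for U :: "'n set" using 0(1) card_mono[of UNIV U] by auto
    then show ?thesis using 0(4)[OF that] by (auto simp: koszul_chains_def)
  qed
  then show ?case by (rule cech_koszul_decomposable_0)
next
  case (Suc k)
  define X where "X = cech_codiff (fun_scale sm) a w"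
  have X: "X \<in> cech_strand (fun_components G) t a" "cech_codiff (fun_scale sm) a X = 0"
    by (simp_all add: X_def koszul.cech_codiff_strand Suc.prems(3) koszul.koszul_codiff_koszul_codiff)
  have diff_X: "koszul_diff sm var (X T) = 0" if "card T = Suc q" for T
    unfolding X_def by (rule Suc.prems(5)[OF that])
  have X_chains: "X T \<in> koszul_chains UNIV l" if T: "card T = Suc q" for T
    unfolding X_def koszul.koszul_codiff_apply
  proof (intro koszul.subspace_sum koszul.subspace_scale subspace_koszul_chains subspace_UNIV
      Suc.prems(4))
    show "card (T - {i}) = q" if "i \<in> T" for i using that T by simp
  qed
  have "cech_koszul_decomposable (t - 1) (a + 1) (Suc q) (row_primitive sm X)"
  proof (rule Suc.IH[of "Suc l"])
    show "row_primitive sm X \<in> cech_strand (fun_components G) (t - 1) (a + 1)"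
      by (rule row_primitive_strand[OF X(1)])
    show "row_primitive sm X T \<in> koszul_chains UNIV (Suc l)" if "card T = Suc q" for T
      by (intro row_primitive_chains X_chains that)
    show "koszul_diff sm var (cech_codiff (fun_scale sm) (a + 1) (row_primitive sm X) T) = 0"
      if "card T = Suc (Suc q)" for T
      by (rule row_primitive_cocycle[OF X(2) diff_X that])
  qed (use Suc.prems(1,2) in simp_all)
  then obtain b u v where b: "b \<ge> a + 1" and u: "u \<in> cech_strand (fun_components G) (t - 1) b"
    and primitive_eq: "\<And>T. card T = Suc q
        \<Longrightarrow> cech_shift (fun_scale sm) (b - (a + 1)) (row_primitive sm X) T
        = koszul_diff sm var (v T) + cech_codiff (fun_scale sm) b u T"
    unfolding cech_koszul_decomposable_def by blast
  have "koszul_diff sm var (cech_codiff (fun_scale sm) b u T)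
      = cech_codiff (fun_scale sm) b (cech_shift (fun_scale sm) (b - a) w) T"
    if T: "card T = Suc q" for T
    using koszul_diff_cech_codiff_row_primitive[where X = X, OF primitive_eq[OF T] diff_X[OF T] _ b] T b
    by (simp add: X_def cech_shift_codiff[OF koszul.module_axioms])
  then show ?case
    using b u by (intro cech_koszul_column[OF cech_exact_fun[OF exact[OF Suc.prems(2)]]
        Suc.prems(3)]) auto
qed

lemma koszul_diff_truncate:
  assumes "\<And>U. card U \<noteq> q \<Longrightarrow> koszul_diff sm var w U = 0"
  shows "koszul_diff sm var (\<lambda>U. if card U = Suc q then w U else 0) = koszul_diff sm var w"
proof
  fix U :: "'n set"
  show "koszul_diff sm var (\<lambda>U. if card U = Suc q then w U else 0) U = koszul_diff sm var w U"
  proof (cases "card U = q")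
    case False
    then show ?thesis using assms by (auto simp: koszul_diff_apply intro!: sum.neutral)
  qed (auto simp: koszul_diff_apply intro!: sum.cong)
qed

lemma koszul_cycles_subset_boundaries:
  assumes vanishing: "\<And>p t. r < int p + t \<Longrightarrow> local_cohomology_vanishes sm G p t" and "r < j"
  shows "koszul_cycles sm var (G j) i \<subseteq> koszul_boundaries sm var (G (j - 1)) i"
proof
  fix z assume z: "z \<in> koszul_cycles sm var (G j) i"
  define w where "w S = (if S = {} then z else 0)" for S :: "'n set"
  have "koszul_diff sm var (w S) = 0" for S using z by (simp add: w_def koszul_cycles_def)
  then have "koszul_diff sm var (cech_codiff (fun_scale sm) 0 w T) = 0" for T
    by (simp add: koszul.koszul_codiff_apply koszul_diff_sum koszul_diff_scale
        fun_eq_iff sum_fun_apply)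
  moreover have "w \<in> cech_strand (fun_components G) j 0"
    using z by (auto simp: w_def cech_strand_def fun_components_def koszul_cycles_def koszul_chains_def)
  moreover have "w S \<in> koszul_chains UNIV i" for S
    using z by (auto simp: w_def koszul_cycles_def koszul_chains_def)
  ultimately have "cech_koszul_decomposable j 0 0 w"
    using \<open>r < j\<close>
    by (intro cech_koszul_chase[OF cech_exact_if_local_cohomology_vanishes[OF vanishing],
          where l = i and k = "Suc CARD('n)"]) simp_all
  then obtain b u v where v: "v \<in> cech_strand (fun_components G) (j - 1) b"
    and w_eq: "\<And>S. card S = 0 \<Longrightarrow> cech_shift (fun_scale sm) (b - 0) w S
        = koszul_diff sm var (v S) + cech_codiff (fun_scale sm) b u S"
    unfolding cech_koszul_decomposable_def by blast
  have z_eq: "z = koszul_diff sm var (v {})"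
    using w_eq[of "{}"]
    by (simp add: w_def cech_shift_def koszul.koszul_codiff_apply fun_eq_iff)
  have "koszul_diff sm var (\<lambda>U. if card U = Suc i then v {} U else 0) = z"
    unfolding z_eq
  proof (rule koszul_diff_truncate)
    show "koszul_diff sm var (v {}) U = 0" if "card U \<noteq> i" for U
      using z that unfolding z_eq[symmetric] by (simp add: koszul_cycles_def koszul_chains_def)
  qed
  moreover have "(\<lambda>U. if card U = Suc i then v {} U else 0) \<in> koszul_chains (G (j - 1)) (Suc i)"
  proof -
    have "v {} \<in> fun_components G (j - 1 + int b * int (card ({} :: 'n set)))"
      using v unfolding cech_strand_def by blast
    then show ?thesis by (simp add: koszul_chains_def fun_components_def)
  qed
  ultimately show "z \<in> koszul_boundaries sm var (G (j - 1)) i"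
    unfolding koszul_boundaries_def by blast
qed

end

section \<open>Koszul homology of a graded module\<close>

context vector_space
begin

lemma has_quotient_dim_subset_exists:
  assumes Z: "subspace Z" "has_quotient_dim scale Z {0} n" and "Y \<subseteq> Z"
  obtains m where "has_quotient_dim scale Y {0} m"
proof -
  have "{0} \<subseteq> Z" using subspace_0[OF Z(1)] by simp
  from has_quotient_dim_imp_basis[OF Z(1) subspace_single_0 this Z(2)]
  obtain B where "finite B" "card B = n" "B \<subseteq> Z" "independent B" "span (B \<union> {0}) = Z" .
  then show ?thesis
    using has_quotient_dim_exists[OF subspace_single_0, of "B \<union> {0}" Y] \<open>Y \<subseteq> Z\<close> that by blast
qed

lemma has_quotient_dim_finitely_supported:
  fixes A :: "'u set"
  assumes N: "subspace N" and h: "has_quotient_dim scale N {0} h" and "finite A"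
  shows "has_quotient_dim (fun_scale scale) {w. \<forall>U. w U \<in> N \<and> (U \<notin> A \<longrightarrow> w U = 0)} {0} (card A * h)"
  using \<open>finite A\<close>
proof (induction A)
  interpret fun_scale: vector_space "fun_scale scale :: 'a \<Rightarrow> ('u \<Rightarrow> 'b) \<Rightarrow> _"
    by unfold_locales (simp_all add: fun_eq_iff scale_right_distrib scale_left_distrib)
  let ?C = "\<lambda>A. {w :: 'u \<Rightarrow> 'b. \<forall>U. w U \<in> N \<and> (U \<notin> A \<longrightarrow> w U = 0)}"
  have C: "fun_scale.subspace (?C A)" for A
    by (rule fun_scale.subspaceI) (auto simp: subspace_0[OF N] subspace_add[OF N] subspace_scale[OF N])
  {
    case empty
    show ?case unfolding card.empty mult_0 by (rule fun_scale.has_quotient_dim_0) (auto simp: fun_eq_iff)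
  next
    case (insert V A)
    have "has_quotient_dim (fun_scale scale) (?C (insert V A)) (?C A) h \<longleftrightarrow> has_quotient_dim scale N {0} h"
    proof (rule has_quotient_dim_linear_iff[OF _ C subspace_single_0])
      show "Vector_Spaces.linear (fun_scale scale) scale (\<lambda>w. w V)" by unfold_locales simp_all
      fix z assume "z \<in> N"
      then show "\<exists>w\<in>?C (insert V A). z - w V \<in> {0}"
        by (intro bexI[of _ "\<lambda>U. if U = V then z else 0"]) (auto simp: subspace_0[OF N])
    qed (use insert.hyps in auto)
    then have "has_quotient_dim (fun_scale scale) (?C (insert V A)) (?C A) h" using h by blast
    moreover have "?C (insert V A) \<inter> ?C A = ?C A" by auto
    then have "has_quotient_dim (fun_scale scale) (?C (insert V A) \<inter> ?C A) {0} (card A * h)"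
      using insert.IH by (simp only:)
    ultimately have "has_quotient_dim (fun_scale scale) (?C (insert V A)) {0} (h + card A * h)"
      by (rule fun_scale.has_quotient_dim_trans[OF C C, rotated]) (simp add: subspace_0[OF N])
    then show ?case unfolding card_insert_disjoint[OF insert.hyps] mult_Suc .
  }
qed

end

lemma (in graded_components) subspace_koszul_chains_G:
  "module.subspace (kscale (fun_scale sm)) (koszul_chains (G t) q)"
  by (rule kscale_subspace_koszul_chains[OF module_axioms subspace_G])

context graded
begin

lemma has_quotient_dim_G:
  assumes "finitely_generated sm"
  shows "has_quotient_dim (kscale sm) (G t) {0} (hilbert_function sm G t)"
proof -
  obtain S deg where S: "finite S" "span S = UNIV" "\<forall>g\<in>S. g \<in> G (deg g)"
    using finite_homogeneous_generators[OF assms] .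
  obtain T where T: "\<And>e. finite (T e)" "\<And>e. (forms e :: ('n, 'k) mpoly set) \<subseteq> mpoly.k.span (T e)"
    using forms_finite_dimensional by metis
  let ?B = "\<Union>g\<in>S. (\<lambda>f. sm f g) ` T (t - deg g)"
  have "G t \<subseteq> k.span ?B"
  proof
    fix x assume "x \<in> G t"
    with S obtain f where f: "\<forall>g. f g \<in> forms (t - deg g)" and x: "x = (\<Sum>g\<in>S. sm (f g) g)"
      by (rule G_eq_sum_forms_scale)
    have "sm (f g) g \<in> k.span ?B" if "g \<in> S" for g
    proof -
      interpret Vector_Spaces.linear "kscale (*)" "kscale sm" "\<lambda>f. sm f g"
        by unfold_locales (simp_all add: scale_left_distrib kscale_def)
      have "sm (f g) g \<in> (\<lambda>f. sm f g) ` mpoly.k.span (T (t - deg g))" using f T(2) by blast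
      also have "\<dots> = k.span ((\<lambda>f. sm f g) ` T (t - deg g))" by (rule span_image[symmetric])
      also have "\<dots> \<subseteq> k.span ?B" using that by (intro k.span_mono) blast
      finally show ?thesis .
    qed
    then show "x \<in> k.span ?B" unfolding x by (rule k.span_sum)
  qed
  moreover have "finite ?B" using S(1) T(1) by simp
  ultimately obtain n where "has_quotient_dim (kscale sm) (G t) {0} n"
    using k.has_quotient_dim_exists[OF k.subspace_single_0] by blast
  then show ?thesis
    using k.dim_eq_if_has_quotient_dim[OF subspace_G] unfolding hilbert_function_def by blast
qed

lemma has_quotient_dim_koszul_chains:
  assumes "finitely_generated sm"
  shows "has_quotient_dim (kscale (fun_scale sm)) (koszul_chains (G t) q :: ('n set \<Rightarrow> 'm) set) {0}
    ((CARD('n) choose q) * hilbert_function sm G t)"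
proof -
  have "card {U :: 'n set. card U = q} = CARD('n) choose q"
    using n_subsets[of "UNIV :: 'n set" q] by simp
  moreover have "koszul_chains (G t) q
      = {w :: 'n set \<Rightarrow> 'm. \<forall>U. w U \<in> G t \<and> (U \<notin> {U. card U = q} \<longrightarrow> w U = 0)}"
    by (simp add: koszul_chains_def)
  ultimately show ?thesis
    using k.has_quotient_dim_finitely_supported[OF subspace_G has_quotient_dim_G[OF assms] finite,
        of t "{U :: 'n set. card U = q}"]
    by (simp only: kscale_fun_scale)
qed

end

definition alternating_binomial_sum :: "nat \<Rightarrow> (nat \<Rightarrow> 'a::comm_ring_1) \<Rightarrow> nat \<Rightarrow> 'a" where
  "alternating_binomial_sum n h i = (\<Sum>q\<le>i. (-1) ^ q * of_nat (n choose (i - q)) * h q)"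

lemma alternating_binomial_sum_0 [simp]: "alternating_binomial_sum n h 0 = h 0"
  by (simp add: alternating_binomial_sum_def)

lemma alternating_binomial_sum_Suc:
  "alternating_binomial_sum n h (Suc i)
    = of_nat (n choose Suc i) * h 0 - alternating_binomial_sum n (\<lambda>q. h (Suc q)) i"
  unfolding alternating_binomial_sum_def sum.atMost_Suc_shift by (simp add: sum_negf)

context graded
begin

lemma koszul_diff_G:
  assumes "w \<in> koszul_chains (G t) (Suc q)"
  shows "koszul_diff sm var w \<in> koszul_cycles sm var (G (t + 1)) q"
proof -
  have w: "component t (w U) = w U" for U
    using assms by (intro component_of_G[THEN trans]) (auto simp: koszul_chains_def)
  have "koszul_diff sm var w U \<in> G (t + 1)" for U
    using component_koszul_diff[of t w] component_in_G[of "t + 1" "koszul_diff sm var w U"]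
    by (simp add: w fun_eq_iff)
  then show ?thesis
    using koszul_diff_in_chains_degree[OF assms]
    by (simp add: koszul_cycles_def koszul_chains_def koszul_diff_koszul_diff)
qed

lemma has_quotient_dim_chains_mod_cycles_iff:
  assumes vanishing: "\<And>p t. r < int p + t \<Longrightarrow> local_cohomology_vanishes sm G p t" and "r \<le> j"
  shows "has_quotient_dim (kscale (fun_scale sm)) (koszul_chains (G j) (Suc i))
      (koszul_cycles sm var (G j) (Suc i)) b
    \<longleftrightarrow> has_quotient_dim (kscale (fun_scale sm)) (koszul_cycles sm var (G (j + 1)) i) {0} b"
proof (rule has_quotient_dim_linear_iff)
  interpret diff: Vector_Spaces.linear "kscale (fun_scale sm)" "kscale (fun_scale sm)"
      "koszul_diff sm var :: ('n set \<Rightarrow> 'm) \<Rightarrow> _"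
    by (rule linear_kscale[OF module_hom_koszul_diff])
  show "Vector_Spaces.linear (kscale (fun_scale sm)) (kscale (fun_scale sm))
      (koszul_diff sm var :: ('n set \<Rightarrow> 'm) \<Rightarrow> _)"
    by (rule diff.linear_axioms)
  show "diff.vs1.subspace {0}" by (rule diff.vs1.subspace_single_0)
next
  fix z assume "z \<in> koszul_cycles sm var (G (j + 1)) i"
  then have "z \<in> koszul_boundaries sm var (G j) i"
    using koszul_cycles_subset_boundaries[OF vanishing, of r "j + 1" i] \<open>r \<le> j\<close> by auto
  then show "\<exists>w\<in>koszul_chains (G j) (Suc i). z - koszul_diff sm var w \<in> {0}"
    by (auto simp: koszul_boundaries_def)
next
  fix w :: "'n set \<Rightarrow> 'm" assume w: "w \<in> koszul_chains (G j) (Suc i)"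
  then show "koszul_diff sm var w \<in> koszul_cycles sm var (G (j + 1)) i" by (rule koszul_diff_G)
  show "koszul_diff sm var w \<in> {0} \<longleftrightarrow> w \<in> koszul_cycles sm var (G j) (Suc i)"
    using w by (simp add: koszul_cycles_def)
qed (rule subspace_koszul_chains_G)

lemma koszul_cycles_dim:
  assumes fg: "finitely_generated sm"
    and vanishing: "\<And>p t. r < int p + t \<Longrightarrow> local_cohomology_vanishes sm G p t"
    and "r \<le> j"
  obtains b where "has_quotient_dim (kscale (fun_scale sm)) (koszul_cycles sm var (G j) i) {0} b"
    and "int b = alternating_binomial_sum CARD('n) (\<lambda>q. int (hilbert_function sm G (j + int q))) i"
  using \<open>r \<le> j\<close>
proof (induction i arbitrary: j thesis)
  case 0
  have "has_quotient_dim (kscale (fun_scale sm)) (koszul_cycles sm var (G j) 0) {0}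
      (hilbert_function sm G j)"
    using has_quotient_dim_koszul_chains[OF fg, of j 0] by (simp add: koszul_cycles_0)
  then show ?case by (rule 0(1)) simp
next
  case (Suc i)
  interpret fun_scale: vector_space "kscale (fun_scale sm) :: _ \<Rightarrow> ('n set \<Rightarrow> 'm) \<Rightarrow> _"
    by (intro vector_space_kscale module_fun_scale module_axioms)
  let ?C = "koszul_chains (G j) (Suc i) :: ('n set \<Rightarrow> 'm) set"
    and ?Z = "koszul_cycles sm var (G j) (Suc i)"
  have Z: "fun_scale.subspace ?Z" by (rule subspace_koszul_cycles[OF module_axioms subspace_G])
  have Z_C: "?C \<inter> ?Z = ?Z" by (auto simp: koszul_cycles_def)
  have "r \<le> j + 1" using Suc.prems(2) by simp
  then obtain b where b: "has_quotient_dim (kscale (fun_scale sm))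
      (koszul_cycles sm var (G (j + 1)) i) {0} b"
    and int_b: "int b = alternating_binomial_sum CARD('n)
        (\<lambda>q. int (hilbert_function sm G (j + 1 + int q))) i"
    by (rule Suc.IH[rotated])
  then have C_Z: "has_quotient_dim (kscale (fun_scale sm)) ?C ?Z b"
    using has_quotient_dim_chains_mod_cycles_iff[OF vanishing Suc.prems(2)] by blast
  have C: "has_quotient_dim (kscale (fun_scale sm)) ?C {0}
      ((CARD('n) choose Suc i) * hilbert_function sm G j)"
    by (rule has_quotient_dim_koszul_chains[OF fg])
  obtain b' where b': "has_quotient_dim (kscale (fun_scale sm)) ?Z {0} b'"
    using fun_scale.has_quotient_dim_subset_exists[OF subspace_koszul_chains_G C] Z_C by blast
  have "has_quotient_dim (kscale (fun_scale sm)) ?C {0} (b + b')"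
    using fun_scale.has_quotient_dim_trans[OF subspace_koszul_chains_G Z _ C_Z, of "{0}" b'] b'
        fun_scale.subspace_0[OF Z]
    by (simp add: Z_C)
  then have "b + b' = (CARD('n) choose Suc i) * hilbert_function sm G j"
    by (rule fun_scale.has_quotient_dim_unique[OF fun_scale.subspace_single_0 _ C])
  then have "int b' = alternating_binomial_sum CARD('n)
      (\<lambda>q. int (hilbert_function sm G (j + int q))) (Suc i)"
    using int_b by (simp add: alternating_binomial_sum_Suc add_ac flip: of_nat_mult)
  with b' show ?case by (rule Suc.prems(1))
qed

lemma koszul_boundaries_iff_components:
  "z \<in> koszul_boundaries sm var UNIV i
    \<longleftrightarrow> (\<forall>t. (\<lambda>U. component t (z U)) \<in> koszul_boundaries sm var (G (t - 1)) i)"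
proof
  assume "z \<in> koszul_boundaries sm var UNIV i"
  then obtain u where u: "u \<in> koszul_chains UNIV (Suc i)" "z = koszul_diff sm var u"
    unfolding koszul_boundaries_def by blast
  have "(\<lambda>U. component t (z U)) = koszul_diff sm var (\<lambda>U. component (t - 1) (u U))" for t
    using component_koszul_diff[of "t - 1" u] by (simp add: u)
  moreover have "(\<lambda>U. component (t - 1) (u U)) \<in> koszul_chains (G (t - 1)) (Suc i)" for t
    using u(1) by (simp add: koszul_chains_def component.zero)
  ultimately show "\<forall>t. (\<lambda>U. component t (z U)) \<in> koszul_boundaries sm var (G (t - 1)) i"
    unfolding koszul_boundaries_def by blast
next
  assume "\<forall>t. (\<lambda>U. component t (z U)) \<in> koszul_boundaries sm var (G (t - 1)) i"
  then have "\<forall>t. \<exists>u. u \<in> koszul_chains (G (t - 1)) (Suc i)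
      \<and> (\<lambda>U. component t (z U)) = koszul_diff sm var u"
    unfolding koszul_boundaries_def by blast
  then obtain u where u: "\<And>t. u t \<in> koszul_chains (G (t - 1)) (Suc i)"
    and diff_u: "\<And>t. (\<lambda>U. component t (z U)) = koszul_diff sm var (u t)" by metis
  define T where "T = (\<Union>U. {t. component t (z U) \<noteq> 0})"
  have "finite T" by (simp add: T_def finite_components)
  have "z U = koszul_diff sm var (\<Sum>t\<in>T. u t) U" for U
  proof -
    have "z U = (\<Sum>t\<in>T. component t (z U))" using \<open>finite T\<close>
      by (rule eq_sum_components) (auto simp: T_def)
    also have "\<dots> = (\<Sum>t\<in>T. koszul_diff sm var (u t) U)" by (simp flip: diff_u)
    finally show ?thesis by (simp add: koszul_diff_sum sum_fun_apply)
  qed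
  moreover have "(\<Sum>t\<in>T. u t) \<in> koszul_chains UNIV (Suc i)"
    using u by (simp add: koszul_chains_def sum_fun_apply)
  ultimately show "z \<in> koszul_boundaries sm var UNIV i" unfolding koszul_boundaries_def by auto
qed

lemma component_koszul_cycles:
  assumes "z \<in> koszul_cycles sm var UNIV i"
  shows "(\<lambda>U. component t (z U)) \<in> koszul_cycles sm var (G t) i"
  using assms by (auto simp: koszul_cycles_def koszul_chains_def component_koszul_diff
      component.zero fun_eq_iff)

lemma koszul_boundaries_iff_component:
  assumes vanishing: "\<And>p t. r < int p + t \<Longrightarrow> local_cohomology_vanishes sm G p t"
    and low: "\<And>t. t < r \<Longrightarrow> G t = {0}" and z: "z \<in> koszul_cycles sm var UNIV i"
  shows "z \<in> koszul_boundaries sm var UNIV i \<longleftrightarrow> (\<lambda>U. component r (z U)) = 0"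
  unfolding koszul_boundaries_iff_components
proof (intro iffI allI)
  fix t assume zero: "(\<lambda>U. component r (z U)) = 0"
  have boundary: "0 \<in> koszul_boundaries sm var (G (t - 1)) i"
    unfolding koszul_boundaries_def by (rule image_eqI[of _ _ 0]) (simp_all add: koszul_chains_def)
  show "(\<lambda>U. component t (z U)) \<in> koszul_boundaries sm var (G (t - 1)) i"
  proof (cases t r rule: linorder_cases)
    case less
    then have "component t (z U) = 0" for U using component_in_G[of t "z U"] low by simp
    then show ?thesis using boundary by (simp flip: zero_fun_def)
  next
    case equal
    then show ?thesis using zero boundary by simp
  next
    case greater
    then show ?thesis
      using component_koszul_cycles[OF z] koszul_cycles_subset_boundaries[OF vanishing] by blast
  qed
next
  assume "\<forall>t. (\<lambda>U. component t (z U)) \<in> koszul_boundaries sm var (G (t - 1)) i"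
  then obtain u where "u \<in> koszul_chains (G (r - 1)) (Suc i)"
      "(\<lambda>U. component r (z U)) = koszul_diff sm var u"
    unfolding koszul_boundaries_def by blast
  moreover from this have "u = 0" using low[of "r - 1"] by (auto simp: koszul_chains_def fun_eq_iff)
  ultimately show "(\<lambda>U. component r (z U)) = 0" by simp
qed

lemma has_quotient_dim_koszul_homology_iff:
  assumes vanishing: "\<And>p t. r < int p + t \<Longrightarrow> local_cohomology_vanishes sm G p t"
    and low: "\<And>t. t < r \<Longrightarrow> G t = {0}"
  shows "has_quotient_dim (kscale (fun_scale sm)) (koszul_cycles sm var UNIV i)
      (koszul_boundaries sm var UNIV i) b
    \<longleftrightarrow> has_quotient_dim (kscale (fun_scale sm)) (koszul_cycles sm var (G r) i) {0} b"
proof (rule has_quotient_dim_linear_iff)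
  interpret fun_scale: vector_space "kscale (fun_scale sm) :: _ \<Rightarrow> ('n set \<Rightarrow> 'm) \<Rightarrow> _"
    by (intro vector_space_kscale module_fun_scale module_axioms)
  show "Vector_Spaces.linear (kscale (fun_scale sm)) (kscale (fun_scale sm))
      (\<lambda>z U :: 'n set. component r (z U))"
    using component_scale[OF const_in_forms, of r]
    by unfold_locales (simp_all add: fun_eq_iff component_add kscale_def)
  show "fun_scale.subspace (koszul_cycles sm var UNIV i)"
    by (rule subspace_koszul_cycles) (use module_axioms in auto)
  show "fun_scale.subspace {0}" by (rule fun_scale.subspace_single_0)
next
  fix z :: "'n set \<Rightarrow> 'm" assume z: "z \<in> koszul_cycles sm var UNIV i"
  show "(\<lambda>U. component r (z U)) \<in> koszul_cycles sm var (G r) i" by (rule component_koszul_cycles[OF z])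
  show "(\<lambda>U. component r (z U)) \<in> {0} \<longleftrightarrow> z \<in> koszul_boundaries sm var UNIV i"
    using koszul_boundaries_iff_component[where r = r, OF vanishing low z] by simp
next
  fix z :: "'n set \<Rightarrow> 'm" assume z: "z \<in> koszul_cycles sm var (G r) i"
  then have "(\<lambda>U. component r (z U)) = z"
    by (simp add: koszul_cycles_def koszul_chains_def fun_eq_iff component_of_G[of _ r])
  then show "\<exists>y\<in>koszul_cycles sm var UNIV i. z - (\<lambda>U. component r (y U)) \<in> {0}"
    using z by (intro bexI[of _ z]) (auto simp: koszul_cycles_def koszul_chains_def)
qed

lemma koszul_cycles_above_card:
  assumes socle: "local_cohomology_vanishes sm G 0 t" and "CARD('n) \<le> i"
  shows "koszul_cycles sm var (G t) i \<subseteq> {0 :: 'n set \<Rightarrow> 'm}"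
proof
  fix z :: "'n set \<Rightarrow> 'm" assume z: "z \<in> koszul_cycles sm var (G t) i"
  have "z U = 0" for U
  proof (cases "card U = i")
    case True
    then have U: "U = UNIV" using \<open>CARD('n) \<le> i\<close> by (simp add: card_seteq)
    have "sm (var j) (z UNIV) = 0" for j
    proof -
      have "sm (koszul_sign j (UNIV - {j}) * var j) (z UNIV) = koszul_diff sm var z (UNIV - {j})"
        by (simp add: koszul_diff_apply Compl_eq_Diff_UNIV Diff_Diff_Int insert_absorb)
      then show ?thesis
        using z koszul_sign_cases[of j "UNIV - {j}", where 'r = "('n, 'k) mpoly"]
        by (auto simp: koszul_cycles_def)
    qed
    then show ?thesis
      using socle_eq_0[OF socle, of "z UNIV"] z U by (simp add: koszul_cycles_def koszul_chains_def)
  qed (use z in \<open>simp add: koszul_cycles_def koszul_chains_def\<close>)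
  then show "z \<in> {0}" by (simp add: fun_eq_iff)
qed

lemma tor_dim_eq_alternating_binomial_sum:
  assumes fg: "finitely_generated sm"
    and vanishing: "\<And>p t. r < int p + t \<Longrightarrow> local_cohomology_vanishes sm G p t"
    and low: "\<And>t. t < r \<Longrightarrow> G t = {0}"
  shows "of_nat (tor_dim sm i) = (alternating_binomial_sum CARD('n)
    (\<lambda>q. of_nat (hilbert_function sm G (r + int q))) i :: 'a::comm_ring_1)"
proof -
  obtain b where "has_quotient_dim (kscale (fun_scale sm)) (koszul_cycles sm var (G r) i) {0} b"
    and b: "int b = alternating_binomial_sum CARD('n) (\<lambda>q. int (hilbert_function sm G (r + int q))) i"
    using koszul_cycles_dim[OF fg vanishing order_refl] .
  then have "has_quotient_dim (kscale (fun_scale sm)) (koszul_cycles sm var UNIV i)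
      (koszul_boundaries sm var UNIV i) b"
    by (simp only: has_quotient_dim_koszul_homology_iff[OF vanishing low])
  then have "tor_dim sm i = b" by (rule tor_dim_eq_koszul_homology[OF module_axioms fg])
  then show ?thesis
    using arg_cong[OF b, of "of_int :: int \<Rightarrow> 'a"] by (simp add: alternating_binomial_sum_def)
qed

lemma tor_dim_above_card:
  assumes fg: "finitely_generated sm"
    and vanishing: "\<And>p t. r < int p + t \<Longrightarrow> local_cohomology_vanishes sm G p t"
    and low: "\<And>t. t < r \<Longrightarrow> G t = {0}"
    and socle: "local_cohomology_vanishes sm G 0 r" and "CARD('n) \<le> i"
  shows "tor_dim sm i = 0"
proof (rule tor_dim_eq_koszul_homology[OF module_axioms fg])
  interpret fun_scale: vector_space "kscale (fun_scale sm) :: _ \<Rightarrow> ('n set \<Rightarrow> 'm) \<Rightarrow> _"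
    by (intro vector_space_kscale module_fun_scale module_axioms)
  have "has_quotient_dim (kscale (fun_scale sm)) (koszul_cycles sm var (G r) i) {0} 0"
    by (rule fun_scale.has_quotient_dim_0[OF koszul_cycles_above_card[OF socle \<open>CARD('n) \<le> i\<close>]])
  then show "has_quotient_dim (kscale (fun_scale sm)) (koszul_cycles sm var UNIV i)
      (koszul_boundaries sm var UNIV i) 0"
    by (simp only: has_quotient_dim_koszul_homology_iff[OF vanishing low])
qed

end

section \<open>Finite differences\<close>

definition forward_diff :: "(nat \<Rightarrow> 'a::ab_group_add) \<Rightarrow> nat \<Rightarrow> 'a" where
  "forward_diff h q = h (Suc q) - h q"

lemma forward_diff_power_eq_0:
  assumes "(forward_diff ^^ n) h = (\<lambda>_. 0)" "n \<le> l"
  shows "(forward_diff ^^ l) h = (\<lambda>_. 0)"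
  using \<open>n \<le> l\<close>
proof (induction l rule: dec_induct)
  case (step l)
  then show ?case by (simp add: fun_eq_iff forward_diff_def)
qed (fact assms(1))

lemma newton_expansion:
  fixes h :: "nat \<Rightarrow> 'a::comm_ring_1"
  shows "h q = (\<Sum>l\<le>q. of_nat (q choose l) * (forward_diff ^^ l) h 0)"
proof (induction q arbitrary: h)
  case (Suc q)
  have "h q = (\<Sum>l\<le>Suc q. of_nat (q choose l) * (forward_diff ^^ l) h 0)"
    using Suc.IH[of h] by (simp add: binomial_eq_0)
  then have h: "h q = h 0 + (\<Sum>l\<le>q. of_nat (q choose Suc l) * (forward_diff ^^ Suc l) h 0)"
    unfolding sum.atMost_Suc_shift by simp
  have diff: "forward_diff h q = (\<Sum>l\<le>q. of_nat (q choose l) * (forward_diff ^^ Suc l) h 0)"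
    using Suc.IH[of "forward_diff h"] by (simp add: funpow_swap1)
  have "h (Suc q) = forward_diff h q + h q" by (simp add: forward_diff_def)
  also have "\<dots> = h 0 + (\<Sum>l\<le>q. of_nat (Suc q choose Suc l) * (forward_diff ^^ Suc l) h 0)"
    unfolding diff by (subst h) (simp add: sum.distrib distrib_right)
  also have "\<dots> = (\<Sum>l\<le>Suc q. of_nat (Suc q choose l) * (forward_diff ^^ l) h 0)"
    unfolding sum.atMost_Suc_shift by simp
  finally show ?case .
qed simp

lemma newton_polynomial:
  fixes h :: "nat \<Rightarrow> 'a::field_char_0"
  assumes "(forward_diff ^^ n) h = (\<lambda>_. 0)"
  obtains P where "\<forall>q. poly P (a + of_nat q) = h q"
proof
  let ?b = "\<lambda>l. \<Prod>j = 0..<l. [:- a - of_nat j, 1:]"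
  define P where "P = (\<Sum>l<n. smult ((forward_diff ^^ l) h 0 / fact l) (?b l))"
  have binomial: "poly (?b l) (a + of_nat q) = of_nat (q choose l) * fact l" for q l
    by (simp add: poly_prod binomial_gbinomial gbinomial_prod_rev)
  show "\<forall>q. poly P (a + of_nat q) = h q"
  proof
    fix q
    have "h q = (\<Sum>l\<le>q. of_nat (q choose l) * (forward_diff ^^ l) h 0)" by (rule newton_expansion)
    also have "\<dots> = (\<Sum>l<n. of_nat (q choose l) * (forward_diff ^^ l) h 0)"
      using forward_diff_power_eq_0[OF assms]
      by (intro sum.mono_neutral_cong) (auto simp: binomial_eq_0 not_le not_less)
    finally show "poly P (a + of_nat q) = h q" by (simp add: P_def poly_sum binomial mult.commute)
  qed
qed

lemma alternating_binomial_sum_Suc_Suc: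
  "alternating_binomial_sum (Suc n) h (Suc i)
    = of_nat (n choose Suc i) * h 0 - alternating_binomial_sum n (forward_diff h) i"
proof -
  have "alternating_binomial_sum (Suc n) h (Suc i)
      = alternating_binomial_sum n h (Suc i) + alternating_binomial_sum n h i"
    by (simp add: alternating_binomial_sum_def Suc_diff_le distrib_left distrib_right sum.distrib)
  moreover have "alternating_binomial_sum n (forward_diff h) i
      = alternating_binomial_sum n (\<lambda>q. h (Suc q)) i - alternating_binomial_sum n h i"
    by (simp add: alternating_binomial_sum_def forward_diff_def right_diff_distrib sum_subtractf)
  ultimately show ?thesis by (simp add: alternating_binomial_sum_Suc)
qed

text \<open>In generating functions, this is \<open>\<Sum>\<^sub>q h q (-x)\<^sup>q = \<Sum>\<^sub>l \<Delta>\<^sup>l h 0 (-x)\<^sup>l / (1 + x)\<^bsup>l+1\<^esup>\<close>,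
  multiplied by \<open>(1 + x)\<^sup>n\<close>.\<close>

lemma alternating_binomial_sum_forward_diff:
  "alternating_binomial_sum n h i
    = (\<Sum>l<n. if l \<le> i then (-1) ^ l * of_nat ((n - l - 1) choose (i - l))
        * (forward_diff ^^ l) h 0 else 0)
      + (if n \<le> i then (-1) ^ i * (forward_diff ^^ n) h (i - n) else 0)"
proof (induction n arbitrary: h i)
  case 0
  have "alternating_binomial_sum 0 h i = (\<Sum>q\<in>{i}. (-1) ^ q * of_nat (0 choose (i - q)) * h q)"
    unfolding alternating_binomial_sum_def by (rule sum.mono_neutral_right) (auto simp: binomial_eq_0)
  then show ?case by simp
next
  case (Suc n)
  show ?case
  proof (cases i)
    case 0
    then show ?thesis unfolding sum.lessThan_Suc_shift by simp
  next
    case (Suc j)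
    have "(\<Sum>l<n. if Suc l \<le> Suc j then (-1) ^ Suc l
          * of_nat ((Suc n - Suc l - 1) choose (Suc j - Suc l)) * (forward_diff ^^ Suc l) h 0 else 0)
        = - (\<Sum>l<n. if l \<le> j then (-1) ^ l * of_nat ((n - l - 1) choose (j - l))
          * (forward_diff ^^ l) (forward_diff h) 0 else 0)"
      unfolding sum_negf[symmetric] by (intro sum.cong) (simp_all add: funpow_swap1)
    then show ?thesis
      unfolding Suc alternating_binomial_sum_Suc_Suc Suc.IH sum.lessThan_Suc_shift
      by (simp add: funpow_swap1)
  qed
qed

lemma forward_diff_power_eq_0_if_alternating_binomial_sum:
  assumes "\<And>i. n \<le> i \<Longrightarrow> alternating_binomial_sum n h i = 0"
  shows "(forward_diff ^^ n) h = (\<lambda>_. 0)"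
proof
  fix q
  have "(\<Sum>l<n. if l \<le> n + q then (-1) ^ l * of_nat ((n - l - 1) choose (n + q - l))
      * (forward_diff ^^ l) h 0 else 0) = 0"
    by (intro sum.neutral) (simp add: binomial_eq_0)
  then have "(-1) ^ (n + q) * (forward_diff ^^ n) h q = alternating_binomial_sum n h (n + q)"
    by (simp add: alternating_binomial_sum_forward_diff)
  then have "(-1) ^ (n + q) * ((-1) ^ (n + q) * (forward_diff ^^ n) h q) = 0" by (simp add: assms)
  then show "(forward_diff ^^ n) h q = 0" by (simp flip: power_mult_distrib mult.assoc)
qed

lemma alternating_binomial_sum_forward_diff_truncated:
  assumes n: "(forward_diff ^^ n) h = (\<lambda>_. 0)" and m: "\<And>l. m < l \<Longrightarrow> (forward_diff ^^ l) h 0 = 0"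
  shows "alternating_binomial_sum n h i
    = (\<Sum>l = 0..min i m. (-1) ^ l * of_nat ((n - l - 1) choose (i - l)) * (forward_diff ^^ l) h 0)"
proof -
  have "alternating_binomial_sum n h i
      = (\<Sum>l<n. if l \<le> i then (-1) ^ l * of_nat ((n - l - 1) choose (i - l))
          * (forward_diff ^^ l) h 0 else 0)"
    by (simp add: alternating_binomial_sum_forward_diff n)
  also have "\<dots> = (\<Sum>l = 0..min i m. (-1) ^ l * of_nat ((n - l - 1) choose (i - l))
      * (forward_diff ^^ l) h 0)"
    using forward_diff_power_eq_0[OF n] m
    by (intro sum.mono_neutral_cong) (auto simp: not_le not_less)
  finally show ?thesis .
qed

lemma poly_backward_diff: "poly (backward_diff P) x = poly P x - poly P (x - 1)"
  by (simp add: backward_diff_def poly_pcompose)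

lemma poly_backward_diff_power:
  assumes "\<And>q. poly P (a + of_nat q) = h q"
  shows "poly ((backward_diff ^^ l) P) (a + of_nat l + of_nat q) = (forward_diff ^^ l) h q"
proof (induction l arbitrary: q)
  case (Suc l)
  have "a + of_nat (Suc l) + of_nat q = a + of_nat l + of_nat (Suc q)"
    and "a + of_nat (Suc l) + of_nat q - 1 = a + of_nat l + of_nat q" by simp_all
  then show ?case
    using Suc.IH[of q] Suc.IH[of "Suc q"]
    by (simp only: funpow.simps comp_apply poly_backward_diff forward_diff_def)
qed (use assms in simp)

lemma backward_diff_eq_0_or_degree_less:
  fixes P :: "'a::idom poly"
  shows "backward_diff P = 0 \<or> degree (backward_diff P) < degree P"
proof (rule eq_zero_or_degree_less)
  have degree: "degree (pcompose P [:-1, 1:]) = degree P" by (simp add: degree_pcompose)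
  then show "degree (backward_diff P) \<le> degree P"
    unfolding backward_diff_def by (intro degree_diff_le) simp_all
  have "lead_coeff (pcompose P [:-1, 1:]) = lead_coeff P" by (simp add: lead_coeff_comp)
  then show "coeff (backward_diff P) (degree P) = 0" by (simp add: backward_diff_def degree)
qed

lemma backward_diff_power_eq_0:
  fixes P :: "'a::idom poly"
  assumes "P = 0 \<or> degree P < l"
  shows "(backward_diff ^^ l) P = 0"
  using assms
proof (induction l arbitrary: P)
  case (Suc l)
  have "backward_diff P = 0 \<or> degree (backward_diff P) < l"
    using backward_diff_eq_0_or_degree_less[of P] Suc.prems by (auto simp: backward_diff_def)
  then have "(backward_diff ^^ l) (backward_diff P) = 0" by (rule Suc.IH)
  then show ?case by (simp add: funpow_swap1)
qed simp

lemma poly_eq_if_eventually_eq: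
  fixes P Q :: "'a::{idom, ring_char_0} poly"
  assumes "\<forall>\<^sub>F t in at_top. poly P (of_int t) = poly Q (of_int t)"
  shows "P = Q"
proof (rule ccontr)
  assume "P \<noteq> Q"
  obtain N :: int where N: "\<And>t. t \<ge> N \<Longrightarrow> poly P (of_int t) = poly Q (of_int t)"
    using assms unfolding eventually_at_top_linorder by blast
  have "finite {x. poly (P - Q) x = 0}" using \<open>P \<noteq> Q\<close> by (intro poly_roots_finite) simp
  moreover have "of_int ` {N..} \<subseteq> {x. poly (P - Q) x = 0}" using N by auto
  ultimately have "finite (of_int ` {N..} :: 'a set)" by (rule finite_subset[rotated])
  then show False using infinite_Ici[of N] by (simp add: finite_image_iff inj_on_def)
qed

lemma eventually_eq_if_eq_from:
  assumes "\<forall>q. poly P (of_int r + of_nat q) = of_nat (h (r + int q))"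
  shows "\<forall>\<^sub>F t in at_top. poly P (of_int t) = of_nat (h t)"
  using eventually_ge_at_top[of r]
proof eventually_elim
  fix t assume "r \<le> t"
  then show "poly P (of_int t) = of_nat (h t)" using assms[rule_format, of "nat (t - r)"] by simp
qed

lemma hilbert_poly_eqI:
  assumes "\<forall>\<^sub>F t in at_top. poly P (of_int t) = of_nat (hilbert_function sm G t)"
  shows "hilbert_poly sm G = P"
  unfolding hilbert_poly_def
proof (rule the_equality[of
      "\<lambda>P. \<forall>\<^sub>F t in at_top. poly P (of_int t) = of_nat (hilbert_function sm G t)", OF assms])
  fix Q :: "rat poly" assume "\<forall>\<^sub>F t in at_top. poly Q (of_int t) = of_nat (hilbert_function sm G t)"
  with assms have "\<forall>\<^sub>F t in at_top. poly Q (of_int t) = poly P (of_int t)" by eventually_elim simp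
  then show "Q = P" by (rule poly_eq_if_eventually_eq)
qed

section \<open>Homogeneous ideals\<close>

definition homogeneous_ideal :: "('n::{finite,linorder}, 'k::field) mpoly set \<Rightarrow> bool" where
  "homogeneous_ideal I \<longleftrightarrow> mpoly.subspace I \<and> (\<forall>f\<in>I. \<forall>e. mpoly.component e f \<in> I)"

lemma homogeneous_ideal_subspace: "homogeneous_ideal I \<Longrightarrow> mpoly.subspace I"
  by (simp add: homogeneous_ideal_def)

lemma homogeneous_ideal_component: "homogeneous_ideal I \<Longrightarrow> f \<in> I \<Longrightarrow> mpoly.component e f \<in> I"
  by (simp add: homogeneous_ideal_def)

lemma homogeneous_ideal_mem_iff:
  assumes "homogeneous_ideal I"
  shows "f \<in> I \<longleftrightarrow> (\<forall>e. mpoly.component e f \<in> I)"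
proof
  assume "\<forall>e. mpoly.component e f \<in> I"
  then have "(\<Sum>e\<in>{e. mpoly.component e f \<noteq> 0}. mpoly.component e f) \<in> I"
    using assms by (intro mpoly.subspace_sum homogeneous_ideal_subspace) auto
  then show "f \<in> I" using mpoly.eq_sum_components[OF mpoly.finite_components order_refl, of f] by simp
qed (simp add: homogeneous_ideal_component assms)

definition ideal_colon :: "'r::comm_ring_1 set \<Rightarrow> 'r \<Rightarrow> 'r set" where
  "ideal_colon I f = {g. g * f \<in> I}"

lemma subset_ideal_colon: "mpoly.subspace I \<Longrightarrow> I \<subseteq> ideal_colon I f"
  using mpoly.subspace_scale[of I _ f] by (auto simp: ideal_colon_def mult.commute)

lemma homogeneous_ideal_colon:
  assumes I: "homogeneous_ideal I" and f: "f \<in> forms a"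
  shows "homogeneous_ideal (ideal_colon I f)"
  unfolding homogeneous_ideal_def
proof (intro conjI ballI allI)
  note I' = homogeneous_ideal_subspace[OF I]
  show "mpoly.subspace (ideal_colon I f)"
    by (rule mpoly.subspaceI)
      (auto simp: ideal_colon_def distrib_right mult.assoc mpoly.subspace_0[OF I']
        mpoly.subspace_add[OF I'] mpoly.subspace_scale[OF I'])
  fix g e assume "g \<in> ideal_colon I f"
  then have "mpoly.component (e + a) (g * f) \<in> I"
    by (simp add: ideal_colon_def homogeneous_ideal_component[OF I])
  then show "mpoly.component e g \<in> ideal_colon I f"
    by (simp add: ideal_colon_def mpoly.component_scale_of_G[OF f])
qed

lemma mem_span_insert_ideal: "mpoly.subspace I \<Longrightarrow> x \<in> mpoly.span (insert f I) \<longleftrightarrow> (\<exists>g. x - g * f \<in> I)"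
  by (simp add: mpoly.span_breakdown_eq flip: mpoly.span_eq_iff)

lemma homogeneous_ideal_span_insert:
  assumes I: "homogeneous_ideal I" and f: "f \<in> forms a"
  shows "homogeneous_ideal (mpoly.span (insert f I))"
  unfolding homogeneous_ideal_def
proof (intro conjI ballI allI)
  fix x e assume "x \<in> mpoly.span (insert f I)"
  then obtain g where "x - g * f \<in> I"
    using mem_span_insert_ideal[OF homogeneous_ideal_subspace[OF I]] by blast
  then have "mpoly.component e (x - g * f) \<in> I" by (rule homogeneous_ideal_component[OF I])
  then have "mpoly.component e x - mpoly.component (e - a) g * f \<in> I"
    by (simp add: mpoly.component.diff mpoly.component_scale_of_G[OF f])
  then show "mpoly.component e x \<in> mpoly.span (insert f I)"
    using mem_span_insert_ideal[OF homogeneous_ideal_subspace[OF I]] by blast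
qed (rule mpoly.subspace_span)

subsection \<open>The ascending chain condition\<close>

lemma lookup_single_mult_add:
  fixes f :: "('n::finite, 'k::field) mpoly"
  shows "lookup (single \<beta> 1 * f) (\<beta> + \<alpha>) = lookup f \<alpha>"
  by (rule additive_eqI_single[where v = f and f = "\<lambda>f. lookup (single \<beta> 1 * f) (\<beta> + \<alpha>)"
        and g = "\<lambda>f. lookup f \<alpha>"])
    (simp_all add: additive_def distrib_left lookup_add mult_single lookup_single when_def)

lemma keys_single_mult:
  fixes f :: "('n::finite, 'k::field) mpoly"
  shows "keys (single \<beta> 1 * f) = (+) \<beta> ` keys f"
proof
  show "keys (single \<beta> 1 * f) \<subseteq> (+) \<beta> ` keys f"
    using keys_mult[of "single \<beta> (1 :: 'k)" f] by auto
  show "(+) \<beta> ` keys f \<subseteq> keys (single \<beta> 1 * f)"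
    by (auto simp: in_keys_iff lookup_single_mult_add)
qed

definition lead_exponents :: "('n::{finite,linorder}, 'k::field) mpoly set \<Rightarrow> ('n \<Rightarrow>\<^sub>0 nat) set" where
  "lead_exponents I = {Max (keys f) | f t. f \<in> I \<and> f \<in> forms t \<and> f \<noteq> 0}"

lemma lead_exponents_add:
  assumes I: "mpoly.subspace I" and "\<alpha> \<in> lead_exponents I"
  shows "\<beta> + \<alpha> \<in> lead_exponents I"
proof -
  obtain f t where f: "f \<in> I" "f \<in> forms t" "f \<noteq> 0" and \<alpha>: "\<alpha> = Max (keys f)"
    using assms(2) unfolding lead_exponents_def by blast
  let ?g = "single \<beta> 1 * f"
  have "mono ((+) \<beta>)" by (rule monoI) (rule add_left_mono)
  then have "\<beta> + \<alpha> = Max (keys ?g)"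
    using f(3) by (simp add: \<alpha> keys_single_mult mono_Max_commute)
  moreover have "?g \<noteq> 0"
    using f(3) keys_single_mult[of \<beta> f] by (metis image_is_empty keys_eq_empty)
  moreover have "?g \<in> I" using f(1) by (rule mpoly.subspace_scale[OF I])
  moreover have "?g \<in> forms (int (monomial_degree \<beta>) + t)" by (intro forms_mult forms_single refl f(2))
  ultimately show ?thesis unfolding lead_exponents_def by blast
qed

lemma forms_cancel_lead:
  assumes f: "f \<in> forms t" "f \<noteq> 0" and g: "g \<in> forms s" "g \<noteq> 0" and max: "Max (keys g) = Max (keys f)"
  obtains c where "f - const c * g \<in> forms t" "\<forall>\<gamma>\<in>keys (f - const c * g). \<gamma> < Max (keys f)"
proof
  define \<alpha> where "\<alpha> = Max (keys f)"
  define c where "c = lookup f \<alpha> / lookup g \<alpha>"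
  have f_\<alpha>: "lookup f \<alpha> \<noteq> 0" and g_\<alpha>: "lookup g \<alpha> \<noteq> 0"
    using f(2) g(2) Max_in[OF finite_keys, of f] Max_in[OF finite_keys, of g]
    by (simp_all add: \<alpha>_def max flip: in_keys_iff)
  then have "s = t" using f(1) g(1) by (auto simp: forms_def)
  then show "f - const c * g \<in> forms t"
    using forms_diff[OF f(1)] forms_mult[OF const_in_forms g(1)] by simp
  show "\<forall>\<gamma>\<in>keys (f - const c * g). \<gamma> < \<alpha>"
  proof
    fix \<gamma> assume \<gamma>: "\<gamma> \<in> keys (f - const c * g)"
    then have "\<gamma> \<in> keys f \<or> \<gamma> \<in> keys g" by (auto simp: in_keys_iff lookup_minus lookup_const_mult)
    then have "\<gamma> \<le> \<alpha>" using Max_ge[OF finite_keys] max unfolding \<alpha>_def by metis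
    moreover have "\<gamma> \<noteq> \<alpha>" using \<gamma> g_\<alpha> by (auto simp: in_keys_iff lookup_minus lookup_const_mult c_def)
    ultimately show "\<gamma> < \<alpha>" by simp
  qed
qed

text \<open>The order of the exponents is lexicographic. As there are only finitely many exponents of each
  degree, its well-foundedness is not needed.\<close>

lemma forms_subset_if_lead_exponents_subset:
  fixes I J :: "('n::{finite,linorder}, 'k::field) mpoly set"
  assumes I: "mpoly.subspace I" and J: "mpoly.subspace J" and "I \<subseteq> J"
    and lead: "lead_exponents J \<subseteq> lead_exponents I" and "f \<in> J" "f \<in> forms t"
  shows "f \<in> I"
  using assms(5,6)
proof (induction "card {\<gamma>. monomial_degree \<gamma> = nat t \<and> \<gamma> < Max (keys f)}" arbitrary: f rule: less_induct)
  case less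
  show ?case
  proof (cases "f = 0")
    case False
    then have "Max (keys f) \<in> lead_exponents I"
      using less.prems lead unfolding lead_exponents_def by blast
    then obtain g s where g: "g \<in> I" "g \<in> forms s" "g \<noteq> 0" "Max (keys g) = Max (keys f)"
      unfolding lead_exponents_def by force
    obtain c where forms: "f - const c * g \<in> forms t"
      and smaller: "\<forall>\<gamma>\<in>keys (f - const c * g). \<gamma> < Max (keys f)"
      by (rule forms_cancel_lead[OF less.prems(2) False g(2-4)])
    let ?h = "f - const c * g"
    have cg: "const c * g \<in> I" using g(1) by (rule mpoly.subspace_scale[OF I])
    have "?h \<in> I"
    proof (cases "?h = 0")
      case True
      then show ?thesis using mpoly.subspace_0[OF I] by simp
    next
      case False
      then have Max_h: "Max (keys ?h) \<in> keys ?h" by (intro Max_in) simp_all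
      then have "Max (keys ?h) < Max (keys f)" using smaller by blast
      moreover have "monomial_degree (Max (keys ?h)) = nat t"
        using Max_h forms by (auto simp: forms_def in_keys_iff)
      ultimately have "{\<gamma>. monomial_degree \<gamma> = nat t \<and> \<gamma> < Max (keys ?h)}
          \<subset> {\<gamma>. monomial_degree \<gamma> = nat t \<and> \<gamma> < Max (keys f)}" by force
      then have "card {\<gamma>. monomial_degree \<gamma> = nat t \<and> \<gamma> < Max (keys ?h)}
          < card {\<gamma>. monomial_degree \<gamma> = nat t \<and> \<gamma> < Max (keys f)}"
        by (rule psubset_card_mono[rotated]) (simp add: finite_monomial_degree_eq)
      moreover have "?h \<in> J" using less.prems(1) cg \<open>I \<subseteq> J\<close> by (intro mpoly.subspace_diff[OF J]) auto
      ultimately show ?thesis using less.hyps forms by blast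
    qed
    then show ?thesis using mpoly.subspace_add[OF I _ cg] by fastforce
  qed (use mpoly.subspace_0[OF I] in simp)
qed

lemma lead_exponents_psubset:
  assumes I: "homogeneous_ideal I" and J: "homogeneous_ideal J" and "I \<subset> J"
  shows "\<exists>\<alpha>\<in>lead_exponents J. \<alpha> \<notin> lead_exponents I"
proof (rule ccontr)
  assume "\<not> (\<exists>\<alpha>\<in>lead_exponents J. \<alpha> \<notin> lead_exponents I)"
  then have forms: "f \<in> I" if "f \<in> J" "f \<in> forms t" for f t
    using that \<open>I \<subset> J\<close> forms_subset_if_lead_exponents_subset[OF I[THEN homogeneous_ideal_subspace]
        J[THEN homogeneous_ideal_subspace]] by blast
  have "J \<subseteq> I"
  proof
    fix f assume "f \<in> J"
    then have "mpoly.component e f \<in> I" for e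
      using forms homogeneous_ideal_component[OF J] mpoly.component_in_G by blast
    then show "f \<in> I" using homogeneous_ideal_mem_iff[OF I] by blast
  qed
  then show False using \<open>I \<subset> J\<close> by blast
qed

lemma incseq_subseq:
  fixes f :: "nat \<Rightarrow> 'a::wellorder"
  obtains \<phi> :: "nat \<Rightarrow> nat" where "strict_mono \<phi>" "incseq (f \<circ> \<phi>)"
proof -
  obtain \<phi> :: "nat \<Rightarrow> nat" where \<phi>: "strict_mono \<phi>" "monoseq (\<lambda>n. f (\<phi> n))"
    using seq_monosub[of f] by blast
  show ?thesis
  proof (cases "incseq (f \<circ> \<phi>)")
    case False
    then have dec: "f (\<phi> n) \<le> f (\<phi> m)" if "m \<le> n" for m n
      using \<phi>(2) that by (auto simp: monoseq_def incseq_def)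
    define a where "a = (LEAST a. \<exists>n. a = f (\<phi> n))"
    have least: "a \<le> f (\<phi> n)" for n unfolding a_def by (rule Least_le) blast
    have "\<exists>n. a = f (\<phi> n)" unfolding a_def by (rule LeastI_ex) blast
    then obtain N where "a = f (\<phi> N)" ..
    then have "f (\<phi> (N + n)) = a" for n using least[of "N + n"] dec[of N "N + n"] by simp
    then have "incseq (f \<circ> (\<lambda>n. \<phi> (N + n)))" by (simp add: incseq_def)
    moreover have "strict_mono (\<lambda>n. \<phi> (N + n))" using \<phi>(1) by (simp add: strict_mono_def)
    ultimately show ?thesis using that by blast
  qed (use \<phi> that in blast)
qed

lemma dickson:
  fixes \<alpha> :: "nat \<Rightarrow> 'n::finite \<Rightarrow>\<^sub>0 nat"
  obtains i j \<beta> where "i < j" "\<alpha> j = \<beta> + \<alpha> i"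
proof -
  have "\<exists>\<phi> :: nat \<Rightarrow> nat. strict_mono \<phi> \<and> (\<forall>k\<in>A. incseq (\<lambda>i. lookup (\<alpha> (\<phi> i)) k))"
    if "finite A" for A :: "'n set"
    using that
  proof (induction A)
    case empty
    show ?case by (intro exI[of _ id]) (simp add: strict_mono_def)
  next
    case (insert a A)
    then obtain \<phi> :: "nat \<Rightarrow> nat" where \<phi>: "strict_mono \<phi>" "\<forall>k\<in>A. incseq (\<lambda>i. lookup (\<alpha> (\<phi> i)) k)"
      by blast
    obtain \<psi> :: "nat \<Rightarrow> nat" where \<psi>: "strict_mono \<psi>" "incseq ((\<lambda>i. lookup (\<alpha> (\<phi> i)) a) \<circ> \<psi>)"
      by (rule incseq_subseq)
    then have "\<forall>k\<in>insert a A. incseq (\<lambda>i. lookup (\<alpha> ((\<phi> \<circ> \<psi>) i)) k)"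
      using \<phi>(2) by (auto simp: incseq_def strict_mono_less_eq)
    then show ?case using strict_mono_o[OF \<phi>(1) \<psi>(1)] by blast
  qed
  from this[of UNIV] obtain \<phi> :: "nat \<Rightarrow> nat"
    where \<phi>: "strict_mono \<phi>" "\<And>k. incseq (\<lambda>i. lookup (\<alpha> (\<phi> i)) k)" by auto
  have "lookup (\<alpha> (\<phi> 0)) k \<le> lookup (\<alpha> (\<phi> 1)) k" for k using \<phi>(2)[of k] by (simp add: incseq_def)
  then have "\<alpha> (\<phi> 1) = (\<alpha> (\<phi> 1) - \<alpha> (\<phi> 0)) + \<alpha> (\<phi> 0)"
    by (intro poly_mapping_eqI) (simp add: lookup_add lookup_minus)
  moreover have "\<phi> 0 < \<phi> 1" using \<phi>(1) by (simp add: strict_mono_def)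
  ultimately show ?thesis using that by blast
qed

lemma wf_homogeneous_ideals:
  "wf {(J, I :: ('n::{finite,linorder}, 'k::field) mpoly set).
    homogeneous_ideal I \<and> homogeneous_ideal J \<and> I \<subset> J}"
  unfolding wf_iff_no_infinite_down_chain
proof
  assume "\<exists>F. \<forall>i. (F (Suc i), F i) \<in> {(J, I :: ('n, 'k) mpoly set).
    homogeneous_ideal I \<and> homogeneous_ideal J \<and> I \<subset> J}"
  then obtain F :: "nat \<Rightarrow> ('n, 'k) mpoly set"
    where "\<forall>i. (F (Suc i), F i) \<in> {(J, I). homogeneous_ideal I \<and> homogeneous_ideal J \<and> I \<subset> J}" ..
  then have F: "homogeneous_ideal (F i)" "F i \<subset> F (Suc i)" for i by simp_all
  obtain \<alpha> where \<alpha>: "\<And>i. \<alpha> i \<in> lead_exponents (F (Suc i))" "\<And>i. \<alpha> i \<notin> lead_exponents (F i)"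
    using lead_exponents_psubset[OF F(1) F(1) F(2)] by metis
  obtain i j \<beta> where ij: "i < j" "\<alpha> j = \<beta> + \<alpha> i" using dickson[of \<alpha>] .
  have "\<beta> + \<alpha> i \<in> lead_exponents (F (Suc i))"
    by (rule lead_exponents_add[OF homogeneous_ideal_subspace[OF F(1)] \<alpha>(1)])
  moreover have "F (Suc i) \<subseteq> F j"
    by (rule lift_Suc_mono_le[of F, OF psubset_imp_subset[OF F(2)]]) (use ij(1) in simp)
  then have "lead_exponents (F (Suc i)) \<subseteq> lead_exponents (F j)" unfolding lead_exponents_def by blast
  ultimately show False using \<alpha>(2)[of j] ij(2) by auto
qed

section \<open>Growth of Hilbert functions\<close>

text \<open>A nonzero polynomial function is in \<open>O(growth e)\<close> iff its degree is less than \<open>e\<close>; in particular,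
  the functions in \<open>O(growth 0)\<close> vanish eventually.\<close>

definition growth :: "nat \<Rightarrow> int \<Rightarrow> real" where
  "growth e t = (if e = 0 then 0 else of_int t ^ (e - 1))"

definition bounded_growth :: "nat \<Rightarrow> (int \<Rightarrow> nat) \<Rightarrow> bool" where
  "bounded_growth e h \<longleftrightarrow> (\<lambda>t. real (h t)) \<in> O(growth e)"

lemma bounded_growth_mono:
  assumes "bounded_growth e h" "\<forall>\<^sub>F t in at_top. h' t \<le> h t"
  shows "bounded_growth e h'"
proof -
  have "(\<lambda>t. real (h' t)) \<in> O(\<lambda>t. real (h t))"
    using assms(2) by (intro landau_o.big_mono) simp
  then show ?thesis using assms(1) unfolding bounded_growth_def by (rule landau_o.big_trans)
qed

lemma bounded_growth_if_eventually_0: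
  assumes "\<forall>\<^sub>F t in at_top. h t = 0"
  shows "bounded_growth e h"
proof -
  have "(\<lambda>_. 0) \<in> O(growth e)" by simp
  then show ?thesis
    by (intro bounded_growth_mono[of e "\<lambda>_. 0" h]) (use assms in \<open>simp_all add: bounded_growth_def\<close>)
qed

lemma bounded_growth_sum:
  "(\<And>i. i \<in> A \<Longrightarrow> bounded_growth e (h i)) \<Longrightarrow> bounded_growth e (\<lambda>t. \<Sum>i\<in>A. h i t)"
  unfolding bounded_growth_def of_nat_sum by (rule big_sum_in_bigo)

lemma bounded_growth_add:
  "bounded_growth e h \<Longrightarrow> bounded_growth e h' \<Longrightarrow> bounded_growth e (\<lambda>t. h t + h' t)"
  unfolding bounded_growth_def of_nat_add by (rule sum_in_bigo)

lemma bounded_growth_shift: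
  assumes "bounded_growth e h"
  shows "bounded_growth e (\<lambda>t. h (t - a))"
proof -
  have "filterlim (\<lambda>t :: int. t - a) at_top at_top"
    unfolding filterlim_at_top
  proof
    show "\<forall>\<^sub>F t in at_top. Z \<le> t - a" for Z
      using eventually_ge_at_top[of "Z + a"] by eventually_elim simp
  qed
  then have "(\<lambda>t. real (h (t - a))) \<in> O(\<lambda>t. growth e (t - a))"
    using assms unfolding bounded_growth_def by (intro landau_o.big.compose[where h' = "\<lambda>t. t - a"])
  also have "(\<lambda>t. growth e (t - a)) \<in> O(growth e)"
  proof (cases "e = 0")
    case False
    have "(\<lambda>t. real_of_int (t - a)) \<in> O(real_of_int)"
    proof (rule landau_o.bigI[of 2])
      show "\<forall>\<^sub>F t in at_top. norm (real_of_int (t - a)) \<le> 2 * norm (real_of_int t)"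
        using eventually_ge_at_top[of "\<bar>a\<bar>"]
      proof eventually_elim
        fix t assume "\<bar>a\<bar> \<le> t"
        then have "real_of_int \<bar>t - a\<bar> \<le> real_of_int (2 * \<bar>t\<bar>)" unfolding of_int_le_iff by linarith
        then show "norm (real_of_int (t - a)) \<le> 2 * norm (real_of_int t)" by simp
      qed
    qed simp
    then have "(\<lambda>t. real_of_int (t - a) ^ (e - 1)) \<in> O(\<lambda>t. real_of_int t ^ (e - 1))"
      by (rule landau_o.big_power)
    then show ?thesis using False by (simp add: growth_def [abs_def])
  qed (simp add: growth_def)
  finally show ?thesis by (simp add: bounded_growth_def)
qed

lemma bounded_growth_Suc:
  assumes "bounded_growth e h'" and step: "\<And>t. h t \<le> h (t - 1) + h' t"
  shows "bounded_growth (Suc e) h"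
proof -
  obtain C where "C > 0" and C: "\<forall>\<^sub>F t in at_top. real (h' t) \<le> C * norm (growth e t)"
    using assms(1) unfolding bounded_growth_def by (elim landau_o.bigE) simp
  have "\<forall>\<^sub>F t in at_top. real (h' t) \<le> C * growth e t \<and> t \<ge> 1"
    using C eventually_ge_at_top[of 1] by eventually_elim (auto simp: growth_def)
  then obtain N where N: "\<And>t. t \<ge> N \<Longrightarrow> real (h' t) \<le> C * growth e t \<and> t \<ge> 1"
    unfolding eventually_at_top_linorder by blast
  have mono: "growth e s \<le> growth e t" if "N \<le> s" "s \<le> t" for s t
    using that N[of s] by (auto simp: growth_def intro: power_mono)
  have bound: "real (h t) \<le> real (h N) + real_of_int (t - N) * (C * growth e t)" if "t \<ge> N" for t
    using that
  proof (induction t rule: int_ge_induct)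
    case (step t)
    have "real (h (t + 1)) \<le> real (h t) + real (h' (t + 1))"
      using assms(2)[of "t + 1"] by simp
    also have "\<dots> \<le> (real (h N) + real_of_int (t - N) * (C * growth e t)) + C * growth e (t + 1)"
      using step N[of "t + 1"] by (intro add_mono) auto
    also have "\<dots> \<le> (real (h N) + real_of_int (t - N) * (C * growth e (t + 1))) + C * growth e (t + 1)"
      using step.hyps \<open>C > 0\<close> by (intro add_mono mult_left_mono mono order_refl) auto
    finally show ?case by (simp add: algebra_simps)
  qed simp
  have "real (h t) \<le> (real (h N) + C) * growth (Suc e) t" if "t \<ge> N" for t
  proof -
    have "t \<ge> 1" using N that by blast
    have "real_of_int (t - N) * growth e t \<le> real_of_int t * growth e t"
      using \<open>t \<ge> 1\<close> N[of N] by (intro mult_right_mono) (auto simp: growth_def)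
    also have "\<dots> \<le> growth (Suc e) t" by (cases e) (simp_all add: growth_def)
    finally have "C * (real_of_int (t - N) * growth e t) \<le> C * growth (Suc e) t"
      using \<open>C > 0\<close> by (intro mult_left_mono) auto
    moreover have "real (h N) * 1 \<le> real (h N) * growth (Suc e) t"
      using \<open>t \<ge> 1\<close> by (intro mult_left_mono) (auto simp: growth_def one_le_power)
    ultimately show ?thesis using bound[OF that] by (simp add: algebra_simps)
  qed
  then have "norm (real (h t)) \<le> (real (h N) + C) * norm (growth (Suc e) t)" if "t \<ge> N" for t
    using that N[OF that] by (simp add: growth_def)
  then have "\<forall>\<^sub>F t in at_top. norm (real (h t)) \<le> (real (h N) + C) * norm (growth (Suc e) t)"
    using eventually_at_top_linorder by blast
  then show ?thesis
    unfolding bounded_growth_def using \<open>C > 0\<close> by (intro landau_o.bigI[of "real (h N) + C"]) auto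
qed

lemma degree_less_if_bigo_growth:
  fixes p :: "real poly"
  assumes "(\<lambda>t :: int. poly p (of_int t)) \<in> O(growth e)"
  shows "p = 0 \<or> degree p < e"
proof (rule ccontr)
  assume "\<not> (p = 0 \<or> degree p < e)"
  then have "p \<noteq> 0" and "e \<le> degree p" by auto
  have at_infinity: "filterlim real_of_int at_infinity at_top"
    by (rule filterlim_at_top_imp_at_infinity[OF filterlim_real_of_int_at_top])
  have nonzero: "\<forall>\<^sub>F t :: int in at_top. poly p (of_int t) \<noteq> 0"
    using filterlim_iff[THEN iffD1, OF at_infinity] poly_eventually_not_zero[OF \<open>p \<noteq> 0\<close>] by blast
  have "growth e \<in> o(\<lambda>t. poly p (of_int t))"
  proof (cases "e = 0")
    case False
    define q :: "real poly" where "q = monom 1 (e - 1)"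
    have "degree q < degree p" using False \<open>e \<le> degree p\<close> by (simp add: q_def degree_monom_eq)
    then have "((\<lambda>t :: int. poly q (of_int t) / poly p (of_int t)) \<longlongrightarrow> 0) at_top"
      by (rule filterlim_compose[OF poly_divide_tendsto_0_at_infinity at_infinity])
    then have "(\<lambda>t. poly q (of_int t)) \<in> o(\<lambda>t. poly p (of_int t))"
      using nonzero by (rule smalloI_tendsto)
    then show ?thesis using False by (simp add: q_def poly_monom growth_def [abs_def])
  qed (simp add: growth_def [abs_def])
  with assms have "(\<lambda>t :: int. poly p (of_int t)) \<in> o(\<lambda>t. poly p (of_int t))"
    by (rule landau_o.big_small_trans)
  then have "\<forall>\<^sub>F t :: int in at_top. poly p (of_int t) = 0" by (simp add: landau_o.small_refl_iff)
  with nonzero have "\<forall>\<^sub>F t :: int in at_top. False" by eventually_elim simp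
  then show False by simp
qed

lemma of_rat_poly: "of_rat (poly P x) = poly (map_poly of_rat P) (of_rat x :: 'a::field_char_0)"
  by (induction P) (simp_all add: map_poly_pCons of_rat_add of_rat_mult)

lemma degree_less_if_bounded_growth:
  fixes P :: "rat poly"
  assumes P: "\<forall>\<^sub>F t in at_top. poly P (of_int t) = of_nat (h t)" and "bounded_growth e h"
  shows "P = 0 \<or> degree P < e"
proof -
  let ?Q = "map_poly of_rat P :: real poly"
  have "\<forall>\<^sub>F t in at_top. real (h t) = poly ?Q (of_int t)"
    using P
  proof eventually_elim
    fix t assume "poly P (of_int t) = of_nat (h t)"
    then have "of_rat (poly P (of_int t)) = (of_rat (of_nat (h t)) :: real)" by simp
    then show "real (h t) = poly ?Q (of_int t)" by (simp add: of_rat_poly)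
  qed
  then have "(\<lambda>t. poly ?Q (of_int t)) \<in> O(growth e)"
    using assms(2) unfolding bounded_growth_def by (simp cong: landau_o.big.in_cong)
  then have "?Q = 0 \<or> degree ?Q < e" by (rule degree_less_if_bigo_growth)
  then show ?thesis by (simp add: degree_map_poly map_poly_eq_0_iff)
qed

definition quotient_hilbert_function :: "('n::{finite,linorder}, 'k::field) mpoly set \<Rightarrow> int \<Rightarrow> nat" where
  "quotient_hilbert_function I t = (THE n. has_quotient_dim (kscale (*)) (forms t) I n)"

lemma subspace_ideal: "mpoly.subspace I \<Longrightarrow> mpoly.k.subspace I"
  by (rule subspace_kscale[OF module_mult])

lemma quotient_hilbert_function_eqI:
  assumes I: "mpoly.subspace I" and n: "has_quotient_dim (kscale (*)) (forms t) I n"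
  shows "quotient_hilbert_function I t = n"
  unfolding quotient_hilbert_function_def
  using mpoly.k.has_quotient_dim_unique[OF subspace_ideal[OF I]] n by blast

lemma has_quotient_dim_forms:
  assumes "mpoly.subspace I"
  shows "has_quotient_dim (kscale (*)) (forms t) I (quotient_hilbert_function I t)"
proof -
  obtain T :: "('a, 'b) mpoly set" where "finite T" "forms t \<subseteq> mpoly.k.span T"
    using forms_finite_dimensional by blast
  then obtain n where n: "has_quotient_dim (kscale (*)) (forms t) I n"
    using mpoly.k.has_quotient_dim_exists[OF subspace_ideal[OF assms]] by blast
  then show ?thesis using quotient_hilbert_function_eqI[OF assms n] by simp
qed

lemma quotient_hilbert_function_eq_0:
  assumes "mpoly.subspace I" "forms t \<subseteq> I"
  shows "quotient_hilbert_function I t = 0"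
  using assms by (intro quotient_hilbert_function_eqI mpoly.k.has_quotient_dim_0)

text \<open>Multiplication by \<open>f\<close> makes \<open>R / (I : f)\<close>, shifted by the degree of \<open>f\<close>, the kernel of
  \<open>R / I \<rightarrow> R / (I + (f))\<close>.\<close>

lemma quotient_hilbert_function_colon:
  fixes I :: "('n::{finite,linorder}, 'k::field) mpoly set"
  assumes I: "homogeneous_ideal I" and f: "f \<in> forms a"
  shows "quotient_hilbert_function I t
    = quotient_hilbert_function (mpoly.span (insert f I)) t
      + quotient_hilbert_function (ideal_colon I f) (t - a)"
    (is "_ = ?m + ?n")
proof (rule quotient_hilbert_function_eqI)
  note I' = homogeneous_ideal_subspace[OF I]
  let ?V = "mpoly.span (insert f I)"
  show "mpoly.subspace I" by (fact I')
  have linear: "Vector_Spaces.linear (kscale (*)) (kscale (*)) (\<lambda>g. g * f)"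
    by unfold_locales (simp_all add: distrib_right kscale_def mult.assoc)
  have "has_quotient_dim (kscale (*)) (forms (t - a)) (ideal_colon I f) ?n
      \<longleftrightarrow> has_quotient_dim (kscale (*)) (forms t \<inter> ?V) I ?n"
  proof (rule has_quotient_dim_linear_iff[OF linear mpoly.subspace_G subspace_ideal[OF I']])
    fix g :: "('n, 'k) mpoly" assume "g \<in> forms (t - a)"
    then have "g * f \<in> forms t" using forms_mult[OF _ f, of g "t - a"] by simp
    moreover have "g * f \<in> ?V" by (intro mpoly.span_scale mpoly.span_base) simp
    ultimately show "g * f \<in> forms t \<inter> ?V" by simp
  next
    fix x assume x: "x \<in> forms t \<inter> ?V"
    then obtain g where "x - g * f \<in> I" using mem_span_insert_ideal[OF I'] by blast
    then have "mpoly.component t (x - g * f) \<in> I" by (rule homogeneous_ideal_component[OF I])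
    moreover have "mpoly.component t x = x" using x by (simp add: mpoly.component_of_G[of _ t])
    ultimately have "x - mpoly.component (t - a) g * f \<in> I"
      by (simp add: mpoly.component.diff mpoly.component_scale_of_G[OF f])
    then show "\<exists>g\<in>forms (t - a). x - g * f \<in> I" by (rule bexI) simp
  qed (simp add: ideal_colon_def)
  moreover have "has_quotient_dim (kscale (*)) (forms (t - a)) (ideal_colon I f) ?n"
    by (intro has_quotient_dim_forms homogeneous_ideal_subspace homogeneous_ideal_colon[OF I f])
  ultimately have "has_quotient_dim (kscale (*)) (forms t \<inter> ?V) I ?n" by blast
  moreover have "has_quotient_dim (kscale (*)) (forms t) ?V ?m"
    by (rule has_quotient_dim_forms[OF mpoly.subspace_span])
  moreover have "I \<subseteq> ?V" using mpoly.span_superset by blast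
  ultimately show "has_quotient_dim (kscale (*)) (forms t) I (?m + ?n)"
    using mpoly.k.has_quotient_dim_trans[OF mpoly.subspace_G subspace_ideal[OF mpoly.subspace_span]]
    by blast
qed

section \<open>Chains of prime ideals\<close>

lemma component_mult_top:
  assumes f: "\<And>e. s < e \<Longrightarrow> mpoly.component e f = 0" and g: "\<And>e. u < e \<Longrightarrow> mpoly.component e g = 0"
  shows "mpoly.component (s + u) (f * g) = mpoly.component s f * mpoly.component u g"
proof -
  let ?E = "insert s {e. mpoly.component e f \<noteq> 0}"
  have "finite ?E" using mpoly.finite_components by simp
  then have f_eq: "f = (\<Sum>e\<in>?E. mpoly.component e f)" by (rule mpoly.eq_sum_components) blast
  have "mpoly.component (s + u) (f * g) = mpoly.component (s + u) (g * (\<Sum>e\<in>?E. mpoly.component e f))"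
    by (simp only: mult.commute flip: f_eq)
  also have "\<dots> = (\<Sum>e\<in>?E. mpoly.component (s + u - e) g * mpoly.component e f)"
    by (simp only: sum_distrib_left mpoly.component.sum
        mpoly.component_scale_of_G[OF mpoly.component_in_G])
  also have "\<dots> = (\<Sum>e\<in>{s}. mpoly.component (s + u - e) g * mpoly.component e f)"
  proof (rule sum.mono_neutral_right[OF \<open>finite ?E\<close>])
    show "\<forall>e\<in>?E - {s}. mpoly.component (s + u - e) g * mpoly.component e f = 0"
    proof
      fix e assume "e \<in> ?E - {s}"
      then show "mpoly.component (s + u - e) g * mpoly.component e f = 0"
        using f[of e] g[of "s + u - e"] by (cases e s rule: linorder_cases) auto
    qed
  qed simp
  finally show ?thesis by (simp add: mult.commute)
qed

lemma homogeneous_ideal_top_component: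
  assumes I: "homogeneous_ideal I" and "f \<notin> I"
  obtains f' s where "f - f' \<in> I" "mpoly.component s f' \<notin> I" "\<forall>e>s. mpoly.component e f' = 0"
proof -
  note I' = homogeneous_ideal_subspace[OF I]
  define A where "A = {e. mpoly.component e f \<notin> I}"
  have "A \<subseteq> {e. mpoly.component e f \<noteq> 0}" using mpoly.subspace_0[OF I'] by (auto simp: A_def)
  then have "finite A" using mpoly.finite_components by (rule finite_subset)
  have "A \<noteq> {}" using assms(2) unfolding A_def homogeneous_ideal_mem_iff[OF I, of f] by blast
  define f' where "f' = (\<Sum>e\<in>A. mpoly.component e f)"
  have f': "mpoly.component e f' = (if e \<in> A then mpoly.component e f else 0)" for e
    using \<open>finite A\<close> by (simp add: f'_def mpoly.component.sum
        mpoly.component_of_G[OF mpoly.component_in_G])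
  have "mpoly.component e (f - f') \<in> I" for e
    using mpoly.subspace_0[OF I'] by (simp add: mpoly.component.diff f' A_def)
  then have "f - f' \<in> I" unfolding homogeneous_ideal_mem_iff[OF I, of "f - f'"] by blast
  moreover have "Max A \<in> A" using \<open>finite A\<close> \<open>A \<noteq> {}\<close> by (rule Max_in)
  then have "mpoly.component (Max A) f' \<notin> I" by (simp add: f' A_def)
  moreover have "\<forall>e>Max A. mpoly.component e f' = 0"
    using \<open>finite A\<close> by (auto simp: f' dest: Max_ge)
  ultimately show ?thesis by (rule that)
qed

lemma prime_ideal_if_homogeneous_prime:
  assumes I: "homogeneous_ideal I" and "I \<noteq> UNIV"
    and prime: "\<And>a b f g. f \<in> forms a \<Longrightarrow> g \<in> forms b \<Longrightarrow> f * g \<in> I \<Longrightarrow> f \<in> I \<or> g \<in> I"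
  shows "prime_ideal I"
  unfolding prime_ideal_def
proof (intro conjI allI impI)
  note I' = homogeneous_ideal_subspace[OF I]
  show "mpoly.subspace I" "I \<noteq> UNIV" by (fact I' assms(2))+
  fix f g assume fg: "f * g \<in> I"
  show "f \<in> I \<or> g \<in> I"
  proof (rule ccontr)
    assume notin: "\<not> (f \<in> I \<or> g \<in> I)"
    obtain f' s where f': "f - f' \<in> I" "mpoly.component s f' \<notin> I" "\<forall>e>s. mpoly.component e f' = 0"
      using homogeneous_ideal_top_component[OF I, of f] notin by blast
    obtain g' u where g': "g - g' \<in> I" "mpoly.component u g' \<notin> I" "\<forall>e>u. mpoly.component e g' = 0"
      using homogeneous_ideal_top_component[OF I, of g] notin by blast
    have "f * g - (g * (f - f') + f' * (g - g')) \<in> I"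
      by (intro mpoly.subspace_diff[OF I'] mpoly.subspace_add[OF I'] mpoly.subspace_scale[OF I'] fg
          f'(1) g'(1))
    then have "f' * g' \<in> I" by (simp add: algebra_simps)
    then have "mpoly.component s f' * mpoly.component u g' \<in> I"
      using homogeneous_ideal_component[OF I] component_mult_top[of s f' u g'] f'(3) g'(3) by metis
    then show False using prime[OF mpoly.component_in_G mpoly.component_in_G] f'(2) g'(2) by blast
  qed
qed

text \<open>A homogeneous ideal that is maximal among those of large growth is prime, because
  \<open>R / J\<close> is an extension of \<open>R / (J + (f))\<close> by a shift of \<open>R / (J : f)\<close>.\<close>

lemma prime_ideal_of_large_growth:
  fixes I :: "('n::{finite,linorder}, 'k::field) mpoly set"
  assumes I: "homogeneous_ideal I" and growth: "\<not> bounded_growth e (quotient_hilbert_function I)"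
  obtains J where "homogeneous_ideal J" "I \<subseteq> J" "prime_ideal J"
    "\<not> bounded_growth e (quotient_hilbert_function J)"
proof -
  define Q where "Q = {J. homogeneous_ideal J \<and> I \<subseteq> J
      \<and> \<not> bounded_growth e (quotient_hilbert_function J)}"
  have "I \<in> Q" using I growth by (simp add: Q_def)
  with wf_homogeneous_ideals obtain J where "J \<in> Q"
    and maximal: "\<And>K. (K, J) \<in> {(J, I). homogeneous_ideal I \<and> homogeneous_ideal J \<and> I \<subset> J} \<Longrightarrow> K \<notin> Q"
    by (rule wfE_min) blast
  then have J: "homogeneous_ideal J" "I \<subseteq> J" "\<not> bounded_growth e (quotient_hilbert_function J)"
    by (auto simp: Q_def)
  note J' = homogeneous_ideal_subspace[OF J(1)]
  have bounded: "bounded_growth e (quotient_hilbert_function K)" if "homogeneous_ideal K" "J \<subset> K" for K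
    using maximal[of K] that J(1,2) by (auto simp: Q_def)
  have "prime_ideal J"
  proof (rule prime_ideal_if_homogeneous_prime[OF J(1)])
    have "bounded_growth e (quotient_hilbert_function (UNIV :: ('n, 'k) mpoly set))"
      by (intro bounded_growth_if_eventually_0 always_eventually allI quotient_hilbert_function_eq_0)
        (simp_all add: mpoly.subspace_UNIV)
    then show "J \<noteq> UNIV" using J(3) by blast
    fix a b f g assume f: "f \<in> forms a" and g: "g \<in> forms b" and fg: "f * g \<in> J"
    show "f \<in> J \<or> g \<in> J"
    proof (rule ccontr)
      assume notin: "\<not> (f \<in> J \<or> g \<in> J)"
      have "J \<subset> mpoly.span (insert f J)" using notin mpoly.span_superset[of "insert f J"] by blast
      then have "bounded_growth e (quotient_hilbert_function (mpoly.span (insert f J)))"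
        by (rule bounded[OF homogeneous_ideal_span_insert[OF J(1) f]])
      moreover have "g \<in> ideal_colon J f" using fg by (simp add: ideal_colon_def mult.commute)
      then have "J \<subset> ideal_colon J f" using notin subset_ideal_colon[OF J', of f] by blast
      then have "bounded_growth e (quotient_hilbert_function (ideal_colon J f))"
        by (rule bounded[OF homogeneous_ideal_colon[OF J(1) f]])
      then have "bounded_growth e (\<lambda>t. quotient_hilbert_function (ideal_colon J f) (t - a))"
        by (rule bounded_growth_shift)
      ultimately have "bounded_growth e (quotient_hilbert_function J)"
        unfolding quotient_hilbert_function_colon[OF J(1) f, abs_def] by (rule bounded_growth_add)
      then show False using J(3) by blast
    qed
  qed
  with J show ?thesis using that by blast
qed

definition prime_chain :: "'r::comm_ring_1 set \<Rightarrow> nat \<Rightarrow> (nat \<Rightarrow> 'r set) \<Rightarrow> bool" where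
  "prime_chain I l P \<longleftrightarrow> (\<forall>j\<le>l. prime_ideal (P j) \<and> I \<subseteq> P j) \<and> (\<forall>j<l. P j \<subset> P (Suc j))"

lemma prime_chain_mono: "prime_chain I l P \<Longrightarrow> I' \<subseteq> I \<Longrightarrow> prime_chain I' l P"
  unfolding prime_chain_def by blast

lemma prime_chain_0: "prime_ideal J \<Longrightarrow> I \<subseteq> J \<Longrightarrow> prime_chain I 0 (\<lambda>_. J)"
  by (simp add: prime_chain_def)

lemma prime_chain_Suc:
  assumes "prime_chain K l P" and J: "prime_ideal J" "J \<subset> K"
  shows "prime_chain J (Suc l) (case_nat J P)"
  unfolding prime_chain_def
proof (intro conjI allI impI)
  fix j assume "j \<le> Suc l"
  then show "prime_ideal (case_nat J P j)" "J \<subseteq> case_nat J P j"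
    using assms unfolding prime_chain_def by (cases j; auto)+
next
  fix j assume "j < Suc l"
  then show "case_nat J P j \<subset> case_nat J P (Suc j)"
    using assms unfolding prime_chain_def by (cases j) auto
qed

lemma krull_dim_ge: "prime_chain (annihilator sm) l P \<Longrightarrow> enat l \<le> krull_dim sm"
  unfolding krull_dim_def prime_chain_def by (rule SUP_upper) blast

lemma lookup_mult_0:
  fixes f g :: "('n::finite, 'k::field) mpoly"
  shows "lookup (f * g) 0 = lookup f 0 * lookup g 0"
proof -
  have "lookup (single \<alpha> a * single \<beta> b) 0 = lookup (single \<alpha> a) 0 * lookup (single \<beta> b) 0"
    for \<alpha> \<beta> :: "'n \<Rightarrow>\<^sub>0 nat" and a b :: 'k
    using monomial_degree_add[of \<alpha> \<beta>] monomial_degree_0_iff[of "\<alpha> + \<beta>"]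
    by (simp add: mult_single lookup_single when_def flip: monomial_degree_0_iff)
  then have "lookup (single \<alpha> a * g) 0 = lookup (single \<alpha> a) 0 * lookup g 0"
    for \<alpha> :: "'n \<Rightarrow>\<^sub>0 nat" and a :: 'k
    by (intro additive_eqI_single[where v = g and f = "\<lambda>g. lookup (single \<alpha> a * g) 0"
          and g = "\<lambda>g. lookup (single \<alpha> a) 0 * lookup g 0"])
      (simp_all add: additive_def distrib_left lookup_add)
  then show ?thesis
    by (intro additive_eqI_single[where v = f and f = "\<lambda>f. lookup (f * g) 0"
          and g = "\<lambda>f. lookup f 0 * lookup g 0"])
      (simp_all add: additive_def distrib_right lookup_add)
qed

lemma prime_irrelevant_ideal:
  "prime_ideal {f :: ('n::{finite,linorder}, 'k::field) mpoly. lookup f 0 = 0}"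
  unfolding prime_ideal_def
proof (intro conjI allI impI)
  show "mpoly.subspace {f :: ('n, 'k) mpoly. lookup f 0 = 0}"
    by (rule mpoly.subspaceI) (auto simp: lookup_add lookup_mult_0)
  have "(1 :: ('n, 'k) mpoly) \<notin> {f. lookup f 0 = 0}" by simp
  then show "{f :: ('n, 'k) mpoly. lookup f 0 = 0} \<noteq> UNIV" by blast
qed (auto simp: lookup_mult_0)

lemma lookup_0_eq_0_if_forms: "f \<in> forms t \<Longrightarrow> t \<noteq> 0 \<Longrightarrow> lookup f 0 = 0"
  by (metis (mono_tags, lifting) forms_def mem_Collect_eq monomial_degree_0_iff of_nat_0)

lemma homogeneous_ideal_subset_irrelevant:
  fixes J :: "('n::{finite,linorder}, 'k::field) mpoly set"
  assumes J: "homogeneous_ideal J" "J \<noteq> UNIV"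
  shows "J \<subseteq> {f. lookup f 0 = 0}"
proof (rule subsetI, unfold mem_Collect_eq, rule ccontr)
  note J' = homogeneous_ideal_subspace[OF J(1)]
  fix f assume "f \<in> J" and f: "lookup f 0 \<noteq> 0"
  have "lookup f 0 = (\<Sum>e\<in>{e. mpoly.component e f \<noteq> 0}. lookup (mpoly.component e f) 0)"
    by (subst mpoly.eq_sum_components[OF mpoly.finite_components order_refl, of f]) (rule lookup_sum)
  then obtain e where e: "lookup (mpoly.component e f) 0 \<noteq> 0"
    using f by (metis (mono_tags, lifting) sum.neutral)
  let ?c = "lookup (mpoly.component e f) 0"
  have "e = 0" using e lookup_0_eq_0_if_forms mpoly.component_in_G by blast
  then have "mpoly.component e f = const ?c"
    using mpoly.component_in_G[of e f]
    by (intro poly_mapping_eqI)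
        (auto simp: forms_def monomial_degree_0_iff const_def lookup_single when_def)
  then have "const (1 / ?c) * const ?c \<in> J"
    using mpoly.subspace_scale[OF J' homogeneous_ideal_component[OF J(1) \<open>f \<in> J\<close>]] by metis
  then have "1 \<in> J" using e by (simp flip: const_mult)
  then have "g \<in> J" for g using mpoly.subspace_scale[OF J', of 1 g] by simp
  then show False using J(2) by blast
qed

lemma var_notin_if_large_growth:
  fixes J :: "('n::{finite,linorder}, 'k::field) mpoly set"
  assumes J: "mpoly.subspace J" and growth: "\<not> bounded_growth e (quotient_hilbert_function J)"
  obtains i where "var i \<notin> J"
proof -
  have "\<exists>i. var i \<notin> J"
  proof (rule ccontr)
    assume "\<nexists>i. var i \<notin> J"
    then have var: "var i \<in> J" for i by blast
    have "f \<in> J" if "f \<in> forms t" "t > 0" for f t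
    proof -
      have "lookup f 0 = 0"
        using that monomial_degree_0_iff[of "0 :: 'n \<Rightarrow>\<^sub>0 nat"] by (auto simp: forms_def)
      then have "f \<in> irrelevant_mult (*) UNIV" by (rule irrelevant_ideal_generated_by_vars)
      then obtain g where f: "f = (\<Sum>i\<in>UNIV. var i * g i)" by (rule irrelevant_multE)
      have "g i * var i \<in> J" for i by (rule mpoly.subspace_scale[OF J var])
      then show ?thesis unfolding f by (intro mpoly.subspace_sum[OF J]) (simp add: mult.commute)
    qed
    then have "quotient_hilbert_function J t = 0" if "t > 0" for t
      using that by (intro quotient_hilbert_function_eq_0[OF J]) blast
    then have "\<forall>\<^sub>F t in at_top. quotient_hilbert_function J t = 0"
      using eventually_gt_at_top[of 0] by (rule eventually_mono[rotated])
    then show False using growth bounded_growth_if_eventually_0 by blast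
  qed
  then show ?thesis using that by blast
qed

lemma not_bounded_growth_span_insert_var:
  assumes J: "homogeneous_ideal J" "prime_ideal J" "var x \<notin> J"
    and growth: "\<not> bounded_growth (Suc e) (quotient_hilbert_function J)"
  shows "\<not> bounded_growth e (quotient_hilbert_function (mpoly.span (insert (var x) J)))"
proof
  assume bounded: "bounded_growth e (quotient_hilbert_function (mpoly.span (insert (var x) J)))"
  have "ideal_colon J (var x) \<subseteq> J"
    using J(2,3) unfolding prime_ideal_def ideal_colon_def by blast
  then have "ideal_colon J (var x) = J"
    using subset_ideal_colon[OF homogeneous_ideal_subspace[OF J(1)]] by blast
  then have "quotient_hilbert_function J t \<le> quotient_hilbert_function J (t - 1)
      + quotient_hilbert_function (mpoly.span (insert (var x) J)) t" for t
    using quotient_hilbert_function_colon[OF J(1) var_in_forms, of t x] by simp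
  then show False using bounded_growth_Suc[OF bounded] growth by blast
qed

lemma prime_chain_if_large_growth:
  assumes "homogeneous_ideal I" "\<not> bounded_growth e (quotient_hilbert_function I)"
  shows "\<exists>P. prime_chain I (Suc e) P"
  using assms
proof (induction e arbitrary: I)
  case 0
  obtain J where J: "homogeneous_ideal J" "I \<subseteq> J" "prime_ideal J"
      "\<not> bounded_growth 0 (quotient_hilbert_function J)"
    by (rule prime_ideal_of_large_growth[OF 0])
  obtain x where "var x \<notin> J"
    using var_notin_if_large_growth[OF homogeneous_ideal_subspace[OF J(1)] J(4)] .
  moreover have "lookup (var x :: ('a, 'b) mpoly) 0 = 0"
    by (rule lookup_0_eq_0_if_forms[OF var_in_forms]) simp
  moreover have "J \<noteq> UNIV" using J(3) by (simp add: prime_ideal_def)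
  ultimately have "J \<subset> {f. lookup f 0 = 0}"
    using homogeneous_ideal_subset_irrelevant[OF J(1)] by blast
  then show ?case
    using prime_chain_Suc[OF prime_chain_0[OF prime_irrelevant_ideal order_refl] J(3)]
      prime_chain_mono[OF _ J(2)] by blast
next
  case (Suc e)
  obtain J where J: "homogeneous_ideal J" "I \<subseteq> J" "prime_ideal J"
      "\<not> bounded_growth (Suc e) (quotient_hilbert_function J)"
    by (rule prime_ideal_of_large_growth[OF Suc.prems])
  obtain x where x: "var x \<notin> J"
    using var_notin_if_large_growth[OF homogeneous_ideal_subspace[OF J(1)] J(4)] .
  let ?K = "mpoly.span (insert (var x) J)"
  obtain P where P: "prime_chain ?K (Suc e) P"
    using Suc.IH[OF homogeneous_ideal_span_insert[OF J(1) var_in_forms]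
        not_bounded_growth_span_insert_var[OF J(1,3) x J(4)]] by blast
  have "J \<subset> ?K" using x mpoly.span_superset[of "insert (var x) J"] by blast
  then show ?case using prime_chain_Suc[OF P J(3)] prime_chain_mono[OF _ J(2)] by blast
qed

section \<open>The degree of the Hilbert polynomial\<close>

context graded
begin

definition element_annihilator :: "'m \<Rightarrow> ('n, 'k) mpoly set" where
  "element_annihilator g = {f. sm f g = 0}"

lemma homogeneous_ideal_element_annihilator:
  assumes "g \<in> G a"
  shows "homogeneous_ideal (element_annihilator g)"
  unfolding homogeneous_ideal_def
proof (intro conjI ballI allI)
  show "mpoly.subspace (element_annihilator g)"
    by (rule mpoly.subspaceI)
      (auto simp: element_annihilator_def scale_left_distrib simp flip: scale_scale)
  fix f e assume "f \<in> element_annihilator g"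
  then have "component (e + a) (sm f g) = 0" by (simp add: element_annihilator_def component.zero)
  then show "mpoly.component e f \<in> element_annihilator g"
    by (simp add: component_scale_of_G[OF assms] element_annihilator_def)
qed

lemma hilbert_function_le_sum_generators:
  assumes S: "finite S" "span S = UNIV" "\<forall>g\<in>S. g \<in> G (deg g)"
  shows "hilbert_function sm G t \<le> (\<Sum>g\<in>S. quotient_hilbert_function (element_annihilator g) (t - deg g))"
proof -
  define n where "n g = quotient_hilbert_function (element_annihilator g) (t - deg g)" for g
  have "\<exists>b. spanning_mod (kscale (*)) (forms (t - deg g)) (element_annihilator g) (n g) b"
    if "g \<in> S" for g
    using has_quotient_dim_forms[OF homogeneous_ideal_subspace[OF homogeneous_ideal_element_annihilator]]
      S(3) that unfolding n_def has_quotient_dim_def by blast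
  then obtain b where b: "\<And>g. g \<in> S \<Longrightarrow>
      spanning_mod (kscale (*)) (forms (t - deg g)) (element_annihilator g) (n g) (b g)" by metis
  define B where "B = (\<Union>g\<in>S. (\<lambda>i. sm (b g i) g) ` {..<n g})"
  have "G t \<subseteq> k.span B"
  proof
    fix x assume "x \<in> G t"
    with S obtain f where f: "\<forall>g. f g \<in> forms (t - deg g)" and x: "x = (\<Sum>g\<in>S. sm (f g) g)"
      by (rule G_eq_sum_forms_scale)
    have "sm (f g) g \<in> k.span B" if g: "g \<in> S" for g
    proof -
      obtain c where "f g - (\<Sum>i<n g. kscale (*) (c i) (b g i)) \<in> element_annihilator g"
        using b[OF g] f unfolding spanning_mod_def by blast
      then have "sm (f g) g = (\<Sum>i<n g. kscale sm (c i) (sm (b g i) g))"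
        by (simp add: element_annihilator_def scale_left_diff_distrib scale_sum_left kscale_def)
      also have "\<dots> \<in> k.span B"
        using g by (intro k.span_sum k.span_scale k.span_base) (auto simp: B_def)
      finally show ?thesis .
    qed
    then show "x \<in> k.span B" unfolding x by (rule k.span_sum)
  qed
  then have "hilbert_function sm G t \<le> card B"
    unfolding hilbert_function_def using S(1) by (intro k.dim_le_card) (simp_all add: B_def)
  also have "\<dots> \<le> (\<Sum>g\<in>S. card ((\<lambda>i. sm (b g i) g) ` {..<n g}))"
    unfolding B_def using S(1) by (rule card_UN_le)
  also have "\<dots> \<le> (\<Sum>g\<in>S. n g)" by (intro sum_mono card_image_le[THEN order_trans]) simp_all
  finally show ?thesis by (simp add: n_def)
qed

lemma degree_less_krull_dim:
  assumes fg: "finitely_generated sm"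
    and P: "\<forall>\<^sub>F t in at_top. poly P (of_int t) = of_nat (hilbert_function sm G t)"
  shows "P = (0 :: rat poly) \<or> enat (degree P) < krull_dim sm"
proof (cases "P = 0")
  case False
  obtain S deg where S: "finite S" "span S = UNIV" "\<forall>g\<in>S. g \<in> G (deg g)"
    using finite_homogeneous_generators[OF fg] .
  have "\<exists>g\<in>S. \<not> bounded_growth (degree P) (quotient_hilbert_function (element_annihilator g))"
  proof (rule ccontr)
    assume "\<not> ?thesis"
    then have "bounded_growth (degree P)
        (\<lambda>t. \<Sum>g\<in>S. quotient_hilbert_function (element_annihilator g) (t - deg g))"
      by (intro bounded_growth_sum bounded_growth_shift) blast
    then have "bounded_growth (degree P) (hilbert_function sm G)"
      by (rule bounded_growth_mono)
          (intro always_eventually allI hilbert_function_le_sum_generators[OF S])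
    then show False using degree_less_if_bounded_growth[OF P] False by blast
  qed
  then obtain g where g: "g \<in> S"
    and growth: "\<not> bounded_growth (degree P) (quotient_hilbert_function (element_annihilator g))" ..
  have "homogeneous_ideal (element_annihilator g)"
    using S(3) g homogeneous_ideal_element_annihilator by blast
  then obtain Q where "prime_chain (element_annihilator g) (Suc (degree P)) Q"
    using prime_chain_if_large_growth growth by blast
  then have "prime_chain (annihilator sm) (Suc (degree P)) Q"
    by (rule prime_chain_mono) (auto simp: annihilator_def element_annihilator_def)
  then show ?thesis using krull_dim_ge Suc_ile_eq by blast
qed simp

lemma forward_diff_hilbert_function_eq_0:
  assumes "finitely_generated sm"
    and "\<And>p t. r < int p + t \<Longrightarrow> local_cohomology_vanishes sm G p t"
    and "\<And>t. t < r \<Longrightarrow> G t = {0}" and "local_cohomology_vanishes sm G 0 r"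
  shows "(forward_diff ^^ CARD('n)) (\<lambda>q. of_nat (hilbert_function sm G (r + int q)) :: 'a::comm_ring_1)
    = (\<lambda>_. 0)"
proof (rule forward_diff_power_eq_0_if_alternating_binomial_sum)
  fix i assume "CARD('n) \<le> i"
  then have "tor_dim sm i = 0" using assms by (intro tor_dim_above_card[where r = r])
  then show "alternating_binomial_sum CARD('n) (\<lambda>q. of_nat (hilbert_function sm G (r + int q))) i
      = (0 :: 'a)"
    using tor_dim_eq_alternating_binomial_sum[where r = r and i = i and 'a = 'a, OF assms(1-3)] by simp
qed

end

section \<open>The Betti numbers\<close>

lemma local_cohomology_vanishes_above_regularity:
  assumes "regularity sm G < ereal (real_of_int (int p + t))"
  shows "local_cohomology_vanishes sm G p t"
proof (rule ccontr)
  assume "\<not> local_cohomology_vanishes sm G p t"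
  then have "ereal (real_of_int (int p + t)) \<le> regularity sm G"
    unfolding regularity_def by (intro SUP_upper2[of "(p, t)"]) auto
  then show False using assms by simp
qed

lemma component_below_indeg: "ereal (real_of_int t) < indeg G \<Longrightarrow> G t = {0}"
  unfolding indeg_def by (metis (mono_tags, lifting) INF_lower leD mem_Collect_eq)

theorem corollary3p4:
  fixes sm :: "('n::{finite,linorder}, 'k::field) mpoly \<Rightarrow> 'm::ab_group_add \<Rightarrow> 'm"
    and G :: "int \<Rightarrow> 'm set"
    and n d i :: nat and r :: int
  assumes "n = CARD('n)" and "n \<ge> 2"
    and "graded_module sm G" and "finitely_generated sm"
    and "\<exists>x::'m. x \<noteq> 0"
    and "krull_dim sm = enat d"
    and "regularity sm G = indeg G" and "indeg G = ereal (real_of_int r)"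
    and "\<forall>t. local_cohomology_vanishes sm G 0 t"
  shows "of_nat (tor_dim sm i) =
    (\<Sum>l = 0..min i (d - 1). (-1) ^ l * of_nat ((n - l - 1) choose (i - l)) *
       poly ((backward_diff ^^ l) (hilbert_poly sm G)) (of_int (r + int l)))"
proof -
  interpret graded sm G by (rule graded_if_graded_module) fact
  have vanishing: "local_cohomology_vanishes sm G p t" if "r < int p + t" for p t
    using assms(7,8) that by (intro local_cohomology_vanishes_above_regularity) simp
  have low: "G t = {0}" if "t < r" for t
    using assms(8) that by (intro component_below_indeg) simp
  define h :: "nat \<Rightarrow> rat" where "h q = of_nat (hilbert_function sm G (r + int q))" for q
  have h: "(forward_diff ^^ n) h = (\<lambda>_. 0)"
    unfolding h_def [abs_def] assms(1)
    by (rule forward_diff_hilbert_function_eq_0[OF assms(4) vanishing low spec[OF assms(9)]])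
  then obtain P where P: "\<forall>q. poly P (of_int r + of_nat q) = h q" by (rule newton_polynomial)
  then have hilbert: "\<forall>\<^sub>F t in at_top. poly P (of_int t) = of_nat (hilbert_function sm G t)"
    unfolding h_def by (rule eventually_eq_if_eq_from)
  have degree: "P = 0 \<or> degree P < d"
    using degree_less_krull_dim[OF assms(4) hilbert] assms(6) by simp
  have diff: "(forward_diff ^^ l) h 0 = poly ((backward_diff ^^ l) P) (of_int (r + int l))" for l
    using poly_backward_diff_power[of P "of_int r" h l 0] P by simp
  have "(forward_diff ^^ l) h 0 = 0" if "d - 1 < l" for l
    using degree that by (subst diff, subst backward_diff_power_eq_0) auto
  moreover have "of_nat (tor_dim sm i) = alternating_binomial_sum n h i"
    unfolding h_def [abs_def] assms(1)
    by (rule tor_dim_eq_alternating_binomial_sum[OF assms(4) vanishing low])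
  ultimately show ?thesis
    unfolding hilbert_poly_eqI[OF hilbert] diff[symmetric]
    by (simp only: alternating_binomial_sum_forward_diff_truncated[OF h])
qed

end
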